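(* Let $\mathfrak g=W(1,1)$ be the Witt algebra over an algebraically closed field $k$ of characteristic $p\ge5$, and let $\chi\in\mathfrak g^*$ be a character of height $r(\chi)=1$. Let $L(\lambda)$, $\lambda\in\mathbb F_p$, be the simple $u(\mathfrak g,\chi)$-modules, and let $\lambda,\mu\in\mathbb F_p$ (the equations below are read in $\mathbb F_p$). (a) For $p=5$, $$\operatorname{Ext}^1_{u(\mathfrak g,\chi)}(L(\mu),L(\lambda))\cong\begin{cases}k&\text{if }\lambda-\mu=2,3,\\0&\text{otherwise.}\end{cases}$$ (b) For $p\ge7$, $$\operatorname{Ext}^1_{u(\mathfrak g,\chi)}(L(\mu),L(\lambda))\cong\begin{cases}k&\text{if }\lambda-\mu=2,3,4,\\0&\text{otherwise.}\end{cases}$$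
   Context: $W(1,1)$ is the $p$-dimensional restricted Lie algebra over $k$ with basis $\{e_i\mid -1\le i\le p-2\}$, bracket $[e_i,e_j]=(j-i)e_{i+j}$ (with $e_{i+j}:=0$ if $i+j\notin\{-1,\dots,p-2\}$) and $p$-mapping $e_i^{[p]}=\delta_{i0}e_i$. Put $\mathfrak g_i=\operatorname{span}(e_i,\dots,e_{p-2})$ for $-1\le i\le p-2$, $\mathfrak b^+=\mathfrak g_0$, $\mathfrak t=ke_0$, $\mathfrak n^+=\mathfrak g_1$. The height of $\chi\in\mathfrak g^*$ is $r(\chi)=\min\{i\mid -1\le i\le p-2,\ \chi|_{\mathfrak g_i}=0\}$ if $\chi(e_{p-2})=0$, and $r(\chi)=p-1$ otherwise. For a restricted Lie algebra $\mathfrak h$ and $\chi\in\mathfrak h^*$, the reduced enveloping algebra is $u(\mathfrak h,\chi)=U(\mathfrak h)/(x^p-x^{[p]}-\chi(x)^p: x\in\mathfrak h)$ (characters are restricted to subalgebras without change of notation). When $r(\chi)=1$ there are $p$ isomorphism classes of simple $u(\mathfrak g,\chi)$-modules, each of dimension $p$. They are labelled as follows. Let $\chi_0\in\mathfrak g^*$ be the character with $\chi_0(e_0)=1$ and $\chi_0(e_i)=0$ for $i\ne0$. The paper asserts that all height $1$ characters are conjugate to $\chi_0$ under the automorphism group of $\mathfrak g$, and on that ground assumes $\chi=\chi_0$ when constructing the modules. Fix $\xi\in k$ with $\xi^p-\xi-1=0$. For $\chi=\chi_0$ and $\lambda\in\mathbb F_p$, let $\lambda+\xi$ also denote the one-dimensional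 $u(\mathfrak b^+,\chi)$-module on which $e_0$ acts by $\lambda+\xi$ and $\mathfrak n^+$ acts by $0$, and set $L(\lambda)=u(\mathfrak g,\chi)\otimes_{u(\mathfrak b^+,\chi)}(\lambda+\xi)$; the $L(\lambda)$, $\lambda\in\mathbb F_p$, represent the $p$ isomorphism classes of simple modules. For a general $\chi$ of height $1$, written $\chi=\chi_0\circ\sigma$ with $\sigma$ an automorphism of $\mathfrak g$, $L(\lambda)$ is the corresponding $u(\mathfrak g,\chi)$-module obtained by letting $x\in\mathfrak g$ act as $\sigma(x)$ does on the module just constructed for $\chi_0$.
   Formalization: The character is assumed to have the form χ = χ₀∘σ with σ an automorphism of g; not every height 1 character is of this form (χ(e₀)=1 is forced, so 2χ₀ is not), and L(λ) is defined only for those that are. *)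

theory Defs
  imports
    "HOL-Computational_Algebra.Computational_Algebra"
    "HOL-Algebra.QuotRing"
    "HOL-Algebra.Module"
    "HOL-Algebra.Free_Abelian_Groups"
begin

text \<open>
  Throughout, \<open>k\<close> is the field given by the type variable \<open>'k\<close> and \<open>p\<close> is its characteristic
  \<open>CHAR('k)\<close>.
\<close>

section \<open>The Witt algebra\<close>

text \<open>The element \<open>\<Sum>i. a i * e\<^sub>i\<close> is represented by its coefficient function \<open>a\<close>.\<close>

type_synonym 'k lie = "int \<Rightarrow>\<^sub>0 'k"

definition scale :: "'k::field \<Rightarrow> ('a \<Rightarrow>\<^sub>0 'k) \<Rightarrow> ('a \<Rightarrow>\<^sub>0 'k)" where
  "scale c x = Poly_Mapping.map (\<lambda>a. c * a) x"

definition witt_e :: "int \<Rightarrow> 'k::field lie" where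
  "witt_e i = Poly_Mapping.single i 1"

text \<open>\<open>witt_filt i\<close> is the span of \<open>e\<^sub>i, \<dots>, e\<^bsub>p-2\<^esub>\<close>.\<close>

definition witt_filt :: "int \<Rightarrow> 'k::field lie set" where
  "witt_filt i = {x. Poly_Mapping.keys x \<subseteq> {i..int CHAR('k) - 2}}"

definition witt :: "'k::field lie set" where
  "witt = witt_filt (-1)"

definition witt_borel :: "'k::field lie set" where
  "witt_borel = witt_filt 0"

definition witt_bracket :: "'k::field lie \<Rightarrow> 'k lie \<Rightarrow> 'k lie" where
  "witt_bracket x y =
    (\<Sum>i\<in>Poly_Mapping.keys x. \<Sum>j\<in>Poly_Mapping.keys y.
       if i + j \<in> {-1..int CHAR('k) - 2}
       then scale (of_int (j - i) * Poly_Mapping.lookup x i * Poly_Mapping.lookup y j) (witt_e (i + j))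
       else 0)"

text \<open>
  The prescribed values \<open>e\<^sub>i\<^bsup>[p]\<^esup> = \<delta>\<^bsub>i0\<^esub> e\<^sub>i\<close> have a unique extension to a \<open>p\<close>-mapping, because the
  centre of the Witt algebra is zero.  To write it down for all elements, let \<open>e\<^sub>i\<close> act on
  \<open>k[X]/(X\<^sup>p)\<close> as the derivation \<open>X\<^bsup>i+1\<^esup> d/dX\<close>.  The \<open>p\<close>-th power of a derivation \<open>D\<close> is again a
  derivation in characteristic \<open>p\<close>, hence equals \<open>D\<^sup>p(X) d/dX\<close>; this is \<open>x\<^bsup>[p]\<^esup>\<close> when \<open>D\<close> is the
  action of \<open>x\<close>.
\<close>

definition witt_der :: "'k::field lie \<Rightarrow> 'k poly \<Rightarrow> 'k poly" where
  "witt_der x f =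
    ((\<Sum>i\<in>{-1..int CHAR('k) - 2}. Polynomial.monom (Poly_Mapping.lookup x i) (nat (i + 1))) * pderiv f)
      mod Polynomial.monom 1 CHAR('k)"

definition witt_pmap :: "'k::field lie \<Rightarrow> 'k lie" where
  "witt_pmap x =
    (\<Sum>i\<in>{-1..int CHAR('k) - 2}.
       scale (Polynomial.coeff ((witt_der x ^^ CHAR('k)) (Polynomial.monom 1 1)) (nat (i + 1))) (witt_e i))"

lemma mod_monom: "Polynomial.monom (c::'k::field) m mod Polynomial.monom 1 n = (if m < n then Polynomial.monom c m else 0)"
proof (cases "m < n")
  case True
  then show ?thesis
    by (cases "c = 0") (auto intro!: mod_poly_less simp: Polynomial.degree_monom_eq)
next
  case False
  then have "Polynomial.monom c m = Polynomial.monom c (m - n) * Polynomial.monom 1 n"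
    by (simp add: Polynomial.mult_monom)
  with False show ?thesis by simp
qed

lemma witt_der_e:
  assumes "i \<in> {-1..int CHAR('k) - 2}"
  shows "witt_der (witt_e i) f = (Polynomial.monom (1::'k::field) (nat (i + 1)) * pderiv f) mod Polynomial.monom 1 CHAR('k)"
proof -
  have "(\<Sum>j\<in>{-1..int CHAR('k) - 2}. Polynomial.monom (Poly_Mapping.lookup (witt_e i) j) (nat (j + 1)))
    = (\<Sum>j\<in>{-1..int CHAR('k) - 2}. if j = i then Polynomial.monom (1::'k) (nat (i + 1)) else 0)"
    by (rule sum.cong) (auto simp: witt_e_def lookup_single when_def)
  with assms show ?thesis by (simp add: witt_der_def)
qed

lemma witt_pmap_e:
  assumes "CHAR('k::field) > 0" "i \<in> {-1..int CHAR('k) - 2}"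
  shows "witt_pmap (witt_e i :: 'k lie) = (if i = 0 then witt_e 0 else 0)"
proof -
  let ?p = "CHAR('k)" and ?X = "Polynomial.monom (1::'k) 1"
  have p: "?p \<ge> 2"
    using prime_CHAR_semidom[OF assms(1)] by (rule prime_ge_2_nat)
  have D: "witt_der (witt_e i) (Polynomial.monom c (Suc m)) =
      (if nat (i + 1) + m < ?p then Polynomial.monom (of_nat (Suc m) * c) (nat (i + 1) + m) else 0)"
    for c :: 'k and m
    unfolding witt_der_e[OF assms(2)] by (simp add: pderiv_monom Polynomial.mult_monom mod_monom del: of_nat_Suc)
  have D0: "(witt_der (witt_e i) ^^ n) (0::'k poly) = 0" for n
    by (induction n) (simp_all add: witt_der_def)
  consider "i = 0" | "i = -1" | "i \<ge> 1" using assms(2) by fastforce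
  then have "(witt_der (witt_e i) ^^ ?p) ?X = (if i = 0 then ?X else 0)"
  proof cases
    case 1
    then have "witt_der (witt_e i) ?X = ?X" using D[of 1 0] p by simp
    then have "(witt_der (witt_e i) ^^ n) ?X = ?X" for n by (induction n) simp_all
    with 1 show ?thesis by simp
  next
    case 2
    then have "witt_der (witt_e i) ?X = 1" using D[of 1 0] p by (simp add: one_poly_eq_simps monom_0)
    moreover have "witt_der (witt_e i) (1::'k poly) = 0" by (simp add: witt_der_def)
    ultimately have "(witt_der (witt_e i) ^^ Suc (Suc n)) ?X = 0" for n
      by (simp only: funpow_Suc_right o_def D0)
    from this[of "?p - 2"] p 2 show ?thesis by (simp add: numeral_2_eq_2 Suc_diff_Suc del: funpow.simps)
  next
    case 3
    have "\<exists>c. (witt_der (witt_e i) ^^ n) ?X = (if n * nat i < ?p - 1 then Polynomial.monom c (Suc (n * nat i)) else 0)" for n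
    proof (induction n)
      case 0
      then show ?case using p by auto
    next
      case (Suc n)
      then obtain c where c: "(witt_der (witt_e i) ^^ n) ?X = (if n * nat i < ?p - 1 then Polynomial.monom c (Suc (n * nat i)) else 0)" ..
      have z: "witt_der (witt_e i) (0::'k poly) = 0" using D0[of 1] by simp
      have "nat (i + 1) = Suc (nat i)" using 3 by simp
      then show ?case
        unfolding funpow.simps(2) o_def c using p by (auto simp: D z simp del: of_nat_Suc)
    qed
    then obtain c where "(witt_der (witt_e i) ^^ ?p) ?X = (if ?p * nat i < ?p - 1 then Polynomial.monom c (Suc (?p * nat i)) else 0)" by blast
    moreover have "nat i \<ge> 1" using 3 by linarith
    then have "?p * 1 \<le> ?p * nat i" by (rule mult_le_mono2)
    then have "\<not> ?p * nat i < ?p - 1" by linarith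
    ultimately show ?thesis using 3 by (simp only: if_False) simp
  qed
  moreover have "(\<Sum>j\<in>{-1..int ?p - 2}. scale (Polynomial.coeff ?X (nat (j + 1))) (witt_e j))
     = (\<Sum>j\<in>{-1..int ?p - 2}. if j = 0 then witt_e 0 else (0 :: 'k lie))"
    by (rule sum.cong) (auto simp: scale_def witt_e_def poly_mapping_eq_iff fun_eq_iff map.rep_eq when_def nat_eq_iff2)
  moreover have "scale 0 x = 0" for x :: "'k lie"
    by (auto simp: scale_def poly_mapping_eq_iff fun_eq_iff map.rep_eq when_def)
  ultimately show ?thesis using p by (simp add: witt_pmap_def)
qed

definition witt_aut :: "('k::field lie \<Rightarrow> 'k lie) set" where
  "witt_aut = {\<sigma>. bij_betw \<sigma> witt witt
     \<and> (\<forall>x\<in>witt. \<forall>y\<in>witt. \<sigma> (x + y) = \<sigma> x + \<sigma> y)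
     \<and> (\<forall>c. \<forall>x\<in>witt. \<sigma> (scale c x) = scale c (\<sigma> x))
     \<and> (\<forall>x\<in>witt. \<forall>y\<in>witt. \<sigma> (witt_bracket x y) = witt_bracket (\<sigma> x) (\<sigma> y))}"

text \<open>Linear forms on the Witt algebra; their values outside \<^const>\<open>witt\<close> are irrelevant.\<close>

definition witt_dual :: "('k::field lie \<Rightarrow> 'k) set" where
  "witt_dual = {\<chi>. (\<forall>x\<in>witt. \<forall>y\<in>witt. \<chi> (x + y) = \<chi> x + \<chi> y)
     \<and> (\<forall>c. \<forall>x\<in>witt. \<chi> (scale c x) = c * \<chi> x)}"

definition height :: "('k::field lie \<Rightarrow> 'k) \<Rightarrow> int" where
  "height \<chi> =
    (if \<chi> (witt_e (int CHAR('k) - 2)) = 0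
     then Min {i \<in> {-1..int CHAR('k) - 2}. \<forall>x\<in>witt_filt i. \<chi> x = 0}
     else int CHAR('k) - 1)"

definition chi0 :: "'k::field lie \<Rightarrow> 'k" where
  "chi0 x = Poly_Mapping.lookup x 0"


section \<open>Reduced enveloping algebras\<close>

text \<open>
  The free associative unital \<open>k\<close>-algebra on a set \<open>h\<close>: finitely supported functions on words, with
  multiplication induced by concatenation.
\<close>

type_synonym 'k free = "'k lie list \<Rightarrow>\<^sub>0 'k"

definition free_alg :: "'k::field lie set \<Rightarrow> 'k free ring" where
  "free_alg h =
    \<lparr>carrier = {f. \<forall>w\<in>Poly_Mapping.keys f. set w \<subseteq> h},
     monoid.mult = (\<lambda>f g. \<Sum>u\<in>Poly_Mapping.keys f. \<Sum>v\<in>Poly_Mapping.keys g.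
       Poly_Mapping.single (u @ v) (Poly_Mapping.lookup f u * Poly_Mapping.lookup g v)),
     monoid.one = Poly_Mapping.single [] 1,
     ring.zero = 0,
     ring.add = (+)\<rparr>"

definition free_gen :: "'k::field lie \<Rightarrow> 'k free" where
  "free_gen x = Poly_Mapping.single [x] 1"

definition free_scalar :: "'k::field \<Rightarrow> 'k free" where
  "free_scalar c = Poly_Mapping.single [] c"

lemma free_alg_mult:
  assumes "finite A" "finite B" "Poly_Mapping.keys f \<subseteq> A" "Poly_Mapping.keys g \<subseteq> B"
  shows "f \<otimes>\<^bsub>free_alg h\<^esub> g = (\<Sum>u\<in>A. \<Sum>v\<in>B.
    Poly_Mapping.single (u @ v) (Poly_Mapping.lookup f u * Poly_Mapping.lookup g v))"
  unfolding free_alg_def monoid.simps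
  apply (rule sum.mono_neutral_cong_left[OF assms(1,3)])
   apply (simp add: in_keys_iff)
  apply (rule sum.mono_neutral_cong_left[OF assms(2,4)])
   apply (simp_all add: in_keys_iff)
  done

lemma free_alg_single:
  "Poly_Mapping.single u a \<otimes>\<^bsub>free_alg h\<^esub> Poly_Mapping.single v b = Poly_Mapping.single (u @ v) (a * b)"
  by (subst free_alg_mult[of "{u}" "{v}"]) auto

lemma free_alg_distrib_left:
  "(f + g) \<otimes>\<^bsub>free_alg h\<^esub> k = f \<otimes>\<^bsub>free_alg h\<^esub> k + g \<otimes>\<^bsub>free_alg h\<^esub> k"
  by (subst (1 2 3) free_alg_mult[of "Poly_Mapping.keys f \<union> Poly_Mapping.keys g" "Poly_Mapping.keys k"])
    (auto simp: Poly_Mapping.keys_add lookup_add algebra_simps single_add sum.distrib)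

lemma free_alg_distrib_right:
  "k \<otimes>\<^bsub>free_alg h\<^esub> (f + g) = k \<otimes>\<^bsub>free_alg h\<^esub> f + k \<otimes>\<^bsub>free_alg h\<^esub> g"
  by (subst (1 2 3) free_alg_mult[of "Poly_Mapping.keys k" "Poly_Mapping.keys f \<union> Poly_Mapping.keys g"])
    (auto simp: Poly_Mapping.keys_add lookup_add algebra_simps single_add sum.distrib)

lemma free_alg_zero: "0 \<otimes>\<^bsub>free_alg h\<^esub> f = 0" "f \<otimes>\<^bsub>free_alg h\<^esub> 0 = 0"
  by (simp_all add: free_alg_def)

lemma free_induct:
  fixes f :: "'k::field free"
  assumes "P 0" "\<And>w c. P (Poly_Mapping.single w c)" "\<And>f g. P f \<Longrightarrow> P g \<Longrightarrow> P (f + g)"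
  shows "P f"
proof (induction f rule: update_induct)
  case const
  then show ?case by (rule assms)
next
  case (update f a b)
  then have "Poly_Mapping.update a b f = f + Poly_Mapping.single a b"
    by (intro poly_mapping_eqI) (auto simp: lookup_update lookup_add in_keys_iff lookup_single when_def)
  with update assms show ?case by simp
qed

lemma free_alg_assoc:
  "f \<otimes>\<^bsub>free_alg h\<^esub> g \<otimes>\<^bsub>free_alg h\<^esub> k = f \<otimes>\<^bsub>free_alg h\<^esub> (g \<otimes>\<^bsub>free_alg h\<^esub> k)"
proof (induction f rule: free_induct)
  case (2 u a)
  show ?case
  proof (induction g rule: free_induct)
    case (2 v b)
    show ?case
      by (induction k rule: free_induct)
        (simp_all add: free_alg_single free_alg_zero free_alg_distrib_right mult.assoc)
  qed (simp_all add: free_alg_zero free_alg_distrib_left free_alg_distrib_right)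
qed (simp_all add: free_alg_zero free_alg_distrib_left)

lemma free_alg_keys:
  "Poly_Mapping.keys (f \<otimes>\<^bsub>free_alg h\<^esub> g)
     \<subseteq> (\<lambda>(u, v). u @ v) ` (Poly_Mapping.keys f \<times> Poly_Mapping.keys g)"
  unfolding free_alg_def monoid.simps
  apply (rule order_trans[OF keys_sum])
  apply (rule UN_least)
  apply (rule order_trans[OF keys_sum])
  apply (auto split: if_splits)
  done

lemma ring_free_alg: "ring (free_alg h)"
proof (intro ringI abelian_groupI monoidI, goal_cases)
  case (1 x y)
  then show ?case using Poly_Mapping.keys_add[of x y] by (auto simp: free_alg_def)
next
  case (6 x)
  then show ?case by (intro bexI[of _ "-x"]) (auto simp: free_alg_def)
next
  case (7 x y)
  then show ?case using free_alg_keys[where f = x and g = y and h = h] by (fastforce simp: free_alg_def)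
next
  case (10 f)
  have "Poly_Mapping.single [] 1 \<otimes>\<^bsub>free_alg h\<^esub> f = f"
    by (induction f rule: free_induct)
      (simp_all add: free_alg_zero free_alg_single free_alg_distrib_right)
  then show ?case by (simp add: free_alg_def)
next
  case (11 f)
  have "f \<otimes>\<^bsub>free_alg h\<^esub> Poly_Mapping.single [] 1 = f"
    by (induction f rule: free_induct)
      (simp_all add: free_alg_zero free_alg_single free_alg_distrib_left)
  then show ?case by (simp add: free_alg_def)
next
  case (12 f g k)
  then show ?case using free_alg_distrib_left[where f = f and g = g and h = h and k = k] by (simp add: free_alg_def)
next
  case (13 f g k)
  then show ?case using free_alg_distrib_right[where f = f and g = g and h = h and k = k] by (simp add: free_alg_def)
qed (auto simp: free_alg_assoc, auto simp: free_alg_def add_ac)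

text \<open>
  The universal enveloping algebra of a subalgebra \<open>h\<close>.  The first two families of relations turn
  the free algebra on the set \<open>h\<close> into the tensor algebra of the vector space \<open>h\<close>.
\<close>

definition env_ideal :: "'k::field lie set \<Rightarrow> 'k free set" where
  "env_ideal h = Idl\<^bsub>free_alg h\<^esub>
    ({free_gen (x + y) - free_gen x - free_gen y | x y. x \<in> h \<and> y \<in> h}
     \<union> {free_gen (scale c x) - scale c (free_gen x) | c x. x \<in> h}
     \<union> {free_gen x \<otimes>\<^bsub>free_alg h\<^esub> free_gen y - free_gen y \<otimes>\<^bsub>free_alg h\<^esub> free_gen x
          - free_gen (witt_bracket x y) | x y. x \<in> h \<and> y \<in> h})"

definition env :: "'k::field lie set \<Rightarrow> 'k free set ring" where
  "env h = free_alg h Quot env_ideal h"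

definition env_class :: "'k::field lie set \<Rightarrow> 'k free \<Rightarrow> 'k free set" where
  "env_class h f = env_ideal h +>\<^bsub>free_alg h\<^esub> f"

definition red_ideal :: "'k::field lie set \<Rightarrow> ('k lie \<Rightarrow> 'k) \<Rightarrow> 'k free set set" where
  "red_ideal h \<chi> = Idl\<^bsub>env h\<^esub>
    {env_class h (free_gen x) [^]\<^bsub>env h\<^esub> CHAR('k)
       \<ominus>\<^bsub>env h\<^esub> env_class h (free_gen (witt_pmap x))
       \<ominus>\<^bsub>env h\<^esub> env_class h (free_scalar (\<chi> x ^ CHAR('k))) | x. x \<in> h}"

type_synonym 'k red = "'k free set set"

definition red_env :: "'k::field lie set \<Rightarrow> ('k lie \<Rightarrow> 'k) \<Rightarrow> 'k red ring" where
  "red_env h \<chi> = env h Quot red_ideal h \<chi>"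

definition red_class :: "'k::field lie set \<Rightarrow> ('k lie \<Rightarrow> 'k) \<Rightarrow> 'k free \<Rightarrow> 'k red" where
  "red_class h \<chi> f = red_ideal h \<chi> +>\<^bsub>env h\<^esub> env_class h f"

definition red_rep :: "'k::field lie set \<Rightarrow> ('k lie \<Rightarrow> 'k) \<Rightarrow> 'k red \<Rightarrow> 'k free" where
  "red_rep h \<chi> a = (SOME f. f \<in> carrier (free_alg h) \<and> red_class h \<chi> f = a)"

definition red_scalar :: "'k::field lie set \<Rightarrow> ('k lie \<Rightarrow> 'k) \<Rightarrow> 'k \<Rightarrow> 'k red" where
  "red_scalar h \<chi> c = red_class h \<chi> (free_scalar c)"

text \<open>
  The algebra homomorphism \<open>u(h,\<chi>) \<rightarrow> u(h',\<chi>')\<close> induced by a homomorphism \<open>\<phi> : h \<rightarrow> h'\<close> of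
  restricted Lie algebras with \<open>\<chi> = \<chi>' \<circ> \<phi>\<close>.
\<close>

definition free_map :: "('k lie \<Rightarrow> 'k lie) \<Rightarrow> 'k::field free \<Rightarrow> 'k free" where
  "free_map \<phi> f =
    (\<Sum>w\<in>Poly_Mapping.keys f. Poly_Mapping.single (map \<phi> w) (Poly_Mapping.lookup f w))"

definition red_map ::
  "'k::field lie set \<Rightarrow> ('k lie \<Rightarrow> 'k) \<Rightarrow> 'k lie set \<Rightarrow> ('k lie \<Rightarrow> 'k) \<Rightarrow> ('k lie \<Rightarrow> 'k lie)
    \<Rightarrow> 'k red \<Rightarrow> 'k red" where
  "red_map h \<chi> h' \<chi>' \<phi> a = red_class h' \<chi>' (free_map \<phi> (red_rep h \<chi> a))"


section \<open>Left modules, extension of scalars and \<open>Ext\<^sup>1\<close>\<close>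

text \<open>
  A left module over a possibly noncommutative ring is given by a \<open>module\<close> record, of which the
  fields \<open>mult\<close> and \<open>one\<close> are not used.
\<close>

text \<open>
  The tensor product of \<open>A\<close> and a left \<open>R\<close>-module \<open>N\<close> over \<open>R\<close>, where \<open>A\<close> is a right \<open>R\<close>-module
  through the ring homomorphism \<open>\<iota> : R \<rightarrow> A\<close>: the free abelian group on \<open>A \<times> N\<close> modulo the
  bilinearity and balancing relations, with \<open>A\<close> acting on the left factor.
\<close>

definition tensor_relations ::
  "('a, 'x) ring_scheme \<Rightarrow> ('r, 'y) ring_scheme \<Rightarrow> ('r \<Rightarrow> 'a) \<Rightarrow> ('r, 'n) module
    \<Rightarrow> ('a \<times> 'n \<Rightarrow>\<^sub>0 int) set" where
  "tensor_relations A R \<iota> N =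
    {frag_of (a \<oplus>\<^bsub>A\<^esub> b, n) - frag_of (a, n) - frag_of (b, n)
      | a b n. a \<in> carrier A \<and> b \<in> carrier A \<and> n \<in> carrier N}
    \<union> {frag_of (a, m \<oplus>\<^bsub>N\<^esub> n) - frag_of (a, m) - frag_of (a, n)
      | a m n. a \<in> carrier A \<and> m \<in> carrier N \<and> n \<in> carrier N}
    \<union> {frag_of (a \<otimes>\<^bsub>A\<^esub> \<iota> r, n) - frag_of (a, r \<odot>\<^bsub>N\<^esub> n)
      | a r n. a \<in> carrier A \<and> r \<in> carrier R \<and> n \<in> carrier N}"

definition tensor_subgroup ::
  "('a, 'x) ring_scheme \<Rightarrow> ('r, 'y) ring_scheme \<Rightarrow> ('r \<Rightarrow> 'a) \<Rightarrow> ('r, 'n) module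
    \<Rightarrow> ('a \<times> 'n \<Rightarrow>\<^sub>0 int) set" where
  "tensor_subgroup A R \<iota> N =
    generate (free_Abelian_group (carrier A \<times> carrier N)) (tensor_relations A R \<iota> N)"

definition induced_module ::
  "('a, 'x) ring_scheme \<Rightarrow> ('r, 'y) ring_scheme \<Rightarrow> ('r \<Rightarrow> 'a) \<Rightarrow> ('r, 'n) module
    \<Rightarrow> ('a, ('a \<times> 'n \<Rightarrow>\<^sub>0 int) set) module" where
  "induced_module A R \<iota> N =
    (let F = free_Abelian_group (carrier A \<times> carrier N);
         T = tensor_subgroup A R \<iota> N
     in \<lparr>carrier = carrier (F Mod T),
         monoid.mult = undefined, monoid.one = undefined,
         ring.zero = \<one>\<^bsub>F Mod T\<^esub>,
         ring.add = (\<lambda>t u. t \<otimes>\<^bsub>F Mod T\<^esub> u),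
         smult = (\<lambda>a t. T #>\<^bsub>F\<^esub>
           frag_extend (\<lambda>(b, n). frag_of (a \<otimes>\<^bsub>A\<^esub> b, n)) (SOME c. c \<in> t))\<rparr>)"

definition mod_hom ::
  "('a, 'x) ring_scheme \<Rightarrow> ('a, 'm) module \<Rightarrow> ('a, 'n) module \<Rightarrow> ('m \<Rightarrow> 'n) set" where
  "mod_hom A M N = {f \<in> carrier M \<rightarrow>\<^sub>E carrier N.
     (\<forall>x\<in>carrier M. \<forall>y\<in>carrier M. f (x \<oplus>\<^bsub>M\<^esub> y) = f x \<oplus>\<^bsub>N\<^esub> f y)
     \<and> (\<forall>a\<in>carrier A. \<forall>x\<in>carrier M. f (a \<odot>\<^bsub>M\<^esub> x) = a \<odot>\<^bsub>N\<^esub> f x)}"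

definition free_mod :: "('a, 'x) ring_scheme \<Rightarrow> 'm set \<Rightarrow> ('a, 'm \<Rightarrow> 'a) module" where
  "free_mod A X =
    \<lparr>carrier = {f. finite {x. f x \<noteq> \<zero>\<^bsub>A\<^esub>} \<and> {x. f x \<noteq> \<zero>\<^bsub>A\<^esub>} \<subseteq> X \<and> range f \<subseteq> carrier A},
     monoid.mult = undefined, monoid.one = undefined,
     ring.zero = (\<lambda>x. \<zero>\<^bsub>A\<^esub>),
     ring.add = (\<lambda>f g x. f x \<oplus>\<^bsub>A\<^esub> g x),
     smult = (\<lambda>a f x. a \<otimes>\<^bsub>A\<^esub> f x)\<rparr>"

text \<open>
  \<open>0 \<rightarrow> syzygy A M \<rightarrow> free_mod A (carrier M) \<rightarrow> M \<rightarrow> 0\<close> is the canonical projective presentation of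
  \<open>M\<close>, and \<open>Ext\<^sup>1(M, N)\<close> is the cokernel of the restriction map
  \<open>Hom(free_mod A (carrier M), N) \<rightarrow> Hom(syzygy A M, N)\<close>.  It is a \<open>k\<close>-vector space through a
  homomorphism \<open>s\<close> from \<open>k\<close> to the centre of \<open>A\<close>.
\<close>

definition syzygy :: "('a, 'x) ring_scheme \<Rightarrow> ('a, 'm) module \<Rightarrow> ('a, 'm \<Rightarrow> 'a) module" where
  "syzygy A M = (free_mod A (carrier M))
    \<lparr>carrier := {f \<in> carrier (free_mod A (carrier M)).
       (\<Oplus>\<^bsub>M\<^esub>m\<in>{m. f m \<noteq> \<zero>\<^bsub>A\<^esub>}. f m \<odot>\<^bsub>M\<^esub> m) = \<zero>\<^bsub>M\<^esub>}\<rparr>"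

definition hom_space ::
  "('a, 'x) ring_scheme \<Rightarrow> ('k \<Rightarrow> 'a) \<Rightarrow> ('a, 'm) module \<Rightarrow> ('a, 'n) module
    \<Rightarrow> ('k, 'm \<Rightarrow> 'n) module" where
  "hom_space A s M N =
    \<lparr>carrier = mod_hom A M N,
     monoid.mult = undefined, monoid.one = undefined,
     ring.zero = (\<lambda>x\<in>carrier M. \<zero>\<^bsub>N\<^esub>),
     ring.add = (\<lambda>f g. \<lambda>x\<in>carrier M. f x \<oplus>\<^bsub>N\<^esub> g x),
     smult = (\<lambda>c f. \<lambda>x\<in>carrier M. s c \<odot>\<^bsub>N\<^esub> f x)\<rparr>"

definition quot_space :: "('k, 'v) module \<Rightarrow> 'v set \<Rightarrow> ('k, 'v set) module" where
  "quot_space V H =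
    \<lparr>carrier = a_rcosets\<^bsub>V\<^esub> H,
     monoid.mult = undefined, monoid.one = undefined,
     ring.zero = H,
     ring.add = (\<lambda>X Y. X <+>\<^bsub>V\<^esub> Y),
     smult = (\<lambda>c X. H +>\<^bsub>V\<^esub> (c \<odot>\<^bsub>V\<^esub> (SOME v. v \<in> X)))\<rparr>"

definition Ext1 ::
  "('a, 'x) ring_scheme \<Rightarrow> ('k \<Rightarrow> 'a) \<Rightarrow> ('a, 'm) module \<Rightarrow> ('a, 'n) module
    \<Rightarrow> ('k, (('m \<Rightarrow> 'a) \<Rightarrow> 'n) set) module" where
  "Ext1 A s M N =
    quot_space (hom_space A s (syzygy A M) N)
      ((\<lambda>f. restrict f (carrier (syzygy A M))) ` mod_hom A (free_mod A (carrier M)) N)"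

definition vs_iso :: "('k, 'v) module \<Rightarrow> ('k, 'w) module \<Rightarrow> bool" where
  "vs_iso V W \<longleftrightarrow> (\<exists>\<phi>. bij_betw \<phi> (carrier V) (carrier W)
     \<and> (\<forall>x\<in>carrier V. \<forall>y\<in>carrier V. \<phi> (x \<oplus>\<^bsub>V\<^esub> y) = \<phi> x \<oplus>\<^bsub>W\<^esub> \<phi> y)
     \<and> (\<forall>c. \<forall>x\<in>carrier V. \<phi> (c \<odot>\<^bsub>V\<^esub> x) = c \<odot>\<^bsub>W\<^esub> \<phi> x))"

definition line :: "('k::field, 'k) module" where
  "line = \<lparr>carrier = UNIV, monoid.mult = (*), monoid.one = 1, ring.zero = 0, ring.add = (+), smult = (*)\<rparr>"

definition zero_space :: "('k::field, 'k) module" where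
  "zero_space = line\<lparr>carrier := {0}\<rparr>"


section \<open>The modules \<open>L(\<lambda>)\<close>\<close>

text \<open>
  The one-dimensional module over \<open>u(b\<^sup>+, \<chi>\<^sub>0)\<close> on which \<open>e\<^sub>0\<close> acts by \<open>c\<close> and \<open>n\<^sup>+\<close> by zero, i.e.
  \<open>x\<close> acts by \<open>c\<close> times its \<open>e\<^sub>0\<close>-coefficient and a word acts by the product of its letters.  It is
  well defined if \<open>c\<^sup>p - c = 1\<close>.
\<close>

definition borel_module :: "'k::field \<Rightarrow> ('k red, 'k) module" where
  "borel_module c = \<lparr>carrier = UNIV, monoid.mult = undefined, monoid.one = undefined, ring.zero = 0, ring.add = (+),
     smult = (\<lambda>a v. (let f = red_rep witt_borel chi0 a in
       \<Sum>w\<in>Poly_Mapping.keys f.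
         Poly_Mapping.lookup f w * prod_list (map (\<lambda>x. c * Poly_Mapping.lookup x 0) w)) * v)\<rparr>"

type_synonym 'k ind = "('k red \<times> 'k \<Rightarrow>\<^sub>0 int) set"

definition L_chi0 :: "'k::field \<Rightarrow> 'k \<Rightarrow> ('k red, 'k ind) module" where
  "L_chi0 \<xi> l = induced_module (red_env witt chi0) (red_env witt_borel chi0)
     (red_map witt_borel chi0 witt chi0 id) (borel_module (l + \<xi>))"

text \<open>The \<open>u(g, \<chi>)\<close>-module \<open>L(\<lambda>)\<close> for a character of the form \<open>\<chi> = \<chi>\<^sub>0 \<circ> \<sigma>\<close>.\<close>

definition L_mod ::
  "'k::field \<Rightarrow> ('k lie \<Rightarrow> 'k) \<Rightarrow> ('k lie \<Rightarrow> 'k lie) \<Rightarrow> 'k \<Rightarrow> ('k red, 'k ind) module" where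
  "L_mod \<xi> \<chi> \<sigma> l = (L_chi0 \<xi> l)
    \<lparr>smult := (\<lambda>a m. red_map witt \<chi> witt chi0 \<sigma> a \<odot>\<^bsub>L_chi0 \<xi> l\<^esub> m)\<rparr>"

end

theory Submission
  imports Defs "HOL-Library.Product_Plus"
begin

text \<open>
  Up to isomorphism \<open>L(\<lambda>)\<close> is a module of tensor densities on the truncated polynomial ring
  \<open>k[X]/(X\<^sup>p)\<close>.  Let \<open>e\<^sub>i\<close> stand for the vector field \<open>X\<^bsup>i+1\<^esup> d/dX\<close> and put \<open>c = \<lambda> + \<xi> + 1\<close>.  Then
  \<open>x\<close> acts on \<open>L(\<lambda>)\<close> as \<open>f \<mapsto> a f' + c a' f\<close>, where \<open>a d/dX\<close> is the vector field of \<open>\<sigma> x\<close>, and the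
  generator \<open>1 \<otimes> 1\<close> corresponds to \<open>X\<^bsup>p-1\<^esup>\<close> (\<open>L_iso\<close>, \<open>L_mod_models\<close>).  That these operators have
  \<open>p\<close>-character \<open>\<chi>\<close> rests on the identity
  \<open>(a d/dX + c a')\<^sup>p = b d/dX + c b' + (c\<^sup>p - c) (a')\<^sup>p\<close> with \<open>b = (a d/dX)\<^sup>p X\<close>
  (\<open>density_funpow_CHAR\<close>).  Its case \<open>c = -1\<close> says that \<open>ad(x)\<^sup>p = ad(x\<^bsup>[p]\<^esup>)\<close>; since the centre of the
  Witt algebra is zero, every automorphism \<open>\<sigma>\<close> commutes with the \<open>p\<close>-map, and the general character
  can be treated like \<open>\<chi>\<^sub>0\<close>.

  The module \<open>L(\<mu>)\<close> is cyclic, and the annihilator \<open>J\<close> of its generator is the left ideal generated by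
  \<open>e\<^sub>0 - (\<mu> + \<xi>)\<close> and \<open>e\<^sub>1, \<dots>, e\<^bsub>p-2\<^esub>\<close> (\<open>annihilator\<close>).  Hence \<open>Ext\<^sup>1(L(\<mu>), L(\<lambda>))\<close> is the space of
  homomorphisms \<open>h : J \<rightarrow> L(\<lambda>)\<close> modulo those of the form \<open>a \<mapsto> a y\<close> (\<open>Ext1_zero\<close>, \<open>Ext1_line\<close>).
  Subtracting such a map one can achieve \<open>h(e\<^sub>0 - (\<mu> + \<xi>)) = 0\<close>, because \<open>e\<^sub>0\<close> is a root of the separable
  polynomial \<open>T\<^sup>p - T - 1\<close>, and then \<open>h(e\<^sub>1) = 0\<close>, because \<open>e\<^sub>1\<close> maps every weight line except the last
  one onto the next; if \<open>\<lambda> = \<mu>\<close>, then \<open>e\<^sub>1\<^sup>p = 0\<close> gives \<open>h(e\<^sub>1) = 0\<close> instead (\<open>normalise\<close>).  After this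
  \<open>h\<close> is determined by \<open>h(e\<^sub>2)\<close>, which lies in a single weight line.  So \<open>Ext\<^sup>1\<close> has dimension at most
  one.

  Let \<open>d = \<lambda> - \<mu>\<close>.  If \<open>p \<ge> 7\<close> and \<open>d\<close> is not \<open>2, 3, 4\<close>, the relation \<open>3 [e\<^sub>2, e\<^sub>3] = [e\<^sub>1, e\<^sub>4]\<close> says that
  a cubic polynomial over the prime field, evaluated at \<open>c\<close>, kills \<open>h(e\<^sub>2)\<close>; but \<open>c\<close> has degree \<open>p\<close> over
  the prime field, so \<open>h(e\<^sub>2) = 0\<close>.  If \<open>p = 5\<close> and \<open>d\<close> is not \<open>2, 3\<close>, the relation \<open>[e\<^sub>1, e\<^sub>3] = 0\<close>
  has the same effect (\<open>E_2_vanishes\<close>).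

  In the remaining cases a nonzero class comes from an extension of density modules by a cocycle:
  \<open>a''' f\<close> for \<open>d = 2\<close>, \<open>2 a''' f' - c a'''' f\<close> for \<open>d = 3\<close>, and
  \<open>10 a''' f'' - 5 (2c + 1) a'''' f' + c (2c + 1) a''''' f\<close> for \<open>d = 4\<close>.  The extension again has
  \<open>p\<close>-character \<open>\<chi>\<close>: the defect of the \<open>p\<close>-th power relation commutes with all vector fields, so it
  induces a homomorphism between density modules with different weights, and that is zero
  (\<open>ext_act_pow\<close>).  The class is not trivial, because the cocycle vanishes at \<open>e\<^sub>0\<close> and \<open>e\<^sub>1\<close> but not at
  \<open>e\<^sub>2\<close> (\<open>coc_E2\<close>, \<open>hom_not_principal\<close>).
\<close>

section \<open>Powers of derivations in characteristic p\<close>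

lemma (in vector_space) leibniz_funpow:
  assumes der: "\<And>f h. U (B f h) = B (S f) h + B f (T h)"
    and U_add: "\<And>u v. U (u + v) = U u + U v"
    and U_scale: "\<And>c u. U (scale c u) = scale c (U u)"
  shows "(U ^^ n) (B f h) = (\<Sum>k\<le>n. scale (of_nat (n choose k)) (B ((S ^^ k) f) ((T ^^ (n - k)) h)))"
proof (induction n)
  case 0
  then show ?case by simp
next
  case (Suc n)
  let ?b = "\<lambda>k m. B ((S ^^ k) f) ((T ^^ m) h)"
  let ?s = "\<lambda>n k. scale (of_nat (n choose k))"
  have U_0: "U 0 = 0" using U_scale[of 0 0] by simp
  have U_sum: "U (sum g A) = (\<Sum>a\<in>A. U (g a))" for g :: "nat \<Rightarrow> 'b" and A
    by (induction A rule: infinite_finite_induct) (simp_all add: U_0 U_add)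
  have "(U ^^ Suc n) (B f h) = (\<Sum>k\<le>n. ?s n k (?b (Suc k) (n - k)) + ?s n k (?b k (Suc (n - k))))"
    by (simp add: Suc U_sum U_scale der scale_right_distrib)
  also have "\<dots> = (\<Sum>k\<le>n. ?s n k (?b (Suc k) (n - k))) + (\<Sum>k\<le>n. ?s n k (?b k (Suc n - k)))"
    by (simp add: sum.distrib Suc_diff_le)
  also have "(\<Sum>k\<le>n. ?s n k (?b k (Suc n - k))) = (\<Sum>k\<le>Suc n. ?s n k (?b k (Suc n - k)))"
    by (simp add: binomial_eq_0)
  also have "\<dots> = ?b 0 (Suc n) + (\<Sum>k\<le>n. ?s n (Suc k) (?b (Suc k) (n - k)))"
    by (subst sum.atMost_Suc_shift) simp
  finally have "(U ^^ Suc n) (B f h) = ?b 0 (Suc n) +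
      ((\<Sum>k\<le>n. ?s n k (?b (Suc k) (n - k))) + (\<Sum>k\<le>n. ?s n (Suc k) (?b (Suc k) (n - k))))"
    by (simp add: add_ac)
  also have "\<dots> = ?b 0 (Suc n) + (\<Sum>k\<le>n. ?s (Suc n) (Suc k) (?b (Suc k) (n - k)))"
    by (simp add: sum.distrib[symmetric] scale_left_distrib)
  also have "\<dots> = (\<Sum>k\<le>Suc n. ?s (Suc n) k (?b k (Suc n - k)))"
    by (subst sum.atMost_Suc_shift) simp
  finally show ?case .
qed

text \<open>
  In characteristic \<open>p\<close> the inner binomial coefficients of the Leibniz formula vanish.  The three
  operators may differ, so that one statement covers derivations, twisted derivations and actions of
  a Lie algebra on a module.
\<close>

lemma (in vector_space) leibniz_CHAR:
  assumes p: "CHAR('a) > 0"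
    and der: "\<And>f h. U (B f h) = B (S f) h + B f (T h)"
    and U_add: "\<And>u v. U (u + v) = U u + U v"
    and U_scale: "\<And>c u. U (scale c u) = scale c (U u)"
  shows "(U ^^ CHAR('a)) (B f h) = B ((S ^^ CHAR('a)) f) h + B f ((T ^^ CHAR('a)) h)"
proof -
  let ?p = "CHAR('a)"
  let ?t = "\<lambda>k. scale (of_nat (?p choose k)) (B ((S ^^ k) f) ((T ^^ (?p - k)) h))"
  have pr: "prime ?p" using p by (rule prime_CHAR_semidom)
  have z: "(of_nat (?p choose k) :: 'a) = 0" if "k \<noteq> 0" "k \<noteq> ?p" "k \<le> ?p" for k
    using that pr by (auto simp: of_nat_eq_0_iff_char_dvd intro!: dvd_choose_prime)
  have "(\<Sum>k\<le>?p. ?t k) = (\<Sum>k\<in>{0, ?p}. ?t k)"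
    by (rule sum.mono_neutral_right) (auto simp: z)
  also have "\<dots> = ?t 0 + ?t ?p" using p by (subst sum.insert) auto
  finally show ?thesis
    unfolding leibniz_funpow[of U B, OF der U_add U_scale] by (simp add: add.commute)
qed

text \<open>
  Fermat's little theorem, for the prime field inside \<open>'k\<close>.
\<close>

lemma of_int_pow_CHAR:
  assumes "CHAR('k::field) > 0" "a \<in> range (of_int :: int \<Rightarrow> 'k)"
  shows "a ^ CHAR('k) = a"
proof -
  let ?p = "CHAR('k)"
  have pr: "prime ?p" using assms(1) by (rule prime_CHAR_semidom)
  have p0: "?p > 0" by (rule assms(1))
  have nat: "(of_nat n :: 'k) ^ ?p = of_nat n" for n
    using p0 by (induction n) (simp_all add: freshmans_dream[OF pr refl] power_0_left)
  obtain z where z: "a = of_int z" using assms(2) by auto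
  have "(of_int z :: 'k) = of_int (z mod int ?p) + of_int (int ?p) * of_int (z div int ?p)"
    by (metis mult_div_mod_eq add.commute of_int_add of_int_mult)
  then have "(of_int z :: 'k) = of_nat (nat (z mod int ?p))" using p0 by simp
  with z nat show ?thesis by metis
qed

lemma of_nat_inj_CHAR:
  assumes "(of_nat i :: 'k::field) = of_nat j" "i < CHAR('k)" "j < CHAR('k)"
  shows "i = j"
  using assms of_nat_eq_iff_char_dvd[where ?'a = 'k, of i j] of_nat_eq_iff_char_dvd[where ?'a = 'k, of j i]
  by (metis dvd_imp_le less_imp_diff_less linorder_neqE_nat not_le zero_less_diff)

text \<open>
  The action of the vector field \<open>a d/dX\<close> on densities of weight \<open>c\<close>.  Weight \<open>0\<close> gives functions,
  and weight \<open>-1\<close> gives vector fields, that is, the adjoint action.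
\<close>

definition density :: "'k::field \<Rightarrow> 'k poly \<Rightarrow> 'k poly \<Rightarrow> 'k poly" where
  "density c a f = a * pderiv f + Polynomial.smult c (pderiv a) * f"

text \<open>
  The \<open>p\<close>-th power of \<open>a d/dX\<close> is the derivation \<open>vfield_pow a d/dX\<close>.
\<close>

definition vfield_pow :: "'k::field poly \<Rightarrow> 'k poly" where
  "vfield_pow a = ((\<lambda>f. a * pderiv f) ^^ CHAR('k)) [:0, 1:]"

interpretation poly_vs: vector_space "Polynomial.smult :: 'k::field \<Rightarrow> 'k poly \<Rightarrow> 'k poly"
  by unfold_locales (simp_all add: smult_add_right smult_add_left)

lemma mult_op_CHAR:
  fixes S T U :: "'k::field poly \<Rightarrow> 'k poly"
  assumes "CHAR('k) > 0"
    and "\<And>f h. U (f * h) = S f * h + f * T h"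
    and "\<And>u v. U (u + v) = U u + U v" "\<And>c u. U (Polynomial.smult c u) = Polynomial.smult c (U u)"
  shows "(U ^^ CHAR('k)) (f * h) = (S ^^ CHAR('k)) f * h + f * (T ^^ CHAR('k)) h"
  by (rule poly_vs.leibniz_CHAR[where B = "(*)" and U = U and S = S and T = T, OF assms])

lemma vfield_funpow_CHAR:
  fixes a :: "'k::field poly"
  assumes p: "CHAR('k) > 0"
  shows "((\<lambda>f. a * pderiv f) ^^ CHAR('k)) f = vfield_pow a * pderiv f"
proof -
  let ?D = "\<lambda>f. a * pderiv f" and ?p = "CHAR('k)"
  have mult: "(?D ^^ ?p) (f * h) = (?D ^^ ?p) f * h + f * (?D ^^ ?p) h" for f h
    by (rule mult_op_CHAR[OF p]) (simp_all add: pderiv_mult pderiv_add pderiv_smult algebra_simps)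
  have add: "(?D ^^ n) (f + h) = (?D ^^ n) f + (?D ^^ n) h" for n f h
    by (induction n) (simp_all add: pderiv_add algebra_simps)
  have const: "(?D ^^ ?p) [:c:] = 0" for c
  proof -
    obtain n where "?p = Suc n" using p gr0_implies_Suc by blast
    moreover have "(?D ^^ n) 0 = 0" for n by (induction n) simp_all
    ultimately show ?thesis by (simp add: funpow_Suc_right pderiv_pCons del: funpow.simps)
  qed
  show ?thesis
  proof (induction f)
    case 0
    show ?case using const[of 0] by simp
  next
    case (pCons c f)
    have "pCons c f = [:c:] + [:0, 1:] * f" by simp
    then have "(?D ^^ ?p) (pCons c f) = vfield_pow a * f + [:0, 1:] * (vfield_pow a * pderiv f)"
      by (simp only: add mult const pCons vfield_pow_def) simp
    then show ?case by (simp add: pderiv_pCons algebra_simps)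
  qed
qed

lemma pderiv_CHAR_power: "pderiv (g ^ CHAR('k)) = (0 :: 'k::field poly)"
  by (cases "CHAR('k)") (simp, metis of_nat_CHAR pderiv_power_Suc mult_zero_left smult_0_left)

text \<open>
  Write \<open>D = a d/dX\<close> and \<open>B g = (D + g)\<^sup>p 1\<close>.  The Leibniz formula yields \<open>(D + g)\<^sup>p = D\<^sup>p + B g\<close> and the
  additivity of \<open>B\<close>.  It remains to evaluate \<open>B (c a')\<close>.  For \<open>c = 1\<close> the operator \<open>D + a'\<close> is
  \<open>f \<mapsto> (a f)'\<close>, which is conjugate to \<open>D\<close> by multiplication with \<open>a\<close>; this gives \<open>B a' = b'\<close>.
\<close>

lemma density_funpow_CHAR:
  fixes a :: "'k::field poly"
  assumes p: "CHAR('k) > 0"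
  shows "(density c a ^^ CHAR('k)) f =
    density c (vfield_pow a) f + Polynomial.smult (c ^ CHAR('k) - c) (pderiv a ^ CHAR('k) * f)"
proof -
  let ?p = "CHAR('k)"
  define D where "D f = a * pderiv f" for f
  define b where "b = vfield_pow a"
  define T where "T g f = D f + g * f" for g f
  define B where "B g = (T g ^^ ?p) 1" for g
  have pr: "prime ?p" using p by (rule prime_CHAR_semidom)
  then have p2: "?p \<ge> 2" by (rule prime_ge_2_nat)
  have Dp: "(D ^^ ?p) f = b * pderiv f" for f
    using vfield_funpow_CHAR[OF p, of a f] by (simp add: D_def[abs_def] b_def)
  have T_mult: "(T (g + h) ^^ ?p) (u * v) = (T g ^^ ?p) u * v + u * (T h ^^ ?p) v" for g h u v
    by (rule mult_op_CHAR[OF p])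
      (simp_all add: T_def D_def pderiv_mult pderiv_add pderiv_smult algebra_simps smult_add_right)
  have T0: "T 0 = D" by (auto simp: T_def)
  have Tp: "(T g ^^ ?p) f = B g * f + b * pderiv f" for g f
    using T_mult[of g 0 1 f] by (simp add: T0 Dp B_def)
  have B_add: "B (g + h) = B g + B h" for g h
    using T_mult[of g h 1 1] by (simp add: B_def)
  have B_0: "B 0 = 0" by (rule add_cancel_right_right[THEN iffD1]) (use B_add[of 0 0] in \<open>simp only: add_0_right\<close>)
  have B_nat: "B (Polynomial.smult (of_nat n) g) = Polynomial.smult (of_nat n) (B g)" for n g
    by (induction n) (simp_all add: B_0 B_add smult_add_left)
  \<comment> \<open>Additivity gives \<open>B (j g) = j B g\<close> for \<open>j\<close> in the prime field.  As \<open>B (c g)\<close> is a polynomial in \<open>c\<close>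
    of degree \<open>p\<close> with leading coefficient \<open>g\<^sup>p\<close>, these \<open>p\<close> values determine it.\<close>
  have B_smult: "B (Polynomial.smult c g) = Polynomial.smult (c ^ ?p) (g ^ ?p) + Polynomial.smult c (B g - g ^ ?p)" for c g
  proof -
    \<comment> \<open>\<open>\<beta> n\<close> is \<open>(D + c g)\<^sup>n 1\<close> with an indeterminate in place of the constant \<open>c\<close>.\<close>
    define \<beta> where "\<beta> = rec_nat (1 :: 'k poly poly) (\<lambda>_ q. map_poly D q + [:0, g:] * q)"
    have \<beta>_0: "\<beta> 0 = 1" and \<beta>_Suc: "\<beta> (Suc n) = map_poly D (\<beta> n) + [:0, g:] * \<beta> n" for n
      by (simp_all add: \<beta>_def)
    have D0: "D 0 = 0" by (simp add: D_def)
    have D_poly: "poly (map_poly D q) [:c:] = D (poly q [:c:])" for c q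
      by (induction q) (simp_all add: map_poly_pCons D0, simp add: D_def pderiv_add pderiv_smult algebra_simps)
    have \<beta>_poly: "poly (\<beta> n) [:c:] = (T (Polynomial.smult c g) ^^ n) 1" for n c
      by (induction n) (simp_all add: \<beta>_0 \<beta>_Suc D_poly T_def algebra_simps)
    have \<beta>_deg: "Polynomial.degree (\<beta> n) \<le> n \<and> Polynomial.coeff (\<beta> n) n = g ^ n" for n
    proof (induction n)
      case (Suc n)
      have "Polynomial.coeff (\<beta> (Suc n)) m = D (Polynomial.coeff (\<beta> n) m) + (if m = 0 then 0 else g * Polynomial.coeff (\<beta> n) (m - 1))" for m
        by (auto simp: \<beta>_Suc coeff_map_poly D0 coeff_pCons split: nat.split)
      then show ?case using Suc by (auto intro!: degree_le simp: coeff_eq_0 D0)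
    qed (simp add: \<beta>_0)
    define R where "R = \<beta> ?p - Polynomial.monom (g ^ ?p) ?p - Polynomial.monom (B g - g ^ ?p) 1"
    have "Polynomial.coeff R n = 0" if "n \<ge> ?p" for n
      using that \<beta>_deg[of ?p] p2 by (cases "n = ?p") (auto simp: R_def coeff_eq_0)
    then have deg: "Polynomial.degree R < ?p"
      using p2 by (metis degree_0 leading_coeff_0_iff less_le_trans not_le zero_less_numeral)
    have root: "poly R [:of_nat j:] = 0" for j
    proof -
      have "(of_nat j :: 'k) ^ ?p = of_nat j"
        using of_int_pow_CHAR[OF p, of "of_nat j"] by (metis of_int_of_nat_eq rangeI)
      then have "[:of_nat j :: 'k:] ^ ?p = [:of_nat j:]" by (simp add: poly_const_pow)
      moreover have "poly (\<beta> ?p) [:of_nat j:] = Polynomial.smult (of_nat j) (B g)"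
        using B_nat[of j g] by (simp only: \<beta>_poly) (simp add: B_def)
      ultimately show ?thesis by (simp add: R_def poly_monom algebra_simps smult_diff_right)
    qed
    have "R = 0"
    proof (rule ccontr)
      assume R: "R \<noteq> 0"
      have inj: "inj_on (\<lambda>j. [:of_nat j :: 'k:]) {..<?p}"
        by (rule inj_onI) (use of_nat_inj_CHAR in auto)
      have "?p = card ((\<lambda>j. [:of_nat j :: 'k:]) ` {..<?p})" by (simp add: card_image[OF inj])
      also have "\<dots> \<le> card {x. poly R x = 0}"
        by (rule card_mono) (use poly_roots_finite[OF R] root in auto)
      also have "\<dots> \<le> Polynomial.degree R" using R by (rule card_poly_roots_bound)
      finally show False using deg by simp
    qed
    then have "poly (\<beta> ?p) [:c:] = [:c:] ^ ?p * g ^ ?p + [:c:] * (B g - g ^ ?p)"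
      by (simp add: R_def poly_monom algebra_simps eq_diff_eq)
    then show ?thesis by (simp add: \<beta>_poly B_def poly_const_pow)
  qed
  have B_deriv: "B (pderiv a) = pderiv b"
  proof (cases "a = 0")
    case True
    have "b = 0" using Dp[of "[:0, 1:]"] True p2
      by (cases ?p) (simp_all add: D_def[abs_def] pderiv_pCons one_pCons[symmetric])
    then show ?thesis using True B_0 by simp
  next
    case False
    have aT: "a * T (pderiv a) f = D (a * f)" for f
      by (simp add: T_def D_def pderiv_mult algebra_simps)
    have "a * (T (pderiv a) ^^ n) f = (D ^^ n) (a * f)" for n f
      by (induction n) (simp_all add: aT)
    then have "a * B (pderiv a) = b * pderiv a" by (simp add: B_def Dp)
    also have "b * pderiv a = (D ^^ ?p) (D [:0, 1:])" by (simp add: Dp D_def pderiv_pCons)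
    also have "\<dots> = D ((D ^^ ?p) [:0, 1:])" by (simp add: funpow_swap1)
    also have "\<dots> = a * pderiv b" by (simp add: Dp D_def pderiv_pCons)
    finally show ?thesis using False by simp
  qed
  have "density c a = T (Polynomial.smult c (pderiv a))" by (simp add: fun_eq_iff density_def T_def D_def)
  then show ?thesis
    by (simp add: Tp B_smult B_deriv density_def flip: b_def)
      (simp add: algebra_simps smult_diff_left smult_diff_right)
qed

section \<open>The reduced enveloping algebra as a quotient of the free algebra\<close>

lemma (in ring) minus_eq_imp:
  assumes "a \<in> carrier R" "b \<in> carrier R" "a \<ominus> b = c"
  shows "a = b \<oplus> c"
  using assms(3)[symmetric] assms(1,2) by (simp add: a_minus_def a_lcomm r_neg)

lemma (in ring) minus_eq_zeroD: "a \<in> carrier R \<Longrightarrow> b \<in> carrier R \<Longrightarrow> a \<ominus> b = \<zero> \<Longrightarrow> a = b"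
  using minus_eq_imp[of a b \<zero>] by simp

lemma (in ring) minus_self: "a \<in> carrier R \<Longrightarrow> a \<ominus> a = \<zero>"
  by (simp add: a_minus_def r_neg)

text \<open>
  These closure properties make the relations of \<open>u(h, \<chi>)\<close> elements of the free algebra on \<open>h\<close>.
\<close>

locale restricted_subalgebra =
  fixes h :: "'k::field lie set" and \<chi> :: "'k lie \<Rightarrow> 'k"
  assumes add_closed: "x \<in> h \<Longrightarrow> y \<in> h \<Longrightarrow> x + y \<in> h"
    and scale_closed: "x \<in> h \<Longrightarrow> scale c x \<in> h"
    and bracket_closed: "x \<in> h \<Longrightarrow> y \<in> h \<Longrightarrow> witt_bracket x y \<in> h"
    and pmap_closed: "x \<in> h \<Longrightarrow> witt_pmap x \<in> h"
begin

abbreviation "F \<equiv> free_alg h"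
abbreviation "A \<equiv> red_env h \<chi>"
abbreviation "cls \<equiv> red_class h \<chi>"

sublocale F: ring F by (rule ring_free_alg)

lemma F_simps [simp]: "f \<oplus>\<^bsub>F\<^esub> g = f + g" "\<zero>\<^bsub>F\<^esub> = 0" "\<one>\<^bsub>F\<^esub> = free_scalar 1"
  by (simp_all add: free_alg_def free_scalar_def)

lemma F_carrier: "f \<in> carrier F \<longleftrightarrow> (\<forall>w\<in>Poly_Mapping.keys f. set w \<subseteq> h)"
  by (simp add: free_alg_def)

lemma gen_carrier [simp]: "x \<in> h \<Longrightarrow> free_gen x \<in> carrier F"
  by (simp add: F_carrier free_gen_def)

lemma scalar_carrier [simp]: "free_scalar c \<in> carrier F"
  by (simp add: F_carrier free_scalar_def)

lemma F_uminus: "f \<in> carrier F \<Longrightarrow> \<ominus>\<^bsub>F\<^esub> f = - f"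
  by (rule F.minus_equality) (simp_all add: F_carrier)

lemma F_minus: "f \<in> carrier F \<Longrightarrow> g \<in> carrier F \<Longrightarrow> f \<ominus>\<^bsub>F\<^esub> g = f - g"
  by (simp add: a_minus_def F_uminus)

lemma F_minus_closed: "f \<in> carrier F \<Longrightarrow> g \<in> carrier F \<Longrightarrow> f - g \<in> carrier F"
  using F.minus_closed F_minus by metis

lemma scale_gen: "scale c (free_gen x) = free_scalar c \<otimes>\<^bsub>F\<^esub> free_gen x"
  by (simp add: scale_def free_gen_def free_scalar_def free_alg_single map_single)

definition env_relations :: "'k free set" where
  "env_relations = {free_gen (x + y) - free_gen x - free_gen y | x y. x \<in> h \<and> y \<in> h}
     \<union> {free_gen (scale c x) - scale c (free_gen x) | c x. x \<in> h}
     \<union> {free_gen x \<otimes>\<^bsub>F\<^esub> free_gen y - free_gen y \<otimes>\<^bsub>F\<^esub> free_gen x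
          - free_gen (witt_bracket x y) | x y. x \<in> h \<and> y \<in> h}"

definition pth_relation :: "'k lie \<Rightarrow> 'k free" where
  "pth_relation x = free_gen x [^]\<^bsub>F\<^esub> CHAR('k) - free_gen (witt_pmap x) - free_scalar (\<chi> x ^ CHAR('k))"

lemma env_relations_carrier: "env_relations \<subseteq> carrier F"
  unfolding env_relations_def scale_gen
  by (auto intro!: F_minus_closed simp: add_closed scale_closed bracket_closed)

lemma env_ideal_eq: "env_ideal h = Idl\<^bsub>F\<^esub> env_relations"
  by (simp add: env_ideal_def env_relations_def)

sublocale I: ideal "env_ideal h" F
  unfolding env_ideal_eq by (rule F.genideal_ideal[OF env_relations_carrier])

lemma env_eq: "env h = F Quot env_ideal h" by (simp add: env_def)

sublocale env: ring_hom_ring F "env h" "env_class h"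
  using I.rcos_ring_hom_ring unfolding env_eq env_class_def[abs_def] .

lemma env_class_add:
  "f \<in> carrier F \<Longrightarrow> g \<in> carrier F \<Longrightarrow> env_class h (f + g) = env_class h f \<oplus>\<^bsub>env h\<^esub> env_class h g"
  using env.hom_add[of f g] by simp

lemma env_class_minus:
  assumes "f \<in> carrier F" "g \<in> carrier F"
  shows "env_class h (f - g) = env_class h f \<ominus>\<^bsub>env h\<^esub> env_class h g"
  using env.hom_add[of f "\<ominus>\<^bsub>F\<^esub> g"] assms by (simp only: F_minus[symmetric] a_minus_def env.hom_a_inv F.a_inv_closed)

lemma env_carrier: "carrier (env h) = env_class h ` carrier F"
  by (auto simp: env_eq FactRing_def A_RCOSETS_def' env_class_def)

lemma pth_relation_carrier: "x \<in> h \<Longrightarrow> pth_relation x \<in> carrier F"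
  unfolding pth_relation_def by (intro F_minus_closed F.nat_pow_closed) (simp_all add: pmap_closed)

lemma env_pth:
  assumes "x \<in> h"
  shows "env_class h (free_gen x) [^]\<^bsub>env h\<^esub> CHAR('k)
       \<ominus>\<^bsub>env h\<^esub> env_class h (free_gen (witt_pmap x))
       \<ominus>\<^bsub>env h\<^esub> env_class h (free_scalar (\<chi> x ^ CHAR('k))) = env_class h (pth_relation x)"
proof -
  have [simp]: "free_gen x [^]\<^bsub>F\<^esub> CHAR('k) \<in> carrier F" using assms by simp
  show ?thesis using assms unfolding pth_relation_def
    by (simp add: env_class_minus F_minus_closed pmap_closed env.hom_nat_pow)
qed

lemma red_ideal_eq: "red_ideal h \<chi> = Idl\<^bsub>env h\<^esub> ((\<lambda>x. env_class h (pth_relation x)) ` h)"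
  unfolding red_ideal_def Setcompr_eq_image
  by (rule arg_cong[where f = "genideal (env h)"], rule image_cong) (simp_all add: env_pth)

sublocale J: ideal "red_ideal h \<chi>" "env h"
  unfolding red_ideal_eq by (rule env.S.genideal_ideal) (auto simp: env_carrier pth_relation_carrier)

lemma A_eq: "A = env h Quot red_ideal h \<chi>" by (simp add: red_env_def)

lemma env_to_A: "ring_hom_ring (env h) A ((+>\<^bsub>env h\<^esub>) (red_ideal h \<chi>))"
  unfolding A_eq by (rule J.rcos_ring_hom_ring)

sublocale A: ring A
  unfolding A_eq by (rule J.quotient_is_ring)

sublocale cls: ring_hom_ring F A cls
proof (rule ring_hom_ringI2)
  interpret r: ring_hom_ring "env h" A "(+>\<^bsub>env h\<^esub>) (red_ideal h \<chi>)" by (rule env_to_A)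
  show "cls \<in> ring_hom F A"
    using env.hom_one r.hom_one
    by (intro ring_hom_memI) (simp_all add: red_class_def env_class_add)
qed (rule F.ring_axioms A.ring_axioms)+

lemma A_carrier: "carrier A = cls ` carrier F"
  by (auto simp: A_eq FactRing_def A_RCOSETS_def' red_class_def env_carrier)

lemma red_rep: "a \<in> carrier A \<Longrightarrow> red_rep h \<chi> a \<in> carrier F" "a \<in> carrier A \<Longrightarrow> cls (red_rep h \<chi> a) = a"
proof -
  have "red_rep h \<chi> a \<in> carrier F \<and> cls (red_rep h \<chi> a) = a" if "a \<in> carrier A"
    unfolding red_rep_def by (rule someI_ex) (use that A_carrier in auto)
  then show "a \<in> carrier A \<Longrightarrow> red_rep h \<chi> a \<in> carrier F" "a \<in> carrier A \<Longrightarrow> cls (red_rep h \<chi> a) = a" by auto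
qed

lemma cls_minus:
  assumes "f \<in> carrier F" "g \<in> carrier F"
  shows "cls (f - g) = cls f \<ominus>\<^bsub>A\<^esub> cls g"
  using cls.hom_add[of f "\<ominus>\<^bsub>F\<^esub> g"] assms by (simp only: F_minus[symmetric] a_minus_def cls.hom_a_inv F.a_inv_closed)

lemma cls_add: "f \<in> carrier F \<Longrightarrow> g \<in> carrier F \<Longrightarrow> cls (f + g) = cls f \<oplus>\<^bsub>A\<^esub> cls g"
  using cls.hom_add[of f g] by simp

lemma env_relations_mem: "f \<in> env_relations \<Longrightarrow> cls f = \<zero>\<^bsub>A\<^esub>"
proof -
  interpret r: ring_hom_ring "env h" A "(+>\<^bsub>env h\<^esub>) (red_ideal h \<chi>)" by (rule env_to_A)
  assume "f \<in> env_relations"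
  then have "f \<in> env_ideal h" unfolding env_ideal_eq
    using F.genideal_self[OF env_relations_carrier] by blast
  then have "env_class h f = \<zero>\<^bsub>env h\<^esub>"
    by (simp add: env_class_def env_eq FactRing_def I.a_rcos_const)
  then show ?thesis by (simp add: red_class_def)
qed

lemma pth_relation_mem: "x \<in> h \<Longrightarrow> cls (pth_relation x) = \<zero>\<^bsub>A\<^esub>"
proof -
  assume x: "x \<in> h"
  have "(\<lambda>x. env_class h (pth_relation x)) ` h \<subseteq> red_ideal h \<chi>"
    unfolding red_ideal_eq by (rule env.S.genideal_self) (auto simp: env_carrier pth_relation_carrier)
  then have "env_class h (pth_relation x) \<in> red_ideal h \<chi>" using x by auto
  then show ?thesis by (simp add: red_class_def A_eq FactRing_def J.a_rcos_const)
qed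

text \<open>
  The kernel of the projection from the free algebra to \<open>u(h, \<chi>)\<close> is the smallest ideal that contains
  the relations.  Every map out of \<open>u(h, \<chi>)\<close> below is constructed on the free algebra and then
  descended with this lemma.
\<close>

lemma kernel_minimal:
  assumes Y: "ideal Y F" and env: "env_relations \<subseteq> Y" and pth: "\<And>x. x \<in> h \<Longrightarrow> pth_relation x \<in> Y"
    and f: "f \<in> carrier F" "cls f = \<zero>\<^bsub>A\<^esub>"
  shows "f \<in> Y"
proof -
  interpret Y: ideal Y F by (rule Y)
  have IY: "env_ideal h \<subseteq> Y" unfolding env_ideal_eq by (rule F.genideal_minimal[OF Y env])
  have "ideal (env_class h ` Y) (env h)"
    using F.ring_ideal_imp_quot_ideal[OF I.ideal_axioms Y] unfolding env_eq env_class_def[abs_def] .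
  then have "red_ideal h \<chi> \<subseteq> env_class h ` Y" unfolding red_ideal_eq
    by (rule env.S.genideal_minimal) (auto simp: pth)
  moreover have "env_class h f \<in> red_ideal h \<chi>"
  proof -
    have "env_class h f \<in> red_ideal h \<chi> +>\<^bsub>env h\<^esub> env_class h f"
      using f(1) by (intro J.a_rcos_self) simp
    with f(2) show ?thesis by (simp add: red_class_def A_eq FactRing_def)
  qed
  ultimately obtain g where g: "g \<in> Y" "env_class h f = env_class h g" by auto
  have "f \<in> env_ideal h +>\<^bsub>F\<^esub> f" using f(1) by (rule I.a_rcos_self)
  then have "f \<in> env_ideal h +>\<^bsub>F\<^esub> g" using g by (simp add: env_class_def)
  then obtain i where "i \<in> env_ideal h" "f = i \<oplus>\<^bsub>F\<^esub> g" by (auto simp: a_r_coset_def')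
  with IY g show ?thesis using Y.a_closed by auto
qed

section \<open>Generators and relations of the reduced enveloping algebra\<close>

abbreviation g :: "'k lie \<Rightarrow> 'k red" where "g x \<equiv> cls (free_gen x)"
abbreviation s :: "'k \<Rightarrow> 'k red" where "s c \<equiv> cls (free_scalar c)"

lemma g_add:
  assumes "x \<in> h" "y \<in> h"
  shows "g (x + y) = g x \<oplus>\<^bsub>A\<^esub> g y"
proof -
  have "cls (free_gen (x + y) - free_gen x - free_gen y) = \<zero>\<^bsub>A\<^esub>"
    by (rule env_relations_mem) (use assms in \<open>unfold env_relations_def, blast\<close>)
  then have "(g (x + y) \<ominus>\<^bsub>A\<^esub> g x) \<ominus>\<^bsub>A\<^esub> g y = \<zero>\<^bsub>A\<^esub>"
    using assms by (simp add: cls_minus F_minus_closed add_closed)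
  then have "g (x + y) \<ominus>\<^bsub>A\<^esub> g x = g y" using assms A.minus_eq_zeroD[of _ "g y"] by (simp add: add_closed)
  then show ?thesis by (rule A.minus_eq_imp[rotated 2]) (use assms in \<open>simp_all add: add_closed\<close>)
qed

lemma g_scale:
  assumes "x \<in> h"
  shows "g (scale c x) = s c \<otimes>\<^bsub>A\<^esub> g x"
proof -
  have "cls (free_gen (scale c x) - scale c (free_gen x)) = \<zero>\<^bsub>A\<^esub>"
    by (rule env_relations_mem) (use assms in \<open>unfold env_relations_def, blast\<close>)
  then show ?thesis
    using assms A.minus_eq_zeroD[of _ "s c \<otimes>\<^bsub>A\<^esub> g x"] by (simp add: cls_minus scale_closed scale_gen)
qed

lemma g_bracket:
  assumes "x \<in> h" "y \<in> h"
  shows "g x \<otimes>\<^bsub>A\<^esub> g y = g y \<otimes>\<^bsub>A\<^esub> g x \<oplus>\<^bsub>A\<^esub> g (witt_bracket x y)"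
proof -
  have "cls (free_gen x \<otimes>\<^bsub>F\<^esub> free_gen y - free_gen y \<otimes>\<^bsub>F\<^esub> free_gen x - free_gen (witt_bracket x y)) = \<zero>\<^bsub>A\<^esub>"
    by (rule env_relations_mem) (use assms in \<open>unfold env_relations_def, blast\<close>)
  then have "(g x \<otimes>\<^bsub>A\<^esub> g y \<ominus>\<^bsub>A\<^esub> g y \<otimes>\<^bsub>A\<^esub> g x) \<ominus>\<^bsub>A\<^esub> g (witt_bracket x y) = \<zero>\<^bsub>A\<^esub>"
    using assms by (simp add: cls_minus F_minus_closed bracket_closed)
  then have "g x \<otimes>\<^bsub>A\<^esub> g y \<ominus>\<^bsub>A\<^esub> g y \<otimes>\<^bsub>A\<^esub> g x = g (witt_bracket x y)"
    using assms A.minus_eq_zeroD[of _ "g (witt_bracket x y)"] by (simp add: bracket_closed)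
  then show ?thesis by (rule A.minus_eq_imp[rotated 2]) (use assms in simp_all)
qed

lemma g_pow:
  assumes "x \<in> h"
  shows "g x [^]\<^bsub>A\<^esub> CHAR('k) = g (witt_pmap x) \<oplus>\<^bsub>A\<^esub> s (\<chi> x ^ CHAR('k))"
proof -
  have [simp]: "free_gen x [^]\<^bsub>F\<^esub> CHAR('k) \<in> carrier F" using assms by simp
  have "cls (pth_relation x) = \<zero>\<^bsub>A\<^esub>" by (rule pth_relation_mem[OF assms])
  then have "(g x [^]\<^bsub>A\<^esub> CHAR('k) \<ominus>\<^bsub>A\<^esub> g (witt_pmap x)) \<ominus>\<^bsub>A\<^esub> s (\<chi> x ^ CHAR('k)) = \<zero>\<^bsub>A\<^esub>"
    using assms by (simp add: pth_relation_def cls_minus F_minus_closed pmap_closed cls.hom_nat_pow)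
  then have "g x [^]\<^bsub>A\<^esub> CHAR('k) \<ominus>\<^bsub>A\<^esub> g (witt_pmap x) = s (\<chi> x ^ CHAR('k))"
    using assms A.minus_eq_zeroD[of _ "s (\<chi> x ^ CHAR('k))"] by (simp add: pmap_closed)
  then show ?thesis by (rule A.minus_eq_imp[rotated 2]) (use assms in \<open>simp_all add: pmap_closed\<close>)
qed

lemma s_add: "s (a + b) = s a \<oplus>\<^bsub>A\<^esub> s b"
  using cls_add[of "free_scalar a" "free_scalar b"] scalar_carrier[of a] scalar_carrier[of b]
  by (simp add: free_scalar_def single_add)

lemma s_mult: "s (a * b) = s a \<otimes>\<^bsub>A\<^esub> s b"
  using cls.hom_mult[of "free_scalar a" "free_scalar b"] scalar_carrier[of a] scalar_carrier[of b]
  by (simp add: free_scalar_def free_alg_single)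

lemma s_one: "s 1 = \<one>\<^bsub>A\<^esub>"
  using cls.hom_one by simp

lemma s_central:
  assumes "a \<in> carrier A"
  shows "s c \<otimes>\<^bsub>A\<^esub> a = a \<otimes>\<^bsub>A\<^esub> s c"
proof -
  obtain f where f: "f \<in> carrier F" "a = cls f" using assms A_carrier by auto
  have "free_scalar c \<otimes>\<^bsub>F\<^esub> f = f \<otimes>\<^bsub>F\<^esub> free_scalar c"
    by (induction f rule: free_induct)
      (simp_all add: free_alg_zero free_alg_distrib_left free_alg_distrib_right free_scalar_def free_alg_single mult.commute)
  then show ?thesis using f cls.hom_mult scalar_carrier by metis
qed

text \<open>
  It is enough to consider multiplication by generators from the left, because the words in the
  generators span the algebra.
\<close>

lemma A_induct [consumes 1, case_names one add scalar gen]: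
  assumes a: "a \<in> carrier A" and one: "P \<one>\<^bsub>A\<^esub>"
    and add: "\<And>a b. a \<in> carrier A \<Longrightarrow> b \<in> carrier A \<Longrightarrow> P a \<Longrightarrow> P b \<Longrightarrow> P (a \<oplus>\<^bsub>A\<^esub> b)"
    and scalar: "\<And>c a. a \<in> carrier A \<Longrightarrow> P a \<Longrightarrow> P (s c \<otimes>\<^bsub>A\<^esub> a)"
    and gen: "\<And>x a. x \<in> h \<Longrightarrow> a \<in> carrier A \<Longrightarrow> P a \<Longrightarrow> P (g x \<otimes>\<^bsub>A\<^esub> a)"
  shows "P a"
proof -
  have "s 0 \<oplus>\<^bsub>A\<^esub> s 0 = s 0" using s_add[of 0 0] by simp
  then have s0: "s 0 = \<zero>\<^bsub>A\<^esub>" by simp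
  have zero: "P \<zero>\<^bsub>A\<^esub>" using scalar[OF A.one_closed one, of 0] s0 by simp
  have word: "P (cls (Poly_Mapping.single w c))" if "set w \<subseteq> h" for w c
    using that
  proof (induction w)
    case Nil
    show ?case using scalar[OF A.one_closed one, of c] cls.hom_closed[OF scalar_carrier, of c]
      by (simp add: free_scalar_def[symmetric])
  next
    case (Cons x w)
    have "Poly_Mapping.single (x # w) c = free_gen x \<otimes>\<^bsub>F\<^esub> Poly_Mapping.single w c"
      by (simp add: free_gen_def free_alg_single)
    moreover have "Poly_Mapping.single w c \<in> carrier F" using Cons by (simp add: F_carrier)
    ultimately show ?case using Cons gen[of x] by simp
  qed
  have "f \<in> carrier F \<Longrightarrow> P (cls f)" for f
  proof (induction f rule: update_induct)
    case const
    then show ?case using zero cls.hom_zero by simp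
  next
    case (update f a b)
    have f: "f \<in> carrier F" and ab: "Poly_Mapping.single a b \<in> carrier F" "set a \<subseteq> h"
      using update by (auto simp: F_carrier in_keys_iff lookup_update split: if_splits)
    have eq: "Poly_Mapping.update a b f = f \<oplus>\<^bsub>F\<^esub> Poly_Mapping.single a b"
      using update by (auto intro!: poly_mapping_eqI simp: lookup_update lookup_add in_keys_iff lookup_single when_def)
    show ?case unfolding eq
      using f ab update word by (subst cls.hom_add) (auto intro!: add)
  qed
  then show ?thesis using a A_carrier by auto
qed

end

section \<open>Representations\<close>

text \<open>
  The action of the free algebra that extends a family of operators.
\<close>

definition act :: "('k::field \<Rightarrow> 'v::ab_group_add \<Rightarrow> 'v) \<Rightarrow> ('k lie \<Rightarrow> 'v \<Rightarrow> 'v) \<Rightarrow> 'k free \<Rightarrow> 'v \<Rightarrow> 'v" where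
  "act sc \<rho> f v = (\<Sum>w\<in>Poly_Mapping.keys f. sc (Poly_Mapping.lookup f w) (foldr \<rho> w v))"

locale operator_family = vector_space sc
  for sc :: "'k::field \<Rightarrow> 'v::ab_group_add \<Rightarrow> 'v" +
  fixes \<rho> :: "'k lie \<Rightarrow> 'v \<Rightarrow> 'v"
  assumes \<rho>_add: "\<rho> x (u + v) = \<rho> x u + \<rho> x v"
    and \<rho>_sc: "\<rho> x (sc c v) = sc c (\<rho> x v)"
begin

abbreviation "ac \<equiv> act sc \<rho>"

lemma word_add: "foldr \<rho> w (u + v) = foldr \<rho> w u + foldr \<rho> w v"
  by (induction w) (simp_all add: \<rho>_add)

lemma word_sc: "foldr \<rho> w (sc c v) = sc c (foldr \<rho> w v)"
  by (induction w) (simp_all add: \<rho>_sc)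

lemma act_superset:
  "finite S \<Longrightarrow> Poly_Mapping.keys f \<subseteq> S \<Longrightarrow> ac f v = (\<Sum>w\<in>S. sc (Poly_Mapping.lookup f w) (foldr \<rho> w v))"
  unfolding act_def by (rule sum.mono_neutral_left) (auto simp: in_keys_iff)

lemma act_single [simp]: "ac (Poly_Mapping.single w c) v = sc c (foldr \<rho> w v)"
  by (subst act_superset[of "{w}"]) auto

lemma act_0 [simp]: "ac 0 v = 0" by (simp add: act_def)

lemma act_add: "ac (f + f') v = ac f v + ac f' v"
  by (subst (1 2 3) act_superset[of "Poly_Mapping.keys f \<union> Poly_Mapping.keys f'"])
    (auto simp: Poly_Mapping.keys_add lookup_add scale_left_distrib sum.distrib)

lemma act_diff: "ac (f - f') v = ac f v - ac f' v"
  using act_add[of "f - f'" f' v] by simp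

lemma act_vadd: "ac f (u + v) = ac f u + ac f v"
  by (simp add: act_def word_add scale_right_distrib sum.distrib)

lemma act_sc: "ac f (sc c v) = sc c (ac f v)"
  by (simp add: act_def word_sc scale_sum_right mult.commute)

lemma act_v0 [simp]: "ac f 0 = 0"
  using act_sc[of f 0 0] by simp

lemma act_mult: "ac (f \<otimes>\<^bsub>free_alg h\<^esub> f') v = ac f (ac f' v)"
proof (induction f rule: free_induct)
  case (2 w c)
  show ?case
    by (induction f' rule: free_induct)
      (simp_all add: free_alg_zero free_alg_single free_alg_distrib_right act_add act_vadd word_sc word_add scale_right_distrib)
qed (simp_all add: free_alg_zero free_alg_distrib_left act_add)

lemma act_gen [simp]: "ac (free_gen x) v = \<rho> x v" by (simp add: free_gen_def)

lemma act_scalar [simp]: "ac (free_scalar c) v = sc c v" by (simp add: free_scalar_def)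

lemma act_gen_pow: "ac (free_gen x [^]\<^bsub>free_alg h\<^esub> n) v = (\<rho> x ^^ n) v"
proof (induction n arbitrary: v)
  case 0
  have "\<one>\<^bsub>free_alg h\<^esub> = free_scalar 1" by (simp add: free_alg_def free_scalar_def)
  then show ?case by simp
next
  case (Suc n)
  show ?case by (simp add: act_mult Suc funpow_Suc_right del: funpow.simps)
qed

end

text \<open>
  A representation of \<open>u(h, \<chi>)\<close> on the quotient of a vector space by \<open>Z\<close>.  The relations are only
  required modulo \<open>Z\<close>; thus density operators can be composed in \<open>k[X]\<close>, without reduction modulo
  \<open>X\<^sup>p\<close> after each step.
\<close>

locale reduced_representation = restricted_subalgebra h \<chi> + operator_family sc \<rho>
  for h :: "'k::field lie set" and \<chi> and sc :: "'k \<Rightarrow> 'v::ab_group_add \<Rightarrow> 'v" and \<rho> +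
  fixes Z :: "'v set"
  assumes Z_0: "0 \<in> Z" and Z_add: "u \<in> Z \<Longrightarrow> v \<in> Z \<Longrightarrow> u + v \<in> Z"
    and Z_sc: "v \<in> Z \<Longrightarrow> sc c v \<in> Z"
    and Z_\<rho>: "x \<in> h \<Longrightarrow> v \<in> Z \<Longrightarrow> \<rho> x v \<in> Z"
    and rel_add: "x \<in> h \<Longrightarrow> y \<in> h \<Longrightarrow> \<rho> (x + y) v - \<rho> x v - \<rho> y v \<in> Z"
    and rel_scale: "x \<in> h \<Longrightarrow> \<rho> (scale c x) v - sc c (\<rho> x v) \<in> Z"
    and rel_bracket: "x \<in> h \<Longrightarrow> y \<in> h \<Longrightarrow> \<rho> x (\<rho> y v) - \<rho> y (\<rho> x v) - \<rho> (witt_bracket x y) v \<in> Z"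
    and rel_pow: "x \<in> h \<Longrightarrow> (\<rho> x ^^ CHAR('k)) v - \<rho> (witt_pmap x) v - sc (\<chi> x ^ CHAR('k)) v \<in> Z"
begin

lemma act_Z:
  assumes "f \<in> carrier F" "v \<in> Z"
  shows "ac f v \<in> Z"
proof -
  have word: "foldr \<rho> w v \<in> Z" if "set w \<subseteq> h" for w
    using that by (induction w) (auto simp: assms Z_\<rho>)
  have "(\<Sum>w\<in>S. sc (Poly_Mapping.lookup f w) (foldr \<rho> w v)) \<in> Z" if "S \<subseteq> Poly_Mapping.keys f" for S
    using that assms(1)
    by (induction S rule: infinite_finite_induct) (auto simp: Z_0 F_carrier intro!: Z_add Z_sc word)
  then show ?thesis by (simp add: act_def)
qed

lemma act_kernel:
  assumes "f \<in> carrier F" "cls f = \<zero>\<^bsub>A\<^esub>"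
  shows "ac f v \<in> Z"
proof -
  define Y where "Y = {f \<in> carrier F. \<forall>v. ac f v \<in> Z}"
  have "ideal Y F"
  proof (rule idealI[OF F.ring_axioms])
    show "subgroup Y (add_monoid F)"
    proof (rule F.add.subgroupI)
      show "Y \<subseteq> carrier F" "Y \<noteq> {}" using Z_0 by (auto simp: Y_def F_carrier intro!: exI[of _ 0])
      fix a b assume a: "a \<in> Y"
      have "ac (- a) v = sc (- 1) (ac a v)" for v using act_diff[of 0 a v] by simp
      moreover have "sc (-1) (ac a v) \<in> Z" for v by (rule Z_sc) (use a in \<open>auto simp: Y_def\<close>)
      ultimately show "\<ominus>\<^bsub>F\<^esub> a \<in> Y" using a by (auto simp: Y_def F_uminus) (simp add: F_carrier)
      assume "b \<in> Y" then show "a \<oplus>\<^bsub>F\<^esub> b \<in> Y"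
        using a F.a_closed[of a b] by (auto simp: Y_def act_add intro!: Z_add)
    qed
  qed (auto simp: Y_def act_mult act_Z)
  moreover have "env_relations \<subseteq> Y"
  proof
    fix f assume f: "f \<in> env_relations"
    have "ac f v \<in> Z" for v
      using f unfolding env_relations_def scale_gen
      by (elim UnE CollectE exE conjE)
        (simp_all add: act_diff act_mult rel_add rel_scale rel_bracket)
    then show "f \<in> Y" using f env_relations_carrier by (auto simp: Y_def)
  qed
  moreover have "pth_relation x \<in> Y" if "x \<in> h" for x
    using that pth_relation_carrier[OF that]
    by (simp add: Y_def pth_relation_def act_diff act_gen_pow rel_pow)
  ultimately have "f \<in> Y" by (rule kernel_minimal) (use assms in auto)
  then show ?thesis by (simp add: Y_def)
qed

lemma act_cong:
  assumes "f \<in> carrier F" "f' \<in> carrier F" "cls f = cls f'"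
  shows "ac f v - ac f' v \<in> Z"
proof -
  have "cls (f - f') = \<zero>\<^bsub>A\<^esub>" using assms by (simp add: cls_minus A.minus_self)
  then show ?thesis using act_kernel[of "f - f'"] assms by (simp add: F_minus_closed act_diff)
qed

end

section \<open>Quotient spaces of dimension at most one\<close>

locale subspace = V: abelian_group V
  for V :: "('k::field, 'v) module" (structure) and H :: "'v set" +
  assumes smult_closed: "v \<in> carrier V \<Longrightarrow> c \<odot> v \<in> carrier V"
    and smult_l_distr: "v \<in> carrier V \<Longrightarrow> (a + b) \<odot> v = a \<odot> v \<oplus> b \<odot> v"
    and smult_r_distr: "u \<in> carrier V \<Longrightarrow> v \<in> carrier V \<Longrightarrow> c \<odot> (u \<oplus> v) = c \<odot> u \<oplus> c \<odot> v"
    and smult_assoc: "v \<in> carrier V \<Longrightarrow> (a * b) \<odot> v = a \<odot> (b \<odot> v)"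
    and smult_one: "v \<in> carrier V \<Longrightarrow> 1 \<odot> v = v"
    and H_subset: "H \<subseteq> carrier V" and H_zero: "\<zero> \<in> H"
    and H_add: "u \<in> H \<Longrightarrow> v \<in> H \<Longrightarrow> u \<oplus> v \<in> H" and H_smult: "v \<in> H \<Longrightarrow> c \<odot> v \<in> H"
begin

lemma smult_0: "v \<in> carrier V \<Longrightarrow> 0 \<odot> v = \<zero>"
  using smult_l_distr[of v 0 0] smult_closed[of v 0] by simp

lemma smult_m1: "v \<in> carrier V \<Longrightarrow> (- 1) \<odot> v = \<ominus> v"
  using smult_l_distr[of v "-1" 1] smult_closed[of v "-1"]
  by (simp add: smult_0 smult_one V.minus_equality)

sublocale H: abelian_subgroup H V
proof (rule abelian_subgroupI3)
  show "additive_subgroup H V"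
    by (rule additive_subgroupI, rule V.add.subgroupI)
      (use H_subset H_zero H_add H_smult[of _ "-1"] in \<open>auto simp: smult_m1 subset_iff\<close>)
qed (rule V.abelian_group_axioms)

lemma coset_eq:
  assumes "h \<in> H" "v \<in> carrier V" shows "H +> (h \<oplus> v) = H +> v"
  using V.a_repr_independence[OF V.a_rcosI[OF assms(1) H_subset assms(2)] assms(2) H.a_subgroup] by simp

lemma quot_zero_space:
  assumes "carrier V \<subseteq> H" shows "vs_iso (quot_space V H) zero_space"
proof -
  have "a_rcosets H = {H}"
    using assms H_zero H_subset by (auto simp: A_RCOSETS_def' H.a_rcos_const intro!: exI[of _ "\<zero>"])
  then show ?thesis
    unfolding vs_iso_def
    by (intro exI[of _ "\<lambda>_. 0"]) (auto simp: quot_space_def zero_space_def line_def bij_betw_def)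
qed

text \<open>
  The isomorphism is inverse to the map \<open>t \<mapsto> H + t v0\<close>.
\<close>

lemma quot_line:
  assumes v0: "v0 \<in> carrier V" "v0 \<notin> H"
    and span: "\<And>v. v \<in> carrier V \<Longrightarrow> \<exists>t. \<exists>h\<in>H. v = h \<oplus> t \<odot> v0"
  shows "vs_iso (quot_space V H) line"
proof -
  define \<psi> where "\<psi> t = H +> (t \<odot> v0)" for t
  have tv: "t \<odot> v0 \<in> carrier V" for t by (rule smult_closed[OF v0(1)])
  have inj: "inj \<psi>"
  proof (rule injI, rule ccontr)
    fix a b assume eq: "\<psi> a = \<psi> b" and ab: "a \<noteq> b"
    have "a \<odot> v0 \<in> H +> (b \<odot> v0)" using H.a_rcos_self[OF tv, of a] eq by (simp add: \<psi>_def)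
    then obtain h where h: "h \<in> H" "a \<odot> v0 = h \<oplus> b \<odot> v0" by (auto simp: a_r_coset_def')
    have "(a - b) \<odot> v0 = h \<oplus> (b \<odot> v0 \<oplus> (- b) \<odot> v0)"
      using h tv H_subset smult_l_distr[OF v0(1), of a "- b"] by (auto simp: V.a_assoc)
    also have "b \<odot> v0 \<oplus> (- b) \<odot> v0 = \<zero>"
      using smult_l_distr[OF v0(1), of b "- b"] smult_0[OF v0(1)] by simp
    finally have "(a - b) \<odot> v0 \<in> H" using h H_subset by auto
    then have "inverse (a - b) \<odot> ((a - b) \<odot> v0) \<in> H" by (rule H_smult)
    then show False using v0 ab by (simp add: smult_assoc[symmetric] smult_one)
  qed
  have range: "range \<psi> = a_rcosets H"
  proof -
    have "\<exists>t. H +> v = \<psi> t" if v: "v \<in> carrier V" for v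
    proof -
      obtain t h where "h \<in> H" "v = h \<oplus> t \<odot> v0" using span[OF v] by auto
      then show ?thesis using coset_eq[OF _ tv] unfolding \<psi>_def by auto
    qed
    moreover have "\<psi> t \<in> a_rcosets H" for t using tv by (auto simp: A_RCOSETS_def' \<psi>_def)
    ultimately show ?thesis by (fastforce simp: A_RCOSETS_def')
  qed
  have add: "\<psi> a <+> \<psi> b = \<psi> (a + b)" for a b
    unfolding \<psi>_def by (simp add: H.a_rcos_sum tv smult_l_distr v0)
  have smult: "H +> (c \<odot> (SOME v. v \<in> \<psi> t)) = \<psi> (c * t)" for c t
  proof -
    have "(SOME v. v \<in> \<psi> t) \<in> \<psi> t" by (rule someI[of _ "t \<odot> v0"]) (simp add: \<psi>_def H.a_rcos_self tv)
    then obtain h where h: "h \<in> H" "(SOME v. v \<in> \<psi> t) = h \<oplus> t \<odot> v0" by (auto simp: \<psi>_def a_r_coset_def')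
    then have "c \<odot> (SOME v. v \<in> \<psi> t) = c \<odot> h \<oplus> (c * t) \<odot> v0"
      using H_subset tv v0 by (auto simp: smult_r_distr smult_assoc)
    then show ?thesis using h by (simp add: \<psi>_def coset_eq H_smult tv)
  qed
  define \<phi> where "\<phi> = inv_into UNIV \<psi>"
  have \<phi>\<psi>: "\<phi> (\<psi> t) = t" for t by (simp add: \<phi>_def inj)
  show ?thesis
    unfolding vs_iso_def
  proof (intro exI[of _ \<phi>] conjI ballI allI)
    have "bij_betw \<phi> (range \<psi>) UNIV"
      unfolding \<phi>_def by (rule bij_betw_inv_into) (use inj in \<open>simp add: bij_betw_def\<close>)
    then show "bij_betw \<phi> (carrier (quot_space V H)) (carrier line)"
      by (simp add: range quot_space_def line_def)
  next
    fix X Y assume "X \<in> carrier (quot_space V H)" "Y \<in> carrier (quot_space V H)"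
    then obtain a b where "X = \<psi> a" "Y = \<psi> b" by (auto simp: quot_space_def range[symmetric])
    then show "\<phi> (X \<oplus>\<^bsub>quot_space V H\<^esub> Y) = \<phi> X \<oplus>\<^bsub>line\<^esub> \<phi> Y"
      by (simp add: quot_space_def line_def add \<phi>\<psi>)
  next
    fix c X assume "X \<in> carrier (quot_space V H)"
    then obtain a where "X = \<psi> a" by (auto simp: quot_space_def range[symmetric])
    then show "\<phi> (c \<odot>\<^bsub>quot_space V H\<^esub> X) = c \<odot>\<^bsub>line\<^esub> \<phi> X"
      by (simp add: quot_space_def line_def smult \<phi>\<psi>)
  qed
qed

end

section \<open>\<open>Ext\<^sup>1\<close> out of a cyclic module\<close>

locale left_module = A: ring A + M: abelian_group M
  for A :: "('a, 'x) ring_scheme" and M :: "('a, 'm) module" +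
  assumes smult_closed: "a \<in> carrier A \<Longrightarrow> m \<in> carrier M \<Longrightarrow> a \<odot>\<^bsub>M\<^esub> m \<in> carrier M"
    and smult_l_distr: "a \<in> carrier A \<Longrightarrow> b \<in> carrier A \<Longrightarrow> m \<in> carrier M \<Longrightarrow>
      (a \<oplus>\<^bsub>A\<^esub> b) \<odot>\<^bsub>M\<^esub> m = a \<odot>\<^bsub>M\<^esub> m \<oplus>\<^bsub>M\<^esub> b \<odot>\<^bsub>M\<^esub> m"
    and smult_r_distr: "a \<in> carrier A \<Longrightarrow> m \<in> carrier M \<Longrightarrow> n \<in> carrier M \<Longrightarrow>
      a \<odot>\<^bsub>M\<^esub> (m \<oplus>\<^bsub>M\<^esub> n) = a \<odot>\<^bsub>M\<^esub> m \<oplus>\<^bsub>M\<^esub> a \<odot>\<^bsub>M\<^esub> n"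
    and smult_assoc: "a \<in> carrier A \<Longrightarrow> b \<in> carrier A \<Longrightarrow> m \<in> carrier M \<Longrightarrow>
      (a \<otimes>\<^bsub>A\<^esub> b) \<odot>\<^bsub>M\<^esub> m = a \<odot>\<^bsub>M\<^esub> (b \<odot>\<^bsub>M\<^esub> m)"
    and smult_one: "m \<in> carrier M \<Longrightarrow> \<one>\<^bsub>A\<^esub> \<odot>\<^bsub>M\<^esub> m = m"
begin

lemma smult_zero_l: "m \<in> carrier M \<Longrightarrow> \<zero>\<^bsub>A\<^esub> \<odot>\<^bsub>M\<^esub> m = \<zero>\<^bsub>M\<^esub>"
  using smult_l_distr[of "\<zero>\<^bsub>A\<^esub>" "\<zero>\<^bsub>A\<^esub>" m] smult_closed[of "\<zero>\<^bsub>A\<^esub>" m] by simp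

lemma smult_zero_r: "a \<in> carrier A \<Longrightarrow> a \<odot>\<^bsub>M\<^esub> \<zero>\<^bsub>M\<^esub> = \<zero>\<^bsub>M\<^esub>"
  using smult_r_distr[of a "\<zero>\<^bsub>M\<^esub>" "\<zero>\<^bsub>M\<^esub>"] smult_closed[of a "\<zero>\<^bsub>M\<^esub>"] by simp

text \<open>
  The value at \<open>f\<close> of the linear map from a free module that sends the \<open>i\<close>-th basis vector to \<open>\<beta> i\<close>.
\<close>

definition lin_ext :: "('i \<Rightarrow> 'm) \<Rightarrow> ('i \<Rightarrow> 'a) \<Rightarrow> 'm" where
  "lin_ext \<beta> f = (\<Oplus>\<^bsub>M\<^esub>i\<in>{i. f i \<noteq> \<zero>\<^bsub>A\<^esub>}. f i \<odot>\<^bsub>M\<^esub> \<beta> i)"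

end

definition free_single :: "('a, 'x) ring_scheme \<Rightarrow> 'i \<Rightarrow> 'a \<Rightarrow> 'i \<Rightarrow> 'a" where
  "free_single A i a = (\<lambda>j. if j = i then a else \<zero>\<^bsub>A\<^esub>)"

context ring
begin

lemma free_mod_simps:
  "f \<oplus>\<^bsub>free_mod R X\<^esub> g = (\<lambda>x. f x \<oplus> g x)" "\<zero>\<^bsub>free_mod R X\<^esub> = (\<lambda>x. \<zero>)"
  "a \<odot>\<^bsub>free_mod R X\<^esub> f = (\<lambda>x. a \<otimes> f x)"
  by (simp_all add: free_mod_def)

lemma free_mod_carrier: "f \<in> carrier (free_mod R X) \<longleftrightarrow>
    finite {x. f x \<noteq> \<zero>} \<and> {x. f x \<noteq> \<zero>} \<subseteq> X \<and> (\<forall>x. f x \<in> carrier R)"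
  by (auto simp: free_mod_def)

lemma free_mod_add:
  assumes "f \<in> carrier (free_mod R X)" "g \<in> carrier (free_mod R X)"
  shows "(\<lambda>x. f x \<oplus> g x) \<in> carrier (free_mod R X)"
proof -
  have "{x. f x \<oplus> g x \<noteq> \<zero>} \<subseteq> {x. f x \<noteq> \<zero>} \<union> {x. g x \<noteq> \<zero>}" by auto
  then show ?thesis using assms by (auto simp: free_mod_carrier intro: finite_subset)
qed

lemma free_mod_smult:
  assumes "a \<in> carrier R" "f \<in> carrier (free_mod R X)"
  shows "(\<lambda>x. a \<otimes> f x) \<in> carrier (free_mod R X)"
proof -
  have "{x. a \<otimes> f x \<noteq> \<zero>} \<subseteq> {x. f x \<noteq> \<zero>}" using assms by auto
  then show ?thesis using assms by (auto simp: free_mod_carrier intro: finite_subset)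
qed

lemma free_single_carrier: "i \<in> X \<Longrightarrow> a \<in> carrier R \<Longrightarrow> free_single R i a \<in> carrier (free_mod R X)"
  by (auto simp: free_mod_carrier free_single_def)

lemma free_single_add:
  assumes "a \<in> carrier R" "b \<in> carrier R"
  shows "free_single R i (a \<oplus> b) = (\<lambda>x. free_single R i a x \<oplus> free_single R i b x)"
  using assms by (auto simp: free_single_def)

lemma free_single_smult:
  assumes "a \<in> carrier R" "b \<in> carrier R"
  shows "free_single R i (a \<otimes> b) = (\<lambda>x. a \<otimes> free_single R i b x)"
  using assms by (auto simp: free_single_def)

lemma free_mod_induct [consumes 1, case_names zero single add]:
  assumes "f \<in> carrier (free_mod R X)"
    and zero: "P (\<lambda>x. \<zero>)"
    and single: "\<And>i a. i \<in> X \<Longrightarrow> a \<in> carrier R \<Longrightarrow> P (free_single R i a)"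
    and add: "\<And>f g. f \<in> carrier (free_mod R X) \<Longrightarrow> g \<in> carrier (free_mod R X) \<Longrightarrow> P f \<Longrightarrow> P g \<Longrightarrow> P (\<lambda>x. f x \<oplus> g x)"
  shows "P f"
proof -
  have "\<forall>f. f \<in> carrier (free_mod R X) \<and> {x. f x \<noteq> \<zero>} \<subseteq> S \<longrightarrow> P f" if "finite S" for S
    using that
  proof (induction S rule: finite_induct)
    case empty
    have "f = (\<lambda>x. \<zero>)" if "{x. f x \<noteq> \<zero>} \<subseteq> {}" for f using that by auto
    then show ?case using zero by auto
  next
    case (insert i S)
    show ?case
    proof (intro allI impI)
      fix f assume f: "f \<in> carrier (free_mod R X) \<and> {x. f x \<noteq> \<zero>} \<subseteq> insert i S"
      define f' where "f' = f(i := \<zero>)"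
      have f': "f' \<in> carrier (free_mod R X)" "{x. f' x \<noteq> \<zero>} \<subseteq> S"
        using f by (auto simp: f'_def free_mod_carrier intro: finite_subset[rotated])
      show "P f"
      proof (cases "f i = \<zero>")
        case True
        then have "f' = f" by (auto simp: f'_def)
        then show ?thesis using f' insert by metis
      next
        case False
        then have i: "i \<in> X" "f i \<in> carrier R" using f by (auto simp: free_mod_carrier)
        have "f = (\<lambda>x. free_single R i (f i) x \<oplus> f' x)"
          using f by (auto simp: f'_def free_single_def free_mod_carrier)
        moreover have "P (\<lambda>x. free_single R i (f i) x \<oplus> f' x)"
          using i f' insert by (intro add single free_single_carrier) auto
        ultimately show ?thesis by simp
      qed
    qed
  qed
  from this[of "{x. f x \<noteq> \<zero>}"] assms(1) show ?thesis by (auto simp: free_mod_carrier)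
qed

end

context left_module
begin

lemma lin_ext_superset:
  assumes "f \<in> carrier (free_mod A X)" "\<beta> \<in> X \<rightarrow> carrier M" "finite S" "{i. f i \<noteq> \<zero>\<^bsub>A\<^esub>} \<subseteq> S" "S \<subseteq> X"
  shows "lin_ext \<beta> f = (\<Oplus>\<^bsub>M\<^esub>i\<in>S. f i \<odot>\<^bsub>M\<^esub> \<beta> i)"
  unfolding lin_ext_def
  by (rule M.add.finprod_mono_neutral_cong_left)
    (use assms in \<open>auto simp: A.free_mod_carrier smult_zero_l intro!: smult_closed smult_zero_l\<close>)

lemma lin_ext_closed:
  assumes "f \<in> carrier (free_mod A X)" "\<beta> \<in> X \<rightarrow> carrier M"
  shows "lin_ext \<beta> f \<in> carrier M"
  unfolding lin_ext_def
  by (rule M.finsum_closed) (use assms in \<open>auto simp: A.free_mod_carrier intro!: smult_closed\<close>)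

lemma lin_ext_add:
  assumes f: "f \<in> carrier (free_mod A X)" and g: "g \<in> carrier (free_mod A X)" and \<beta>: "\<beta> \<in> X \<rightarrow> carrier M"
  shows "lin_ext \<beta> (\<lambda>x. f x \<oplus>\<^bsub>A\<^esub> g x) = lin_ext \<beta> f \<oplus>\<^bsub>M\<^esub> lin_ext \<beta> g"
proof -
  let ?S = "{i. f i \<noteq> \<zero>\<^bsub>A\<^esub>} \<union> {i. g i \<noteq> \<zero>\<^bsub>A\<^esub>}"
  have S: "finite ?S" "?S \<subseteq> X" using f g by (auto simp: A.free_mod_carrier)
  have "lin_ext \<beta> (\<lambda>x. f x \<oplus>\<^bsub>A\<^esub> g x) = (\<Oplus>\<^bsub>M\<^esub>i\<in>?S. (f i \<oplus>\<^bsub>A\<^esub> g i) \<odot>\<^bsub>M\<^esub> \<beta> i)"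
    using S by (intro lin_ext_superset[OF A.free_mod_add[OF f g] \<beta>]) auto
  also have "\<dots> = (\<Oplus>\<^bsub>M\<^esub>i\<in>?S. f i \<odot>\<^bsub>M\<^esub> \<beta> i \<oplus>\<^bsub>M\<^esub> g i \<odot>\<^bsub>M\<^esub> \<beta> i)"
    using S f g \<beta> by (intro M.finsum_cong') (auto simp: A.free_mod_carrier Pi_iff subset_iff intro!: smult_l_distr smult_closed)
  also have "\<dots> = (\<Oplus>\<^bsub>M\<^esub>i\<in>?S. f i \<odot>\<^bsub>M\<^esub> \<beta> i) \<oplus>\<^bsub>M\<^esub> (\<Oplus>\<^bsub>M\<^esub>i\<in>?S. g i \<odot>\<^bsub>M\<^esub> \<beta> i)"
    using S f g \<beta> by (intro M.finsum_addf) (auto simp: A.free_mod_carrier Pi_iff subset_iff intro!: smult_closed)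
  also have "\<dots> = lin_ext \<beta> f \<oplus>\<^bsub>M\<^esub> lin_ext \<beta> g"
    using S lin_ext_superset[OF f \<beta>, of ?S] lin_ext_superset[OF g \<beta>, of ?S] by auto
  finally show ?thesis .
qed

lemma lin_ext_single:
  assumes "i \<in> X" "a \<in> carrier A" "\<beta> \<in> X \<rightarrow> carrier M"
  shows "lin_ext \<beta> (free_single A i a) = a \<odot>\<^bsub>M\<^esub> \<beta> i"
proof -
  have "lin_ext \<beta> (free_single A i a) = (\<Oplus>\<^bsub>M\<^esub>j\<in>{i}. free_single A i a j \<odot>\<^bsub>M\<^esub> \<beta> j)"
    using assms by (intro lin_ext_superset[OF A.free_single_carrier, of i X]) (auto simp: free_single_def)
  then show ?thesis using assms by (simp add: M.finsum_insert free_single_def smult_closed Pi_iff)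
qed

lemma lin_ext_zero: "lin_ext \<beta> (\<lambda>x. \<zero>\<^bsub>A\<^esub>) = \<zero>\<^bsub>M\<^esub>"
  by (simp add: lin_ext_def)

lemma lin_ext_smult:
  assumes a: "a \<in> carrier A" and f: "f \<in> carrier (free_mod A X)" and \<beta>: "\<beta> \<in> X \<rightarrow> carrier M"
  shows "lin_ext \<beta> (\<lambda>x. a \<otimes>\<^bsub>A\<^esub> f x) = a \<odot>\<^bsub>M\<^esub> lin_ext \<beta> f"
  using f
proof (induction f rule: A.free_mod_induct)
  case zero
  show ?case using a by (simp add: lin_ext_zero smult_zero_r)
next
  case (single i b)
  moreover have "\<beta> i \<in> carrier M" using single \<beta> by auto
  ultimately show ?case using a \<beta>
    by (simp add: A.free_single_smult[symmetric] lin_ext_single smult_assoc)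
next
  case (add f g)
  have "(\<lambda>x. a \<otimes>\<^bsub>A\<^esub> (f x \<oplus>\<^bsub>A\<^esub> g x)) = (\<lambda>x. a \<otimes>\<^bsub>A\<^esub> f x \<oplus>\<^bsub>A\<^esub> a \<otimes>\<^bsub>A\<^esub> g x)"
    using a add by (auto simp: A.free_mod_carrier A.r_distr)
  then show ?case using add a \<beta>
    by (simp add: lin_ext_add[where X = X] A.free_mod_smult[where X = X] lin_ext_closed[where X = X] smult_r_distr)
qed

end

definition regular_module :: "('a, 'x) ring_scheme \<Rightarrow> ('a, 'a) module" where
  "regular_module A = \<lparr>carrier = carrier A, monoid.mult = undefined, monoid.one = undefined,
     ring.zero = \<zero>\<^bsub>A\<^esub>, ring.add = (\<oplus>\<^bsub>A\<^esub>), smult = (\<otimes>\<^bsub>A\<^esub>)\<rparr>"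

lemma (in ring) left_module_regular: "left_module R (regular_module R)"
proof -
  have "abelian_group (regular_module R)"
    by (rule abelian_groupI) (auto simp: regular_module_def a_ac intro!: l_neg a_inv_closed)
  then show ?thesis
    by (intro left_module.intro left_module_axioms.intro ring_axioms)
      (auto simp: regular_module_def l_distr r_distr m_assoc)
qed

text \<open>
  \<open>M\<close> is generated by \<open>m0\<close>.  Then \<open>Ext\<^sup>1(M, N)\<close> can be computed from the presentation
  \<open>0 \<rightarrow> ann \<rightarrow> A \<rightarrow> M \<rightarrow> 0\<close> in place of the canonical one.
\<close>

locale ext_pair = M: left_module A M + N: left_module A N
  for A :: "('a, 'x) ring_scheme" and M :: "('a, 'm) module" and N :: "('a, 'n) module" +
  fixes s :: "'k::field \<Rightarrow> 'a" and m0 :: 'm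
  assumes s_closed: "s c \<in> carrier A"
    and s_add: "s (a + b) = s a \<oplus>\<^bsub>A\<^esub> s b" and s_mult: "s (a * b) = s a \<otimes>\<^bsub>A\<^esub> s b"
    and s_one: "s 1 = \<one>\<^bsub>A\<^esub>"
    and s_central: "r \<in> carrier A \<Longrightarrow> s c \<otimes>\<^bsub>A\<^esub> r = r \<otimes>\<^bsub>A\<^esub> s c"
    and m0: "m0 \<in> carrier M" and generator: "m \<in> carrier M \<Longrightarrow> \<exists>r\<in>carrier A. r \<odot>\<^bsub>M\<^esub> m0 = m"
begin

definition ann :: "'a set" where "ann = {a \<in> carrier A. a \<odot>\<^bsub>M\<^esub> m0 = \<zero>\<^bsub>M\<^esub>}"

definition is_hom :: "('a \<Rightarrow> 'n) \<Rightarrow> bool" where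
  "is_hom g \<longleftrightarrow> (\<forall>a\<in>ann. g a \<in> carrier N) \<and> (\<forall>a\<in>ann. \<forall>b\<in>ann. g (a \<oplus>\<^bsub>A\<^esub> b) = g a \<oplus>\<^bsub>N\<^esub> g b)
     \<and> (\<forall>r\<in>carrier A. \<forall>a\<in>ann. g (r \<otimes>\<^bsub>A\<^esub> a) = r \<odot>\<^bsub>N\<^esub> g a)"

text \<open>
  The choice \<open>lift m0 = 1\<close> makes \<open>coef\<close> a left inverse of \<open>a \<mapsto> free_single A m0 a\<close>.
\<close>

definition lift :: "'m \<Rightarrow> 'a" where
  "lift m = (if m = m0 then \<one>\<^bsub>A\<^esub> else SOME a. a \<in> carrier A \<and> a \<odot>\<^bsub>M\<^esub> m0 = m)"

lemma lift: "m \<in> carrier M \<Longrightarrow> lift m \<in> carrier A" "m \<in> carrier M \<Longrightarrow> lift m \<odot>\<^bsub>M\<^esub> m0 = m"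
proof -
  have "lift m \<in> carrier A \<and> lift m \<odot>\<^bsub>M\<^esub> m0 = m" if "m \<in> carrier M"
  proof (cases "m = m0")
    case False
    have "\<exists>a. a \<in> carrier A \<and> a \<odot>\<^bsub>M\<^esub> m0 = m" using generator[OF that] by auto
    from someI_ex[OF this] show ?thesis using False by (simp add: lift_def)
  qed (use m0 M.smult_one in \<open>auto simp: lift_def\<close>)
  then show "m \<in> carrier M \<Longrightarrow> lift m \<in> carrier A" "m \<in> carrier M \<Longrightarrow> lift m \<odot>\<^bsub>M\<^esub> m0 = m" by auto
qed

abbreviation "P \<equiv> free_mod A (carrier M)"
abbreviation "S \<equiv> syzygy A M"

interpretation R: left_module A "regular_module A" by (rule M.A.left_module_regular)

text \<open>
  \<open>coef\<close> lifts the canonical presentation of \<open>M\<close> to the presentation by \<open>A\<close>.  It maps the syzygies to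
  the annihilator of \<open>m0\<close>, and these are its only arguments with this property.
\<close>

definition coef :: "('m \<Rightarrow> 'a) \<Rightarrow> 'a" where "coef = R.lin_ext lift"

lemma lift_Pi: "lift \<in> carrier M \<rightarrow> carrier (regular_module A)"
  by (auto simp: regular_module_def lift)

lemma coef_closed: "f \<in> carrier P \<Longrightarrow> coef f \<in> carrier A"
  using R.lin_ext_closed[OF _ lift_Pi] by (simp add: coef_def regular_module_def)

lemma coef_add: "f \<in> carrier P \<Longrightarrow> g \<in> carrier P \<Longrightarrow> coef (\<lambda>x. f x \<oplus>\<^bsub>A\<^esub> g x) = coef f \<oplus>\<^bsub>A\<^esub> coef g"
  using R.lin_ext_add[OF _ _ lift_Pi] by (simp add: coef_def regular_module_def)

lemma coef_smult: "a \<in> carrier A \<Longrightarrow> f \<in> carrier P \<Longrightarrow> coef (\<lambda>x. a \<otimes>\<^bsub>A\<^esub> f x) = a \<otimes>\<^bsub>A\<^esub> coef f"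
  using R.lin_ext_smult[OF _ _ lift_Pi] by (simp add: coef_def regular_module_def)

lemma coef_single: "m \<in> carrier M \<Longrightarrow> a \<in> carrier A \<Longrightarrow> coef (free_single A m a) = a \<otimes>\<^bsub>A\<^esub> lift m"
  using R.lin_ext_single[OF _ _ lift_Pi] by (simp add: coef_def regular_module_def)

lemma coef_zero: "coef (\<lambda>x. \<zero>\<^bsub>A\<^esub>) = \<zero>\<^bsub>A\<^esub>"
  using R.lin_ext_zero[of lift] by (simp add: coef_def regular_module_def)

lemma coef_m0: "a \<in> carrier A \<Longrightarrow> coef (free_single A m0 a) = a"
  by (simp add: coef_single m0) (simp add: lift_def)

lemma S_carrier: "f \<in> carrier S \<longleftrightarrow> f \<in> carrier P \<and> coef f \<in> ann"
proof -
  have "M.lin_ext (\<lambda>m. m) f = coef f \<odot>\<^bsub>M\<^esub> m0" if "f \<in> carrier P"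
    using that
  proof (induction f rule: M.A.free_mod_induct)
    case zero
    then show ?case by (simp add: M.lin_ext_zero coef_zero M.smult_zero_l m0)
  next
    case (single m a)
    then show ?case
      by (simp add: M.lin_ext_single[where X = "carrier M"] coef_single M.smult_assoc lift m0)
  next
    case (add f g)
    then show ?case
      by (simp add: M.lin_ext_add[where X = "carrier M"] coef_add M.smult_l_distr coef_closed m0)
  qed
  then show ?thesis by (auto simp: syzygy_def M.lin_ext_def ann_def coef_closed)
qed

lemma S_simps: "f \<oplus>\<^bsub>S\<^esub> g = (\<lambda>x. f x \<oplus>\<^bsub>A\<^esub> g x)" "a \<odot>\<^bsub>S\<^esub> f = (\<lambda>x. a \<otimes>\<^bsub>A\<^esub> f x)"
  by (simp_all add: syzygy_def M.A.free_mod_simps)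

lemma ann_add: "a \<in> ann \<Longrightarrow> b \<in> ann \<Longrightarrow> a \<oplus>\<^bsub>A\<^esub> b \<in> ann"
  using m0 by (auto simp: ann_def M.smult_l_distr)

lemma ann_mult: "r \<in> carrier A \<Longrightarrow> a \<in> ann \<Longrightarrow> r \<otimes>\<^bsub>A\<^esub> a \<in> ann"
  using m0 by (auto simp: ann_def M.smult_assoc M.smult_zero_r)

lemma S_add: "f \<in> carrier S \<Longrightarrow> g \<in> carrier S \<Longrightarrow> (\<lambda>x. f x \<oplus>\<^bsub>A\<^esub> g x) \<in> carrier S"
  by (simp add: S_carrier M.A.free_mod_add coef_add ann_add)

lemma S_smult: "a \<in> carrier A \<Longrightarrow> f \<in> carrier S \<Longrightarrow> (\<lambda>x. a \<otimes>\<^bsub>A\<^esub> f x) \<in> carrier S"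
  by (simp add: S_carrier M.A.free_mod_smult coef_smult ann_mult)

lemma S_single: "a \<in> ann \<Longrightarrow> free_single A m0 a \<in> carrier S"
  using m0 by (auto simp: S_carrier coef_m0 ann_def intro!: M.A.free_single_carrier)

lemma mod_hom_S: "h \<in> mod_hom A S N \<longleftrightarrow> h \<in> carrier S \<rightarrow>\<^sub>E carrier N
    \<and> (\<forall>f\<in>carrier S. \<forall>g\<in>carrier S. h (\<lambda>x. f x \<oplus>\<^bsub>A\<^esub> g x) = h f \<oplus>\<^bsub>N\<^esub> h g)
    \<and> (\<forall>a\<in>carrier A. \<forall>f\<in>carrier S. h (\<lambda>x. a \<otimes>\<^bsub>A\<^esub> f x) = a \<odot>\<^bsub>N\<^esub> h f)"
  by (simp add: mod_hom_def S_simps)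

lemma mod_hom_P: "h \<in> mod_hom A P N \<longleftrightarrow> h \<in> carrier P \<rightarrow>\<^sub>E carrier N
    \<and> (\<forall>f\<in>carrier P. \<forall>g\<in>carrier P. h (\<lambda>x. f x \<oplus>\<^bsub>A\<^esub> g x) = h f \<oplus>\<^bsub>N\<^esub> h g)
    \<and> (\<forall>a\<in>carrier A. \<forall>f\<in>carrier P. h (\<lambda>x. a \<otimes>\<^bsub>A\<^esub> f x) = a \<odot>\<^bsub>N\<^esub> h f)"
  by (simp add: mod_hom_def M.A.free_mod_simps)

abbreviation "V \<equiv> hom_space A s S N"
definition "H = (\<lambda>f. restrict f (carrier S)) ` mod_hom A P N"

lemma SP: "f \<in> carrier S \<Longrightarrow> f \<in> carrier P" by (simp add: S_carrier)

lemma s_zero: "s 0 = \<zero>\<^bsub>A\<^esub>"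
  using s_add[of 0 0] s_closed[of 0] by simp

lemma s_swap: "a \<in> carrier A \<Longrightarrow> n \<in> carrier N \<Longrightarrow> s c \<odot>\<^bsub>N\<^esub> (a \<odot>\<^bsub>N\<^esub> n) = a \<odot>\<^bsub>N\<^esub> (s c \<odot>\<^bsub>N\<^esub> n)"
  by (metis N.smult_assoc s_central s_closed)

lemma comb_hom_S:
  "f \<in> mod_hom A S N \<Longrightarrow> g \<in> mod_hom A S N \<Longrightarrow> (\<lambda>x\<in>carrier S. f x \<oplus>\<^bsub>N\<^esub> g x) \<in> mod_hom A S N"
  "f \<in> mod_hom A S N \<Longrightarrow> (\<lambda>x\<in>carrier S. s c \<odot>\<^bsub>N\<^esub> f x) \<in> mod_hom A S N"
  "(\<lambda>x\<in>carrier S. \<zero>\<^bsub>N\<^esub>) \<in> mod_hom A S N"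
proof -
  have cl: "f x \<in> carrier N" if "f \<in> mod_hom A S N" "x \<in> carrier S" for f x
    using that by (auto simp: mod_hom_S)
  have ad: "f (\<lambda>x. u x \<oplus>\<^bsub>A\<^esub> v x) = f u \<oplus>\<^bsub>N\<^esub> f v" if "f \<in> mod_hom A S N" "u \<in> carrier S" "v \<in> carrier S" for f u v
    using that by (simp add: mod_hom_S)
  have sm: "f (\<lambda>x. a \<otimes>\<^bsub>A\<^esub> u x) = a \<odot>\<^bsub>N\<^esub> f u" if "f \<in> mod_hom A S N" "a \<in> carrier A" "u \<in> carrier S" for f a u
    using that by (simp add: mod_hom_S)
  show "(\<lambda>x\<in>carrier S. f x \<oplus>\<^bsub>N\<^esub> g x) \<in> mod_hom A S N" if f: "f \<in> mod_hom A S N" and g: "g \<in> mod_hom A S N"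
    unfolding mod_hom_S
    by (simp add: S_add S_smult cl[OF f] cl[OF g] ad[OF f] ad[OF g] sm[OF f] sm[OF g] N.smult_r_distr N.M.a_ac)
  show "(\<lambda>x\<in>carrier S. s c \<odot>\<^bsub>N\<^esub> f x) \<in> mod_hom A S N" if f: "f \<in> mod_hom A S N"
    unfolding mod_hom_S
    by (simp add: S_add S_smult cl[OF f] ad[OF f] sm[OF f] s_closed N.smult_closed N.smult_r_distr s_swap)
  show "(\<lambda>x\<in>carrier S. \<zero>\<^bsub>N\<^esub>) \<in> mod_hom A S N"
    unfolding mod_hom_S by (simp add: S_add S_smult N.smult_zero_r)
qed

lemma comb_hom_P:
  "f \<in> mod_hom A P N \<Longrightarrow> g \<in> mod_hom A P N \<Longrightarrow> (\<lambda>x\<in>carrier P. f x \<oplus>\<^bsub>N\<^esub> g x) \<in> mod_hom A P N"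
  "f \<in> mod_hom A P N \<Longrightarrow> (\<lambda>x\<in>carrier P. s c \<odot>\<^bsub>N\<^esub> f x) \<in> mod_hom A P N"
  "(\<lambda>x\<in>carrier P. \<zero>\<^bsub>N\<^esub>) \<in> mod_hom A P N"
proof -
  have cl: "f x \<in> carrier N" if "f \<in> mod_hom A P N" "x \<in> carrier P" for f x
    using that by (auto simp: mod_hom_P)
  have ad: "f (\<lambda>x. u x \<oplus>\<^bsub>A\<^esub> v x) = f u \<oplus>\<^bsub>N\<^esub> f v" if "f \<in> mod_hom A P N" "u \<in> carrier P" "v \<in> carrier P" for f u v
    using that by (simp add: mod_hom_P)
  have sm: "f (\<lambda>x. a \<otimes>\<^bsub>A\<^esub> u x) = a \<odot>\<^bsub>N\<^esub> f u" if "f \<in> mod_hom A P N" "a \<in> carrier A" "u \<in> carrier P" for f a u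
    using that by (simp add: mod_hom_P)
  show "(\<lambda>x\<in>carrier P. f x \<oplus>\<^bsub>N\<^esub> g x) \<in> mod_hom A P N" if f: "f \<in> mod_hom A P N" and g: "g \<in> mod_hom A P N"
    unfolding mod_hom_P
    by (simp add: M.A.free_mod_add M.A.free_mod_smult cl[OF f] cl[OF g] ad[OF f] ad[OF g] sm[OF f] sm[OF g] N.smult_r_distr N.M.a_ac)
  show "(\<lambda>x\<in>carrier P. s c \<odot>\<^bsub>N\<^esub> f x) \<in> mod_hom A P N" if f: "f \<in> mod_hom A P N"
    unfolding mod_hom_P
    by (simp add: M.A.free_mod_add M.A.free_mod_smult cl[OF f] ad[OF f] sm[OF f] s_closed N.smult_closed N.smult_r_distr s_swap)
  show "(\<lambda>x\<in>carrier P. \<zero>\<^bsub>N\<^esub>) \<in> mod_hom A P N"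
    unfolding mod_hom_P by (simp add: M.A.free_mod_add M.A.free_mod_smult N.smult_zero_r)
qed

lemma V_simps: "carrier V = mod_hom A S N" "f \<oplus>\<^bsub>V\<^esub> g = (\<lambda>x\<in>carrier S. f x \<oplus>\<^bsub>N\<^esub> g x)"
  "\<zero>\<^bsub>V\<^esub> = (\<lambda>x\<in>carrier S. \<zero>\<^bsub>N\<^esub>)" "c \<odot>\<^bsub>V\<^esub> f = (\<lambda>x\<in>carrier S. s c \<odot>\<^bsub>N\<^esub> f x)"
  by (simp_all add: hom_space_def)

lemma hom_S_closed: "f \<in> mod_hom A S N \<Longrightarrow> x \<in> carrier S \<Longrightarrow> f x \<in> carrier N"
  by (auto simp: mod_hom_S)

lemma hom_S_ext: "f \<in> mod_hom A S N \<Longrightarrow> x \<notin> carrier S \<Longrightarrow> f x = undefined"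
  by (auto simp: mod_hom_S PiE_iff extensional_def)

lemma restrict_S: "f \<in> mod_hom A P N \<Longrightarrow> restrict f (carrier S) \<in> mod_hom A S N"
  by (auto simp: mod_hom_P mod_hom_S S_add S_smult SP)

lemma V_abelian: "abelian_group V"
proof (rule abelian_groupI, unfold V_simps, goal_cases)
  case (3 f g h)
  then show ?case by (intro ext) (simp add: restrict_def hom_S_closed N.M.a_assoc)
next
  case (4 f g)
  then show ?case by (intro ext) (simp add: restrict_def hom_S_closed N.M.a_comm)
next
  case (5 f)
  then show ?case by (intro ext) (simp add: restrict_def hom_S_closed hom_S_ext)
next
  case (6 f)
  have "s (- 1) \<oplus>\<^bsub>A\<^esub> \<one>\<^bsub>A\<^esub> = \<zero>\<^bsub>A\<^esub>" using s_add[of "-1" 1] by (simp add: s_zero s_one)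
  then have "s (- 1) \<odot>\<^bsub>N\<^esub> n \<oplus>\<^bsub>N\<^esub> n = \<zero>\<^bsub>N\<^esub>" if "n \<in> carrier N" for n
    using N.smult_l_distr[of "s (-1)" "\<one>\<^bsub>A\<^esub>" n] that by (simp add: s_closed N.smult_one N.smult_zero_l)
  then show ?case using 6
    by (intro bexI[of _ "\<lambda>x\<in>carrier S. s (- 1) \<odot>\<^bsub>N\<^esub> f x"] comb_hom_S(2) ext)
      (simp_all add: restrict_def hom_S_closed)
qed (simp_all add: comb_hom_S)

lemma V_subspace: "subspace V H"
proof (rule subspace.intro[OF V_abelian], unfold_locales, unfold V_simps, goal_cases)
  case (1 v c)
  then show ?case by (rule comb_hom_S)
next
  case (2 v a b)
  then show ?case by (intro ext) (simp add: restrict_def hom_S_closed s_add s_closed N.smult_l_distr)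
next
  case (3 u v c)
  then show ?case by (intro ext) (simp add: restrict_def hom_S_closed s_closed N.smult_r_distr)
next
  case (4 v a b)
  then show ?case by (intro ext) (simp add: restrict_def hom_S_closed s_mult s_closed N.smult_assoc)
next
  case (5 v)
  then show ?case by (intro ext) (simp add: restrict_def hom_S_closed hom_S_ext s_one N.smult_one)
next
  case 6
  show ?case by (auto simp: H_def restrict_S)
next
  case 7
  show ?case
    unfolding H_def by (rule image_eqI[OF _ comb_hom_P(3)]) (simp add: restrict_def SP fun_eq_iff)
next
  case (8 f g)
  then obtain f' g' where "f' \<in> mod_hom A P N" "g' \<in> mod_hom A P N" "f = restrict f' (carrier S)" "g = restrict g' (carrier S)"
    by (auto simp: H_def)
  then show ?case
    unfolding H_def by (intro image_eqI[OF _ comb_hom_P(1)[of f' g']]) (simp_all add: restrict_def SP fun_eq_iff)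
next
  case (9 f c)
  then obtain f' where "f' \<in> mod_hom A P N" "f = restrict f' (carrier S)" by (auto simp: H_def)
  then show ?case
    unfolding H_def by (intro image_eqI[OF _ comb_hom_P(2)[of f' c]]) (simp_all add: restrict_def SP fun_eq_iff)
qed

sublocale subspace V H by (rule V_subspace)

lemma Ext1_eq: "Ext1 A s M N = quot_space V H"
  by (simp add: Ext1_def H_def)

text \<open>
  Subtracting \<open>coef f\<close> at \<open>m0\<close> projects the free module onto the syzygies.  A homomorphism on the syzygies,
  composed with this projection, extends to the free module; what is lost is its restriction to
  the annihilator of \<open>m0\<close>, where the part \<open>a \<mapsto> a y\<close> extends too.
\<close>

lemma split_hom:
  assumes h: "h \<in> mod_hom A S N" and y: "y \<in> carrier N"
    and u: "\<And>a. a \<in> ann \<Longrightarrow> u a \<in> carrier N \<and> h (free_single A m0 a) = a \<odot>\<^bsub>N\<^esub> y \<oplus>\<^bsub>N\<^esub> u a"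
  shows "\<exists>F\<in>mod_hom A P N. \<forall>f\<in>carrier S. h f = F f \<oplus>\<^bsub>N\<^esub> u (coef f)"
proof -
  \<comment> \<open>The projection onto the syzygies.\<close>
  define \<kappa> where "\<kappa> f = (\<lambda>x. f x \<oplus>\<^bsub>A\<^esub> free_single A m0 (\<ominus>\<^bsub>A\<^esub> coef f) x)" for f
  have sc: "f x \<in> carrier A" if "f \<in> carrier P" for f x using that by (simp add: M.A.free_mod_carrier)
  have fs: "free_single A m0 a x \<in> carrier A" if "a \<in> carrier A" for a x
    using that by (simp add: free_single_def)
  have \<kappa>_S: "\<kappa> f \<in> carrier S" if f: "f \<in> carrier P" for f
  proof -
    have s: "free_single A m0 (\<ominus>\<^bsub>A\<^esub> coef f) \<in> carrier P"
      by (rule M.A.free_single_carrier) (use f coef_closed m0 in auto)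
    have "coef (\<kappa> f) = \<zero>\<^bsub>A\<^esub>"
      unfolding \<kappa>_def using f s by (simp add: coef_add coef_m0 coef_closed M.A.r_neg)
    then show ?thesis unfolding S_carrier
      using f s M.A.free_mod_add m0 by (simp add: \<kappa>_def ann_def M.smult_zero_l)
  qed
  have \<kappa>_add: "\<kappa> (\<lambda>x. f x \<oplus>\<^bsub>A\<^esub> g x) = (\<lambda>x. \<kappa> f x \<oplus>\<^bsub>A\<^esub> \<kappa> g x)" if "f \<in> carrier P" "g \<in> carrier P" for f g
    using that coef_closed[of f] coef_closed[of g]
    by (auto simp: \<kappa>_def coef_add free_single_def M.A.minus_add sc M.A.a_ac fun_eq_iff)
  have \<kappa>_smult: "\<kappa> (\<lambda>x. a \<otimes>\<^bsub>A\<^esub> f x) = (\<lambda>x. a \<otimes>\<^bsub>A\<^esub> \<kappa> f x)" if "a \<in> carrier A" "f \<in> carrier P" for a f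
    using that coef_closed[of f]
    by (auto simp: \<kappa>_def coef_smult free_single_def sc fun_eq_iff M.A.r_distr M.A.r_minus)
  define F where "F = (\<lambda>f\<in>carrier P. h (\<kappa> f) \<oplus>\<^bsub>N\<^esub> coef f \<odot>\<^bsub>N\<^esub> y)"
  have hN: "h f \<in> carrier N" if "f \<in> carrier S" for f using hom_S_closed[OF h that] .
  have "F \<in> mod_hom A P N"
    unfolding mod_hom_P
  proof (intro conjI ballI)
    show "F \<in> carrier P \<rightarrow>\<^sub>E carrier N"
      by (auto simp: F_def hN \<kappa>_S coef_closed y N.smult_closed)
  next
    fix f g assume f: "f \<in> carrier P" "g \<in> carrier P"
    then have "h (\<kappa> (\<lambda>x. f x \<oplus>\<^bsub>A\<^esub> g x)) = h (\<kappa> f) \<oplus>\<^bsub>N\<^esub> h (\<kappa> g)"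
      using h \<kappa>_S by (simp add: \<kappa>_add mod_hom_S)
    then show "F (\<lambda>x. f x \<oplus>\<^bsub>A\<^esub> g x) = F f \<oplus>\<^bsub>N\<^esub> F g"
      using f y \<kappa>_S by (simp add: F_def M.A.free_mod_add coef_add coef_closed N.smult_l_distr hN N.smult_closed N.M.a_ac)
  next
    fix a f assume f: "a \<in> carrier A" "f \<in> carrier P"
    then have "h (\<kappa> (\<lambda>x. a \<otimes>\<^bsub>A\<^esub> f x)) = a \<odot>\<^bsub>N\<^esub> h (\<kappa> f)"
      using h \<kappa>_S by (simp add: \<kappa>_smult mod_hom_S)
    then show "F (\<lambda>x. a \<otimes>\<^bsub>A\<^esub> f x) = a \<odot>\<^bsub>N\<^esub> F f"
      using f y \<kappa>_S by (simp add: F_def M.A.free_mod_smult coef_smult coef_closed N.smult_r_distr N.smult_assoc hN N.smult_closed)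
  qed
  moreover have "h f = F f \<oplus>\<^bsub>N\<^esub> u (coef f)" if f: "f \<in> carrier S" for f
  proof -
    have fP: "f \<in> carrier P" and c: "coef f \<in> ann" using f by (auto simp: S_carrier)
    have cA: "coef f \<in> carrier A" using fP by (rule coef_closed)
    have "f = (\<lambda>x. \<kappa> f x \<oplus>\<^bsub>A\<^esub> free_single A m0 (coef f) x)"
      using cA sc[OF fP] by (auto simp: \<kappa>_def fun_eq_iff free_single_def M.A.a_assoc M.A.l_neg)
    then have "h f = h (\<lambda>x. \<kappa> f x \<oplus>\<^bsub>A\<^esub> free_single A m0 (coef f) x)" by (rule arg_cong)
    also have "\<dots> = h (\<kappa> f) \<oplus>\<^bsub>N\<^esub> h (free_single A m0 (coef f))"
      using h \<kappa>_S[OF fP] S_single[OF c] by (simp add: mod_hom_S)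
    finally show ?thesis using u[OF c] fP hN[OF \<kappa>_S[OF fP]] y cA by (simp add: F_def N.M.a_assoc N.smult_closed)
  qed
  ultimately show ?thesis by blast
qed

lemma is_hom_restrict:
  assumes h: "h \<in> mod_hom A S N"
  shows "is_hom (\<lambda>a. h (free_single A m0 a))"
proof -
  have a: "a \<in> carrier A" if "a \<in> ann" for a using that by (simp add: ann_def)
  show ?thesis unfolding is_hom_def
    using h by (auto simp: a M.A.free_single_add M.A.free_single_smult mod_hom_S S_single)
qed

theorem Ext1_zero:
  assumes "\<And>g. is_hom g \<Longrightarrow> \<exists>y\<in>carrier N. \<forall>a\<in>ann. g a = a \<odot>\<^bsub>N\<^esub> y"
  shows "vs_iso (Ext1 A s M N) zero_space"
  unfolding Ext1_eq
proof (rule quot_zero_space, rule subsetI)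
  fix h assume "h \<in> carrier V"
  then have h: "h \<in> mod_hom A S N" by (simp add: V_simps)
  from assms[OF is_hom_restrict[OF h]] obtain y
    where y: "y \<in> carrier N" "\<forall>a\<in>ann. h (free_single A m0 a) = a \<odot>\<^bsub>N\<^esub> y" by blast
  have "\<exists>F\<in>mod_hom A P N. \<forall>f\<in>carrier S. h f = F f \<oplus>\<^bsub>N\<^esub> \<zero>\<^bsub>N\<^esub>"
    by (rule split_hom[OF h y(1), where u = "\<lambda>_. \<zero>\<^bsub>N\<^esub>"]) (use y in \<open>auto simp: ann_def N.smult_closed\<close>)
  then obtain F where F: "F \<in> mod_hom A P N" and hF: "\<forall>f\<in>carrier S. h f = F f \<oplus>\<^bsub>N\<^esub> \<zero>\<^bsub>N\<^esub>"
    by (elim bexE)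
  have "F f \<in> carrier N" if "f \<in> carrier S" for f
    using F SP[OF that] by (auto simp: mod_hom_P)
  with hF have "h f = F f" if "f \<in> carrier S" for f using that by simp
  then have "h = restrict F (carrier S)" using hom_S_ext[OF h] by (intro ext) (simp add: restrict_def)
  then show "h \<in> H" using F by (auto simp: H_def)
qed

theorem Ext1_line:
  assumes g0: "is_hom g0" and nontriv: "\<not> (\<exists>y\<in>carrier N. \<forall>a\<in>ann. g0 a = a \<odot>\<^bsub>N\<^esub> y)"
    and span: "\<And>g. is_hom g \<Longrightarrow> \<exists>t. \<exists>y\<in>carrier N. \<forall>a\<in>ann. g a = a \<odot>\<^bsub>N\<^esub> y \<oplus>\<^bsub>N\<^esub> s t \<odot>\<^bsub>N\<^esub> g0 a"
  shows "vs_iso (Ext1 A s M N) line"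
  unfolding Ext1_eq
proof (rule quot_line)
  define v0 where "v0 = (\<lambda>f\<in>carrier S. g0 (coef f))"
  show "v0 \<in> carrier V"
    using g0 by (auto simp: v0_def V_simps mod_hom_S is_hom_def S_carrier M.A.free_mod_add M.A.free_mod_smult
        coef_add coef_smult ann_add ann_mult)
  show "v0 \<notin> H"
  proof
    assume "v0 \<in> H"
    then obtain F where F: "F \<in> mod_hom A P N" "v0 = restrict F (carrier S)" by (auto simp: H_def)
    \<comment> \<open>A homomorphism defined on the whole free module restricts to \<open>a \<mapsto> a y\<close> on the annihilator.\<close>
    let ?y = "F (free_single A m0 \<one>\<^bsub>A\<^esub>)"
    have sP: "free_single A m0 \<one>\<^bsub>A\<^esub> \<in> carrier P" by (rule M.A.free_single_carrier) (use m0 in auto)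
    have "g0 a = a \<odot>\<^bsub>N\<^esub> ?y" if a: "a \<in> ann" for a
    proof -
      have aA: "a \<in> carrier A" using a by (simp add: ann_def)
      have "g0 a = v0 (free_single A m0 a)" using aA S_single[OF a] by (simp add: v0_def coef_m0)
      also have "\<dots> = F (\<lambda>x. a \<otimes>\<^bsub>A\<^esub> free_single A m0 \<one>\<^bsub>A\<^esub> x)"
        using S_single[OF a] M.A.free_single_smult[OF aA M.A.one_closed, of m0] aA by (simp add: F)
      also have "\<dots> = a \<odot>\<^bsub>N\<^esub> ?y" using F(1) aA sP by (simp add: mod_hom_P)
      finally show ?thesis .
    qed
    moreover have "?y \<in> carrier N" using F(1) sP by (auto simp: mod_hom_P)
    ultimately show False using nontriv by blast
  qed
  fix h assume "h \<in> carrier V"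
  then have h: "h \<in> mod_hom A S N" by (simp add: V_simps)
  from span[OF is_hom_restrict[OF h]] obtain t y
    where y: "y \<in> carrier N" "\<forall>a\<in>ann. h (free_single A m0 a) = a \<odot>\<^bsub>N\<^esub> y \<oplus>\<^bsub>N\<^esub> s t \<odot>\<^bsub>N\<^esub> g0 a" by blast
  have "\<exists>F\<in>mod_hom A P N. \<forall>f\<in>carrier S. h f = F f \<oplus>\<^bsub>N\<^esub> s t \<odot>\<^bsub>N\<^esub> g0 (coef f)"
    by (rule split_hom[OF h y(1), where u = "\<lambda>a. s t \<odot>\<^bsub>N\<^esub> g0 a"]) (use y g0 in \<open>auto simp: is_hom_def s_closed N.smult_closed\<close>)
  then obtain F where F: "F \<in> mod_hom A P N" "\<forall>f\<in>carrier S. h f = F f \<oplus>\<^bsub>N\<^esub> s t \<odot>\<^bsub>N\<^esub> g0 (coef f)" by (elim bexE)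
  then have "h = restrict F (carrier S) \<oplus>\<^bsub>V\<^esub> t \<odot>\<^bsub>V\<^esub> v0"
    using hom_S_ext[OF h] by (intro ext) (simp add: V_simps v0_def restrict_def)
  then show "\<exists>t. \<exists>k\<in>H. h = k \<oplus>\<^bsub>V\<^esub> t \<odot>\<^bsub>V\<^esub> v0" using F by (auto simp: H_def)
qed

end

section \<open>The Witt algebra as truncated polynomial vector fields\<close>

abbreviation XP :: "'k::field poly" where "XP \<equiv> Polynomial.monom 1 CHAR('k)"

text \<open>
  The polynomial \<open>a\<close> of degree less than \<open>p\<close> for which \<open>x\<close> acts on \<open>k[X]/(X\<^sup>p)\<close> as \<open>a d/dX\<close>.
\<close>

definition vfield :: "'k::field lie \<Rightarrow> 'k poly" where
  "vfield x = (\<Sum>i\<in>{-1..int CHAR('k) - 2}. Polynomial.monom (Poly_Mapping.lookup x i) (nat (i + 1)))"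

definition of_vfield :: "'k::field poly \<Rightarrow> 'k lie" where
  "of_vfield a = (\<Sum>i\<in>{-1..int CHAR('k) - 2}. scale (Polynomial.coeff a (nat (i + 1))) (witt_e i))"

lemma coeff_mod_monom:
  "Polynomial.coeff (a mod Polynomial.monom 1 n) m = (if m < n then Polynomial.coeff (a::'k::field poly) m else 0)"
proof (cases "m < n")
  case True
  have "Polynomial.coeff a m = Polynomial.coeff (Polynomial.monom 1 n * (a div Polynomial.monom 1 n) + a mod Polynomial.monom 1 n) m"
    by simp
  also have "\<dots> = Polynomial.coeff (a mod Polynomial.monom 1 n) m"
    using True unfolding Polynomial.coeff_add by (simp add: coeff_monom_mult)
  finally show ?thesis using True by simp
next
  case False
  have "Polynomial.degree (a mod Polynomial.monom 1 n) < n \<or> a mod Polynomial.monom 1 n = 0"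
    using degree_mod_less[of "Polynomial.monom 1 n" a] by (auto simp: degree_monom_eq monom_eq_0_iff)
  then show ?thesis using False by (auto simp: coeff_eq_0)
qed

lemma XP_dvd_iff: "XP dvd a \<longleftrightarrow> (\<forall>n<CHAR('k). Polynomial.coeff (a::'k::field poly) n = 0)"
  by (auto simp: dvd_eq_mod_eq_0 poly_eq_iff coeff_mod_monom)

lemma mod_XP_eq_iff: "a mod XP = b mod XP \<longleftrightarrow> XP dvd (a - b :: 'k::field poly)"
  by (auto simp: XP_dvd_iff poly_eq_iff coeff_mod_monom)

lemma XP_dvd_mod: "XP dvd (a mod XP - a :: 'k::field poly)" "XP dvd (a - a mod XP :: 'k::field poly)"
  by (auto simp: XP_dvd_iff coeff_mod_monom)

lemma XP_dvd_pderiv: "XP dvd (a::'k::field poly) \<Longrightarrow> XP dvd pderiv a"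
proof -
  have "pderiv (XP :: 'k poly) = 0" by (simp add: pderiv_monom)
  then show "XP dvd a \<Longrightarrow> XP dvd pderiv a" by (auto simp: pderiv_mult elim!: dvdE)
qed

lemma lookup_scale: "Poly_Mapping.lookup (scale c x) i = c * Poly_Mapping.lookup x i"
  by (simp add: scale_def map.rep_eq when_def)

lemma lookup_witt_e: "Poly_Mapping.lookup (witt_e i :: 'k::field lie) j = (if i = j then 1 else 0)"
  by (simp add: witt_e_def lookup_single when_def)

lemma coeff_vfield:
  "Polynomial.coeff (vfield (x::'k::field lie)) n = (if n < CHAR('k) then Poly_Mapping.lookup x (int n - 1) else 0)"
proof -
  have "Polynomial.coeff (vfield x) n = (\<Sum>i\<in>{-1..int CHAR('k) - 2}. if i = int n - 1 then Poly_Mapping.lookup x i else 0)"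
    unfolding vfield_def coeff_sum by (rule sum.cong) auto
  then show ?thesis by (simp add: sum.delta)
qed

lemma lookup_sum: "Poly_Mapping.lookup (sum f S) i = (\<Sum>s\<in>S. Poly_Mapping.lookup (f s) i)"
  by (induction S rule: infinite_finite_induct) (simp_all add: lookup_add)

lemma lookup_of_vfield: "Poly_Mapping.lookup (of_vfield (a::'k::field poly)) i =
    (if i \<in> {-1..int CHAR('k) - 2} then Polynomial.coeff a (nat (i + 1)) else 0)"
  by (simp add: of_vfield_def lookup_sum lookup_scale lookup_witt_e if_distrib[of "\<lambda>x. _ * x"] cong: if_cong)

lemma in_witt_iff: "x \<in> witt \<longleftrightarrow> (\<forall>i. i \<notin> {-1..int CHAR('k) - 2} \<longrightarrow> Poly_Mapping.lookup (x::'k::field lie) i = 0)"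
  by (auto simp: witt_def witt_filt_def in_keys_iff subset_iff)

lemma in_borel_iff: "x \<in> witt_borel \<longleftrightarrow> x \<in> witt \<and> Poly_Mapping.lookup (x::'k::field lie) (- 1) = 0"
proof -
  have "i \<notin> {0..n} \<longleftrightarrow> i \<notin> {-1..n} \<or> i = -1" for i n :: int by auto
  then show ?thesis unfolding in_witt_iff
    by (auto simp: witt_borel_def witt_filt_def in_keys_iff subset_iff)
qed

lemma of_vfield_witt: "of_vfield a \<in> witt" by (simp add: in_witt_iff lookup_of_vfield)

lemma of_vfield_vfield: "x \<in> witt \<Longrightarrow> of_vfield (vfield (x::'k::field lie)) = x"
  by (rule poly_mapping_eqI) (auto simp: lookup_of_vfield coeff_vfield in_witt_iff)

lemma vfield_of_vfield: "vfield (of_vfield a) = (a::'k::field poly) mod XP"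
  by (rule poly_eqI) (auto simp: lookup_of_vfield coeff_vfield coeff_mod_monom)

lemma vfield_inj: "x \<in> witt \<Longrightarrow> y \<in> witt \<Longrightarrow> vfield (x::'k::field lie) = vfield y \<Longrightarrow> x = y"
  by (metis of_vfield_vfield)

lemma vfield_add: "vfield (x + y) = vfield (x::'k::field lie) + vfield y"
  by (rule poly_eqI) (simp add: coeff_vfield lookup_add)

lemma vfield_scale: "vfield (scale c x) = Polynomial.smult c (vfield (x::'k::field lie))"
  by (rule poly_eqI) (simp add: coeff_vfield lookup_scale)

lemma vfield_0: "vfield 0 = (0::'k::field poly)"
  by (rule poly_eqI) (simp add: coeff_vfield)

lemma vfield_sum: "vfield (sum f S) = (\<Sum>s\<in>S. vfield (f s :: 'k::field lie))"
  by (induction S rule: infinite_finite_induct) (simp_all add: vfield_add vfield_0)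

lemma vfield_e: "i \<in> {-1..int CHAR('k) - 2} \<Longrightarrow> vfield (witt_e i :: 'k::field lie) = Polynomial.monom 1 (nat (i + 1))"
  by (rule poly_eqI) (auto simp: coeff_vfield lookup_witt_e)

lemma vfield_mod: "vfield (x::'k::field lie) mod XP = vfield x"
  by (rule poly_eqI) (simp add: coeff_vfield coeff_mod_monom)

lemma witt_add: "x \<in> witt \<Longrightarrow> y \<in> witt \<Longrightarrow> x + y \<in> witt" by (simp add: in_witt_iff lookup_add)
lemma witt_0: "0 \<in> witt" by (simp add: in_witt_iff)
lemma witt_scale: "x \<in> witt \<Longrightarrow> scale c x \<in> witt" by (simp add: in_witt_iff lookup_scale)
lemma witt_e_in: "i \<in> {-1..int CHAR('k) - 2} \<Longrightarrow> (witt_e i :: 'k::field lie) \<in> witt"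
  by (auto simp: in_witt_iff lookup_witt_e)
lemma witt_sum: "(\<And>s. s \<in> S \<Longrightarrow> f s \<in> witt) \<Longrightarrow> sum f S \<in> witt"
  by (simp add: in_witt_iff lookup_sum)

lemma witt_bracket_in: "witt_bracket x y \<in> witt"
  unfolding witt_bracket_def
  by (intro witt_sum) (auto intro!: witt_scale witt_e_in witt_0)

lemma witt_pmap_eq: "witt_pmap x = of_vfield ((witt_der x ^^ CHAR('k)) (Polynomial.monom 1 1))" for x :: "'k::field lie"
  by (simp add: witt_pmap_def of_vfield_def)

lemma witt_pmap_in: "witt_pmap x \<in> witt"
  by (simp add: witt_pmap_eq of_vfield_witt)

lemma pderiv_sum_poly: "pderiv (sum f S) = (\<Sum>s\<in>S. pderiv (f s :: 'k::field poly))"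
  by (induction S rule: infinite_finite_induct) (simp_all add: pderiv_add)

lemma vfield_bracket:
  fixes x y :: "'k::field lie"
  assumes "CHAR('k) \<ge> 2" "x \<in> witt" "y \<in> witt"
  shows "vfield (witt_bracket x y) = density (- 1) (vfield x) (vfield y) mod XP"
proof -
  let ?R = "{-1..int CHAR('k) - 2}"
  let ?t = "\<lambda>i j. if i + j \<in> ?R then Polynomial.monom (of_int (j - i) * Poly_Mapping.lookup x i * Poly_Mapping.lookup y j) (nat (i + j + 1)) else 0"
  let ?b = "\<lambda>i j. if i + j \<in> ?R then scale (of_int (j - i) * Poly_Mapping.lookup x i * Poly_Mapping.lookup y j) (witt_e (i + j)) else 0"
  have s0: "scale 0 z = (0 :: 'k lie)" for z by (rule poly_mapping_eqI) (simp add: lookup_scale)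
  have K: "Poly_Mapping.keys x \<subseteq> ?R" "Poly_Mapping.keys y \<subseteq> ?R"
    using assms by (auto simp: witt_def witt_filt_def)
  have "witt_bracket x y = (\<Sum>i\<in>Poly_Mapping.keys x. \<Sum>j\<in>?R. ?b i j)"
    unfolding witt_bracket_def
    by (intro sum.cong refl sum.mono_neutral_left) (use K in \<open>auto simp: in_keys_iff s0\<close>)
  also have "\<dots> = (\<Sum>i\<in>?R. \<Sum>j\<in>?R. ?b i j)"
    by (intro sum.mono_neutral_left) (use K in \<open>auto simp: in_keys_iff s0 intro!: sum.neutral\<close>)
  finally have "vfield (witt_bracket x y) = (\<Sum>i\<in>?R. \<Sum>j\<in>?R. ?t i j)"
    by (simp add: vfield_sum vfield_scale vfield_e vfield_0 if_distrib[of vfield] smult_monom add_ac cong: if_cong)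
  also have "\<dots> = (\<Sum>i\<in>?R. \<Sum>j\<in>?R. density (- 1) (Polynomial.monom (Poly_Mapping.lookup x i) (nat (i + 1)))
      (Polynomial.monom (Poly_Mapping.lookup y j) (nat (j + 1))) mod XP)"
  proof (intro sum.cong refl)
    fix i j assume ij: "i \<in> ?R" "j \<in> ?R"
    obtain m n where mn: "m = nat (i + 1)" "n = nat (j + 1)" by auto
    have i: "i = int m - 1" "j = int n - 1" using ij mn by auto
    have "density (- 1) (Polynomial.monom a m) (Polynomial.monom b n) mod XP =
        (if m + n < Suc CHAR('k) \<and> m + n \<noteq> 0 then Polynomial.monom (of_int (int n - int m) * a * b) (m + n - 1) else 0)" for a b :: 'k
    proof (cases "m + n = 0")
      case True
      then show ?thesis by (simp add: density_def pderiv_monom)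
    next
      case False
      have "density (- 1) (Polynomial.monom a m) (Polynomial.monom b n) = Polynomial.monom ((of_nat n - of_nat m) * a * b) (m + n - 1)"
        using False by (cases m; cases n) (auto simp: density_def pderiv_monom mult_monom smult_monom add_monom algebra_simps)
      then show ?thesis using False by (auto simp: mod_monom)
    qed
    moreover have "i + j \<in> ?R \<longleftrightarrow> m + n < Suc CHAR('k) \<and> m + n \<noteq> 0" unfolding i by auto
    moreover have "nat (i + j + 1) = m + n - 1" unfolding i by auto
    ultimately show "?t i j = density (- 1) (Polynomial.monom (Poly_Mapping.lookup x i) (nat (i + 1)))
      (Polynomial.monom (Poly_Mapping.lookup y j) (nat (j + 1))) mod XP"
      unfolding mn[symmetric] by (simp add: i)
  qed
  also have "\<dots> = (\<Sum>i\<in>?R. \<Sum>j\<in>?R. density (- 1) (Polynomial.monom (Poly_Mapping.lookup x i) (nat (i + 1)))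
      (Polynomial.monom (Poly_Mapping.lookup y j) (nat (j + 1)))) mod XP"
    by (rule poly_eqI) (simp add: coeff_mod_monom coeff_sum)
  also have "(\<Sum>i\<in>?R. \<Sum>j\<in>?R. density (- 1) (Polynomial.monom (Poly_Mapping.lookup x i) (nat (i + 1)))
      (Polynomial.monom (Poly_Mapping.lookup y j) (nat (j + 1)))) = density (- 1) (vfield x) (vfield y)"
    unfolding density_def vfield_def
    by (simp add: sum_product sum.distrib pderiv_sum_poly sum_negf sum_subtractf)
  finally show ?thesis .
qed

lemma density_cong: "XP dvd (a - b) \<Longrightarrow> XP dvd (u - v) \<Longrightarrow> XP dvd (density c a u - density c b v)"
  for a b u v :: "'k::field poly"
proof -
  assume a: "XP dvd (a - b)" and u: "XP dvd (u - v)"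
  have "density c a u - density c b v = (a - b) * pderiv u + b * pderiv (u - v)
      + Polynomial.smult c (pderiv (a - b) * u) + Polynomial.smult c (pderiv b * (u - v))"
    by (simp add: density_def pderiv_diff algebra_simps smult_diff_right)
  also have "XP dvd \<dots>"
    by (intro dvd_add dvd_mult dvd_mult2 dvd_smult a u XP_dvd_pderiv)
  finally show ?thesis .
qed

lemma vfield_pmap:
  fixes x :: "'k::field lie"
  assumes "CHAR('k) > 0"
  shows "vfield (witt_pmap x) = vfield_pow (vfield x) mod XP"
proof -
  have wd: "witt_der x f = (vfield x * pderiv f) mod XP" for f by (simp add: witt_der_def vfield_def)
  have "XP dvd ((witt_der x ^^ n) f - ((\<lambda>f. vfield x * pderiv f) ^^ n) f)" for n f
  proof (induction n)
    case (Suc n)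
    have "XP dvd ((vfield x * pderiv ((witt_der x ^^ n) f)) mod XP - vfield x * pderiv ((witt_der x ^^ n) f))
        + vfield x * pderiv ((witt_der x ^^ n) f - ((\<lambda>f. vfield x * pderiv f) ^^ n) f)"
      by (intro dvd_add XP_dvd_mod dvd_mult XP_dvd_pderiv Suc)
    moreover have "(witt_der x ^^ Suc n) f = (vfield x * pderiv ((witt_der x ^^ n) f)) mod XP"
      unfolding funpow.simps(2) o_apply by (rule wd)
    ultimately show ?case by (simp add: pderiv_diff right_diff_distrib)
  qed simp
  from this[of "CHAR('k)" "Polynomial.monom 1 1"] show ?thesis
    by (simp add: witt_pmap_eq vfield_of_vfield vfield_pow_def mod_XP_eq_iff monom_Suc monom_0)
qed

text \<open>
  By the freshman's dream \<open>g\<^sup>p\<close> is a polynomial in \<open>X\<^sup>p\<close> with constant term \<open>g(0)\<^sup>p\<close>.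
\<close>

lemma frobenius_XP:
  fixes g :: "'k::field poly"
  assumes "CHAR('k) > 0"
  shows "XP dvd (g ^ CHAR('k) - [:Polynomial.coeff g 0 ^ CHAR('k):])"
proof -
  have pr: "prime CHAR('k poly)" using prime_CHAR_semidom[OF assms] by simp
  obtain c q where g: "g = pCons c q" by (cases g)
  then have "g = [:c:] + [:0, 1:] * q" by simp
  then have "g ^ CHAR('k) = ([:c:] + [:0, 1:] * q) ^ CHAR('k)" by (rule arg_cong)
  also have "\<dots> = [:c:] ^ CHAR('k) + [:0, 1:] ^ CHAR('k) * q ^ CHAR('k)"
    unfolding power_mult_distrib[symmetric] by (rule freshmans_dream[OF pr]) simp
  finally have "g ^ CHAR('k) = [:c:] ^ CHAR('k) + [:0, 1:] ^ CHAR('k) * q ^ CHAR('k)" .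
  moreover have "[:0, 1:] ^ CHAR('k) = (XP :: 'k poly)" by (simp add: monom_altdef)
  ultimately show ?thesis by (simp add: g poly_const_pow)
qed

text \<open>
  The adjoint action is the action on densities of weight \<open>-1\<close>, and \<open>c\<^sup>p - c\<close> vanishes for \<open>c = -1\<close>.
\<close>

lemma ad_pmap:
  fixes x y :: "'k::field lie"
  assumes p: "CHAR('k) > 0" and x: "x \<in> witt" and y: "y \<in> witt"
  shows "(witt_bracket x ^^ CHAR('k)) y = witt_bracket (witt_pmap x) y"
proof -
  have p2: "CHAR('k) \<ge> 2" using prime_CHAR_semidom[OF p] by (rule prime_ge_2_nat)
  have w: "(witt_bracket x ^^ n) y \<in> witt" for n by (cases n) (simp_all add: y witt_bracket_in)
  have "XP dvd (vfield ((witt_bracket x ^^ n) y) - (density (- 1) (vfield x) ^^ n) (vfield y))" for n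
  proof (induction n)
    case (Suc n)
    have "XP dvd (density (- 1) (vfield x) (vfield ((witt_bracket x ^^ n) y)) mod XP - density (- 1) (vfield x) (vfield ((witt_bracket x ^^ n) y)))
      + (density (- 1) (vfield x) (vfield ((witt_bracket x ^^ n) y)) - density (- 1) (vfield x) ((density (- 1) (vfield x) ^^ n) (vfield y)))"
      by (intro dvd_add XP_dvd_mod density_cong Suc) simp
    then show ?case by (simp add: vfield_bracket p2 x w)
  qed simp
  from this[of "CHAR('k)"]
  have "vfield ((witt_bracket x ^^ CHAR('k)) y) mod XP = (density (- 1) (vfield x) ^^ CHAR('k)) (vfield y) mod XP"
    by (simp add: mod_XP_eq_iff)
  moreover have "(- 1 :: 'k) ^ CHAR('k) = - 1" using of_int_pow_CHAR[OF p, of "- 1"] by (metis of_int_1 of_int_minus rangeI)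
  ultimately have "vfield ((witt_bracket x ^^ CHAR('k)) y) mod XP = density (- 1) (vfield_pow (vfield x)) (vfield y) mod XP"
    by (simp add: density_funpow_CHAR[OF p])
  also have "\<dots> = density (- 1) (vfield (witt_pmap x)) (vfield y) mod XP"
    unfolding mod_XP_eq_iff vfield_pmap[OF p] by (rule density_cong) (simp_all add: XP_dvd_mod)
  finally have "vfield ((witt_bracket x ^^ CHAR('k)) y) = vfield (witt_bracket (witt_pmap x) y)"
    by (simp add: vfield_mod vfield_bracket p2 witt_pmap_in y)
  then show ?thesis by (rule vfield_inj[OF w witt_bracket_in])
qed

text \<open>
  A vector field \<open>a d/dX\<close> that commutes with \<open>d/dX\<close> and \<open>X d/dX\<close> has \<open>a' = 0\<close> and \<open>a = a' X\<close>.
\<close>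

lemma witt_centre:
  fixes u v :: "'k::field lie"
  assumes p: "CHAR('k) > 0" and u: "u \<in> witt" and v: "v \<in> witt"
    and eq: "\<And>z. z \<in> witt \<Longrightarrow> witt_bracket u z = witt_bracket v z"
  shows "u = v"
proof -
  have p2: "CHAR('k) \<ge> 2" using prime_CHAR_semidom[OF p] by (rule prime_ge_2_nat)
  let ?a = "vfield u - vfield v"
  have *: "XP dvd (?a * pderiv (vfield z) - pderiv ?a * vfield z)" if "z \<in> witt" for z
  proof -
    have "density (- 1) (vfield u) (vfield z) mod XP = density (- 1) (vfield v) (vfield z) mod XP"
      using eq[OF that] vfield_bracket[OF p2] u v that by metis
    then show ?thesis unfolding mod_XP_eq_iff by (simp add: density_def algebra_simps pderiv_diff)
  qed
  have 1: "vfield (witt_e (- 1) :: 'k lie) = 1" "vfield (witt_e 0 :: 'k lie) = [:0, 1:]"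
    using p2 by (simp_all add: vfield_e monom_Suc monom_0 one_pCons)
  have "XP dvd pderiv ?a" using *[of "witt_e (- 1)"] p2 1 by (simp add: witt_e_in)
  moreover have "XP dvd (?a - pderiv ?a * [:0, 1:])" using *[of "witt_e 0"] p2 1 by (simp add: witt_e_in pderiv_pCons)
  ultimately have "XP dvd ?a" by (metis dvd_diffD dvd_mult2 diff_add_cancel dvd_add)
  then have "vfield u mod XP = vfield v mod XP" by (simp add: mod_XP_eq_iff)
  then show ?thesis using vfield_inj[OF u v] by (simp add: vfield_mod)
qed

text \<open>
  Both sides have the same adjoint action, namely \<open>\<sigma> ad(x)\<^sup>p \<sigma>\<^sup>-\<^sup>1 = ad(\<sigma> x)\<^sup>p\<close>.
\<close>

lemma aut_pmap:
  fixes \<sigma> :: "'k::field lie \<Rightarrow> 'k lie"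
  assumes p: "CHAR('k) > 0" and \<sigma>: "\<sigma> \<in> witt_aut" and x: "x \<in> witt"
  shows "\<sigma> (witt_pmap x) = witt_pmap (\<sigma> x)"
proof (rule witt_centre[OF p])
  have bij: "bij_betw \<sigma> witt witt" and br: "\<And>x y. x \<in> witt \<Longrightarrow> y \<in> witt \<Longrightarrow> \<sigma> (witt_bracket x y) = witt_bracket (\<sigma> x) (\<sigma> y)"
    using \<sigma> by (auto simp: witt_aut_def)
  have cl: "\<sigma> z \<in> witt" if "z \<in> witt" for z using bij that by (auto simp: bij_betw_def)
  show "\<sigma> (witt_pmap x) \<in> witt" "witt_pmap (\<sigma> x) \<in> witt" by (auto simp: cl witt_pmap_in)
  fix z :: "'k lie" assume "z \<in> witt"
  then obtain y where y: "y \<in> witt" "z = \<sigma> y" using bij by (auto simp: bij_betw_def)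
  have w: "(witt_bracket x ^^ n) y \<in> witt" for n by (cases n) (simp_all add: y witt_bracket_in)
  have it: "\<sigma> ((witt_bracket x ^^ n) y) = (witt_bracket (\<sigma> x) ^^ n) (\<sigma> y)" for n
    by (induction n) (simp_all add: br x w)
  have "witt_bracket (\<sigma> (witt_pmap x)) z = \<sigma> ((witt_bracket x ^^ CHAR('k)) y)"
    by (simp add: y br witt_pmap_in ad_pmap[OF p x y(1)])
  also have "\<dots> = witt_bracket (witt_pmap (\<sigma> x)) z"
    by (simp add: it ad_pmap[OF p cl[OF x] cl[OF y(1)]] y)
  finally show "witt_bracket (\<sigma> (witt_pmap x)) z = witt_bracket (witt_pmap (\<sigma> x)) z" .
qed

section \<open>Density operators and the cocycles of degree two, three and four\<close>

lemma density_add_v: "density c a (u + v) = density c a u + density c a v"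
  by (simp add: density_def pderiv_add algebra_simps smult_add_right)

lemma density_smult_v: "density c a (Polynomial.smult t v) = Polynomial.smult t (density c a v)"
  by (simp add: density_def pderiv_smult algebra_simps smult_add_right)

lemma density_add_a: "density c (a + b) v = density c a v + density c b v"
  by (simp add: density_def pderiv_add algebra_simps smult_add_right)

lemma density_smult_a: "density c (Polynomial.smult t a) v = Polynomial.smult t (density c a v)"
  by (simp add: density_def pderiv_smult algebra_simps smult_add_right)

text \<open>
  The cocycle identities hold for any derivation of a commutative ring.  In this generality they are
  identities between formal products of derivatives.
\<close>

locale derivation =
  fixes D :: "'a::comm_ring_1 \<Rightarrow> 'a" and c :: 'a
  assumes D_add: "D (a + b) = D a + D b" and D_mult: "D (a * b) = a * D b + D a * b"
    and D_c: "D c = 0"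
begin

lemma D_0: "D 0 = 0" using D_add[of 0 0] by simp
lemma D_1: "D 1 = 0" using D_mult[of 1 1] by simp
lemma D_minus: "D (- a) = - D a" using D_add[of a "- a"] by (simp add: D_0 eq_neg_iff_add_eq_0 add.commute)
lemma D_diff: "D (a - b) = D a - D b" using D_add[of a "- b"] by (simp add: D_minus)
lemma D_nat: "D (of_nat n) = 0" by (induction n) (simp_all add: D_0 D_1 D_add)
lemma D_num: "D (numeral n) = 0" using D_nat[of "numeral n"] by simp

definition lie_der :: "'a \<Rightarrow> 'a \<Rightarrow> 'a \<Rightarrow> 'a" where "lie_der w a f = a * D f + w * D a * f"

lemmas D_simps = D_add D_diff D_mult D_c D_0 D_1 D_minus D_num

text \<open>
  The three cocycles are the compositions of \<open>a \<mapsto> a'''\<close>, which takes vector fields to quadratic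
  differentials, with the transvectants of order \<open>0\<close>, \<open>1\<close> and \<open>2\<close> into densities of weight \<open>c + 2\<close>,
  \<open>c + 3\<close> and \<open>c + 4\<close>.
\<close>

definition coc2 :: "'a \<Rightarrow> 'a \<Rightarrow> 'a" where "coc2 a f = D (D (D a)) * f"
definition coc3 :: "'a \<Rightarrow> 'a \<Rightarrow> 'a" where "coc3 a f = 2 * D (D (D a)) * D f - c * D (D (D (D a))) * f"
definition coc4 :: "'a \<Rightarrow> 'a \<Rightarrow> 'a" where
  "coc4 a f = 10 * D (D (D a)) * D (D f) - 5 * (2 * c + 1) * D (D (D (D a))) * D f
     + c * (2 * c + 1) * D (D (D (D (D a)))) * f"

lemma bracket: "lie_der c a (lie_der c b f) - lie_der c b (lie_der c a f) = lie_der c (lie_der (-1) a b) f"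
  unfolding lie_der_def by (simp add: D_simps) (simp add: algebra_simps)

lemma coc2: "lie_der (c + 2) a (coc2 b f) + coc2 a (lie_der c b f) - (lie_der (c + 2) b (coc2 a f) + coc2 b (lie_der c a f))
   = coc2 (lie_der (-1) a b) f"
  unfolding lie_der_def coc2_def by (simp add: D_simps) (simp add: algebra_simps)

lemma coc3: "lie_der (c + 3) a (coc3 b f) + coc3 a (lie_der c b f) - (lie_der (c + 3) b (coc3 a f) + coc3 b (lie_der c a f))
   = coc3 (lie_der (-1) a b) f"
  unfolding lie_der_def coc3_def by (simp add: D_simps) (simp add: algebra_simps)

lemma coc4: "lie_der (c + 4) a (coc4 b f) + coc4 a (lie_der c b f) - (lie_der (c + 4) b (coc4 a f) + coc4 b (lie_der c a f))
   = coc4 (lie_der (-1) a b) f"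
  unfolding lie_der_def coc4_def by (simp add: D_simps) (simp add: algebra_simps)

end

interpretation pd: derivation pderiv "[:c:]" for c :: "'k::field"
  by unfold_locales (simp_all add: pderiv_add pderiv_mult algebra_simps pderiv_pCons)

lemma density_lie_der: "density w a f = pd.lie_der [:w:] a f"
  by (simp add: density_def pd.lie_der_def algebra_simps)

lemma density_bracket:
  "density c a (density c b f) - density c b (density c a f) = density c (density (- 1) a b) f"
  using pd.bracket[of c a b f] by (simp add: density_lie_der one_pCons)

definition cocycle :: "nat \<Rightarrow> 'k::field \<Rightarrow> 'k poly \<Rightarrow> 'k poly \<Rightarrow> 'k poly" where
  "cocycle d c = (if d = 2 then pd.coc2 else if d = 3 then pd.coc3 c else pd.coc4 c)"

lemmas coc_defs = pd.coc2_def pd.coc3_def pd.coc4_def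

lemma cocycle_identity:
  assumes "d \<in> {2, 3, 4}"
  shows "density (c + of_nat d) a (cocycle d c b f) + cocycle d c a (density c b f)
    - (density (c + of_nat d) b (cocycle d c a f) + cocycle d c b (density c a f)) = cocycle d c (density (- 1) a b) f"
proof -
  have e: "[:c + of_nat d:] = [:c:] + of_nat d" by (simp add: of_nat_poly)
  have m: "[:- 1 :: 'a:] = - 1" by (simp add: one_pCons)
  show ?thesis
    using assms pd.coc2[of c a b f] pd.coc3[of c a b f] pd.coc4[of c a b f]
    unfolding cocycle_def density_lie_der e m by auto
qed

lemma cocycle_add_v: "cocycle d c a (f + g) = cocycle d c a f + cocycle d c a g"
  by (simp add: cocycle_def coc_defs pderiv_add algebra_simps smult_add_right)

lemma cocycle_add_a: "cocycle d c (a + b) f = cocycle d c a f + cocycle d c b f"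
  by (simp add: cocycle_def coc_defs pderiv_add algebra_simps smult_add_right)

lemma cocycle_const_v: "pderiv K = 0 \<Longrightarrow> cocycle d c a (K * f) = K * cocycle d c a f"
  by (simp add: cocycle_def coc_defs pderiv_mult pderiv_add algebra_simps smult_add_right smult_diff_right)

lemma cocycle_const_a: "pderiv K = 0 \<Longrightarrow> cocycle d c (K * a) f = K * cocycle d c a f"
  by (simp add: cocycle_def coc_defs pderiv_mult pderiv_add algebra_simps smult_add_right smult_diff_right)

lemma smult_as_mult: "Polynomial.smult t f = [:t:] * f" "pderiv [:t:] = 0"
  by (simp_all add: pderiv_pCons)

lemma cocycle_smult: "cocycle d c a (Polynomial.smult t f) = Polynomial.smult t (cocycle d c a f)"
   "cocycle d c (Polynomial.smult t a) f = Polynomial.smult t (cocycle d c a f)"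
  unfolding smult_as_mult(1) by (simp_all only: cocycle_const_v cocycle_const_a smult_as_mult(2))

lemma cocycle_0: "cocycle d c a 0 = 0" "cocycle d c 0 f = 0"
  using cocycle_const_v[of 0 d c a 0] cocycle_const_a[of 0 d c 0 f] by simp_all

lemma XP_pderiv: "pderiv (XP :: 'k::field poly) = 0" by (simp add: pderiv_monom)

text \<open>
  Differentiation annihilates \<open>X\<^sup>p\<close>, so the cocycles descend to \<open>k[X]/(X\<^sup>p)\<close> in both arguments.
\<close>

lemma cocycle_cong:
  fixes a b :: "'k::field poly"
  assumes "XP dvd (a - b)" "XP dvd (u - v)"
  shows "XP dvd (cocycle d c a u - cocycle d c b v)"
proof -
  obtain q r where qr: "a = XP * q + b" "u = XP * r + v"
    using assms by (metis dvd_def diff_eq_eq)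
  show ?thesis unfolding qr cocycle_add_v cocycle_add_a
    by (simp add: cocycle_const_v cocycle_const_a XP_pderiv)
qed

section \<open>Extensions of density modules\<close>

definition ext_act :: "nat \<Rightarrow> 'k::field \<Rightarrow> 'k poly \<Rightarrow> 'k poly \<times> 'k poly \<Rightarrow> 'k poly \<times> 'k poly" where
  "ext_act d c a v = (density c a (fst v), density (c + of_nat d) a (snd v) + cocycle d c a (fst v))"

definition pair_smult :: "'k::field \<Rightarrow> 'k poly \<times> 'k poly \<Rightarrow> 'k poly \<times> 'k poly" where
  "pair_smult t v = (Polynomial.smult t (fst v), Polynomial.smult t (snd v))"

interpretation pair_vs: vector_space "pair_smult :: 'k::field \<Rightarrow> _"
  by unfold_locales (simp_all add: pair_smult_def smult_add_right smult_add_left prod_eq_iff)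

lemma ext_act_add_v: "ext_act d c a (u + v) = ext_act d c a u + ext_act d c a v"
  by (simp add: ext_act_def density_add_v cocycle_add_v prod_eq_iff)

lemma ext_act_smult_v: "ext_act d c a (pair_smult t v) = pair_smult t (ext_act d c a v)"
  by (simp add: ext_act_def pair_smult_def density_smult_v cocycle_smult smult_add_right)

lemma ext_act_add_a: "ext_act d c (a + b) v = ext_act d c a v + ext_act d c b v"
  by (simp add: ext_act_def density_add_a cocycle_add_a prod_eq_iff)

lemma ext_act_smult_a: "ext_act d c (Polynomial.smult t a) v = pair_smult t (ext_act d c a v)"
  by (simp add: ext_act_def pair_smult_def density_smult_a cocycle_smult smult_add_right)

lemma ext_act_bracket:
  assumes "d \<in> {2, 3, 4}"
  shows "ext_act d c a (ext_act d c b v) - ext_act d c b (ext_act d c a v) = ext_act d c (density (- 1) a b) v"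
proof -
  have 2: "density w a (f + g) = density w a f + density w a g" for w a f and g :: "'a poly" by (rule density_add_v)
  show ?thesis
    using density_bracket[of c a b "fst v"] density_bracket[of "c + of_nat d" a b "snd v"]
      cocycle_identity[OF assms, of c a b "fst v"]
    by (simp add: ext_act_def 2 prod_eq_iff algebra_simps)
qed

section \<open>Artin-Schreier elements\<close>

text \<open>
  Taking \<open>p\<close>-th powers replaces \<open>c\<close> by \<open>c + 1\<close>, so \<open>a c + b = 0\<close> would imply \<open>a = 0\<close>.
\<close>

lemma artin_schreier_linear:
  fixes c :: "'k::field"
  assumes p: "CHAR('k) > 0" and c: "c ^ CHAR('k) - c = 1" and a: "(of_int a :: 'k) \<noteq> 0"
  shows "of_int a * c + of_int b \<noteq> 0"
proof
  assume eq: "of_int a * c + of_int b = 0"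
  have pr: "prime CHAR('k)" using p by (rule prime_CHAR_semidom)
  have i: "(of_int z :: 'k) ^ CHAR('k) = of_int z" for z by (rule of_int_pow_CHAR[OF p]) simp
  have "0 = (of_int a * c + of_int b) ^ CHAR('k)" using p by (simp add: eq power_0_left)
  also have "\<dots> = of_int a * (c + 1) + of_int b"
    unfolding freshmans_dream[OF pr refl] power_mult_distrib i using c by (simp add: algebra_simps eq_diff_eq)
  also have "\<dots> = of_int a" using eq by (simp add: algebra_simps)
  finally show False using a by simp
qed

lemma artin_schreier_shift:
  fixes c :: "'k::field"
  assumes p: "CHAR('k) > 0" and c: "c ^ CHAR('k) - c = 1"
  shows "(c + of_nat n) ^ CHAR('k) - (c + of_nat n) = 1"
proof -
  have "(of_nat n :: 'k) ^ CHAR('k) = of_nat n"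
    by (rule of_int_pow_CHAR[OF p]) (metis of_int_of_nat_eq rangeI)
  moreover have "(c + of_nat n) ^ CHAR('k) = c ^ CHAR('k) + of_nat n ^ CHAR('k)"
    by (rule freshmans_dream[OF prime_CHAR_semidom[OF p] refl])
  ultimately show ?thesis using c by (simp add: algebra_simps)
qed

text \<open>
  Taking \<open>p\<close>-th powers replaces a root \<open>c\<close> by the root \<open>c + 1\<close>, so there would be \<open>p\<close> roots.
\<close>

lemma artin_schreier_poly:
  fixes c :: "'k::field"
  assumes p: "CHAR('k) > 0" and c: "c ^ CHAR('k) - c = 1"
    and q: "\<And>i. Polynomial.coeff q i \<in> range of_int" "Polynomial.degree q < CHAR('k)" "q \<noteq> 0"
  shows "poly q c \<noteq> 0"
proof
  assume root: "poly q c = 0"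
  let ?p = "CHAR('k)"
  have pr: "prime ?p" using p by (rule prime_CHAR_semidom)
  have frob: "poly q (x ^ ?p) = (poly q x) ^ ?p" for x
    unfolding poly_altdef freshmans_dream_sum[OF pr refl] power_mult_distrib
    using of_int_pow_CHAR[OF p q(1)] by (simp add: power_mult[symmetric] mult.commute)
  have "c ^ ?p = c + 1" using c by (simp add: algebra_simps eq_diff_eq)
  then have cj: "(c + of_nat j) ^ ?p = c + of_nat (Suc j)" for j
    unfolding freshmans_dream[OF pr refl] using of_int_pow_CHAR[OF p, of "of_nat j"]
    by (metis add.assoc add.commute of_int_of_nat_eq of_nat_Suc rangeI)
  have roots: "poly q (c + of_nat j) = 0" for j
  proof (induction j)
    case (Suc j)
    then show ?case using frob[of "c + of_nat j"] p by (simp only: cj power_0_left) simp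
  qed (use root in simp)
  have inj: "inj_on (\<lambda>j. c + of_nat j) {..<?p}"
    by (rule inj_onI) (use of_nat_inj_CHAR[where ?'k = 'k] in auto)
  have "?p = card ((\<lambda>j. c + of_nat j) ` {..<?p})" by (simp add: card_image[OF inj])
  also have "\<dots> \<le> card {x. poly q x = 0}"
    by (rule card_mono) (use poly_roots_finite[OF q(3)] roots in auto)
  also have "\<dots> \<le> Polynomial.degree q" using q(3) by (rule card_poly_roots_bound)
  finally show False using q(2) by simp
qed

section \<open>The p-character of the extension\<close>

text \<open>
  Let \<open>G\<close> be the difference of the \<open>p\<close>-th power of \<open>a\<close> and the action of \<open>vfield_pow a\<close>.  By the Leibniz
  formula \<open>G\<close> commutes with all vector fields.  On the submodule and on the quotient it is
  multiplication by \<open>K\<close>, which commutes with all vector fields too; the rest of \<open>G\<close> is a homomorphism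
  \<open>\<Theta>\<close> from densities of weight \<open>c\<close> to densities of weight \<open>c + d\<close>.  The constant \<open>1\<close> has weight \<open>c\<close>
  under \<open>X d/dX\<close> and is killed by \<open>d/dX\<close>, which forces \<open>\<Theta> 1 = 0\<close>; and \<open>X\<^sup>2 d/dX\<close> produces all
  monomials from \<open>1\<close>, as \<open>2c\<close> is not in the prime field.
\<close>

lemma ext_act_pow:
  fixes a :: "'k::field poly"
  assumes p5: "CHAR('k) \<ge> 5" and d: "d \<in> {2, 3, 4}" and c: "c ^ CHAR('k) - c = 1"
  defines "K \<equiv> pderiv a ^ CHAR('k)"
  shows "(ext_act d c a ^^ CHAR('k)) v = ext_act d c (vfield_pow a) v + (K * fst v, K * snd v)"
proof -
  let ?p = "CHAR('k)"
  let ?U = "ext_act d c a" and ?b = "vfield_pow a"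
  have p: "?p > 0" using p5 by simp
  have K: "pderiv K = 0" unfolding K_def by (rule pderiv_CHAR_power)
  have cd: "(c + of_nat d) ^ ?p - (c + of_nat d) = 1"
    by (rule artin_schreier_shift[OF p c])
  define G where "G v = (?U ^^ ?p) v - ext_act d c ?b v" for v
  have U_add: "(?U ^^ n) (u + v) = (?U ^^ n) u + (?U ^^ n) v" for n u v
    by (induction n) (simp_all add: ext_act_add_v)
  have U_smult: "(?U ^^ n) (pair_smult t v) = pair_smult t ((?U ^^ n) v)" for n t v
    by (induction n) (simp_all add: ext_act_smult_v)
  have G_add: "G (u + v) = G u + G v" for u v by (simp add: G_def U_add ext_act_add_v)
  have G_smult: "G (pair_smult t v) = pair_smult t (G v)" for t v
    by (simp add: G_def U_smult ext_act_smult_v pair_vs.scale_right_diff_distrib)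
  have m1: "(- 1 :: 'k) ^ ?p = - 1" using of_int_pow_CHAR[OF p, of "- 1"] by (metis of_int_1 of_int_minus rangeI)
  have G_comm: "G (ext_act d c y v) = ext_act d c y (G v)" for y v
  proof -
    have "(?U ^^ ?p) (ext_act d c y v) = ext_act d c ((density (- 1) a ^^ ?p) y) v + ext_act d c y ((?U ^^ ?p) v)"
      by (rule pair_vs.leibniz_CHAR[where B = "ext_act d c", OF p])
        (use ext_act_bracket[OF d, of c a] in \<open>simp_all add: ext_act_add_v ext_act_smult_v diff_eq_eq\<close>)
    moreover have "(density (- 1) a ^^ ?p) y = density (- 1) ?b y" by (simp add: density_funpow_CHAR[OF p] m1)
    ultimately show ?thesis
      using ext_act_bracket[OF d, of c ?b y v] ext_act_add_v[of d c y "(?U ^^ ?p) v - ext_act d c ?b v" "ext_act d c ?b v"]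
      by (simp add: G_def algebra_simps)
  qed
  have U_fst: "fst ((?U ^^ n) v) = (density c a ^^ n) (fst v)" for n v
    by (induction n) (simp_all add: ext_act_def)
  have d0: "density w y 0 = 0" for w and y :: "'k poly" by (simp add: density_def)
  have U_snd: "(?U ^^ n) (0, g) = (0, (density (c + of_nat d) a ^^ n) g)" for n g
    by (induction n) (simp_all add: ext_act_def d0 cocycle_0)
  define \<Theta> where "\<Theta> f = snd (G (f, 0))" for f
  have G_eq: "G (f, g) = (K * f, K * g + \<Theta> f)" for f g
  proof -
    have "G (f, g) = G (f, 0) + G (0, g)" using G_add[of "(f, 0)" "(0, g)"] by simp
    moreover have "fst (G (f, 0)) = K * f"
      by (simp add: G_def U_fst density_funpow_CHAR[OF p] c K_def) (simp add: ext_act_def)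
    moreover have "G (0, g) = (0, K * g)"
      by (simp add: G_def U_snd density_funpow_CHAR[OF p] cd K_def) (simp add: ext_act_def d0 cocycle_0)
    ultimately show ?thesis by (simp add: \<Theta>_def prod_eq_iff)
  qed
  have \<Theta>_add: "\<Theta> (f + g) = \<Theta> f + \<Theta> g" for f g
    using G_add[of "(f, 0)" "(g, 0)"] by (simp add: \<Theta>_def)
  have \<Theta>_smult: "\<Theta> (Polynomial.smult t f) = Polynomial.smult t (\<Theta> f)" for t f
    using G_smult[of t "(f, 0)"] by (simp add: \<Theta>_def pair_smult_def)
  have \<Theta>_0: "\<Theta> 0 = 0" using \<Theta>_smult[of 0 0] by simp
  \<comment> \<open>Central operators intertwine, so \<open>\<Theta>\<close> is a homomorphism between two density modules of different weights.\<close>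
  have \<Theta>_density: "\<Theta> (density c y f) = density (c + of_nat d) y (\<Theta> f)" for y f
  proof -
    have "snd (G (ext_act d c y (f, 0))) = snd (ext_act d c y (G (f, 0)))" by (simp only: G_comm)
    then show ?thesis by (simp add: ext_act_def G_eq cocycle_const_v[OF K] d0 density_add_v)
  qed
  have dk: "(of_nat d :: 'k) \<noteq> 0" using d p5 by (auto simp: of_nat_eq_0_iff_char_dvd dest: dvd_imp_le)
  have two: "(of_int 2 :: 'k) \<noteq> 0"
    using p5 of_nat_eq_0_iff_char_dvd[of 2, where ?'a = 'k] by (auto dest: dvd_imp_le)
  have \<Theta>_monom: "\<Theta> (Polynomial.monom 1 n) = 0" for n
  proof (induction n)
    case 0
    have "pderiv (\<Theta> 1) = 0" using \<Theta>_density[of 1 1] by (simp add: density_def \<Theta>_0)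
    then have "Polynomial.smult c (\<Theta> 1) = Polynomial.smult (c + of_nat d) (\<Theta> 1)"
      using \<Theta>_density[of "[:0, 1:]" 1] \<Theta>_smult[of c 1] by (simp add: density_def pderiv_pCons)
    then show ?case using dk by (simp add: smult_add_left)
  next
    case (Suc n)
    have "density c (Polynomial.monom 1 2) (Polynomial.monom 1 n) = Polynomial.smult (of_nat n + 2 * c) (Polynomial.monom 1 (Suc n))"
      by (cases n) (simp_all add: density_def pderiv_monom mult_monom smult_monom add_monom algebra_simps)
    moreover have "of_nat n + 2 * c \<noteq> 0"
      using artin_schreier_linear[OF p c two, of "int n"] by (simp add: algebra_simps)
    moreover have "\<Theta> (density c (Polynomial.monom 1 2) (Polynomial.monom 1 n)) = 0"
      by (simp only: \<Theta>_density Suc) (simp add: density_def)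
    ultimately show ?case by (simp add: \<Theta>_smult)
  qed
  have \<Theta>_sum: "\<Theta> (sum u S) = (\<Sum>s\<in>S. \<Theta> (u s))" for u :: "nat \<Rightarrow> 'k poly" and S
    by (induction S rule: infinite_finite_induct) (simp_all add: \<Theta>_0 \<Theta>_add)
  have "\<Theta> f = 0" for f
  proof -
    have "f = (\<Sum>i\<le>Polynomial.degree f. Polynomial.smult (Polynomial.coeff f i) (Polynomial.monom 1 i))"
      by (simp add: smult_monom poly_as_sum_of_monoms)
    then have "\<Theta> f = \<Theta> (\<Sum>i\<le>Polynomial.degree f. Polynomial.smult (Polynomial.coeff f i) (Polynomial.monom 1 i))"
      by (rule arg_cong)
    then show ?thesis by (simp only: \<Theta>_sum \<Theta>_smult \<Theta>_monom) simp
  qed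
  then have "G v = (K * fst v, K * snd v)" using G_eq[of "fst v" "snd v"] by simp
  then show ?thesis by (simp add: G_def algebra_simps)
qed

section \<open>Representations of the reduced enveloping algebras\<close>

lemma K_cong:
  fixes x :: "'k::field lie"
  assumes p: "CHAR('k) \<ge> 2"
  shows "XP dvd (pderiv (vfield x) ^ CHAR('k) * f - Polynomial.smult (Poly_Mapping.lookup x 0 ^ CHAR('k)) f)"
proof -
  have "Polynomial.coeff (pderiv (vfield x)) 0 = Poly_Mapping.lookup x 0" using p by (simp add: coeff_pderiv coeff_vfield)
  moreover have "XP dvd ((pderiv (vfield x) ^ CHAR('k) - [:Polynomial.coeff (pderiv (vfield x)) 0 ^ CHAR('k):]) * f)"
    by (rule dvd_mult2[OF frobenius_XP]) (use p in simp)
  ultimately show ?thesis by (simp add: algebra_simps)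
qed

lemma vfield_pow_cong:
  fixes x :: "'k::field lie"
  assumes "CHAR('k) > 0"
  shows "XP dvd (vfield_pow (vfield x) - vfield (witt_pmap x))"
  unfolding vfield_pmap[OF assms] by (rule XP_dvd_mod)

lemma ext_act_cong:
  fixes a b :: "'k::field poly"
  assumes "XP dvd (a - b)" "XP dvd (fst u - fst v)" "XP dvd (snd u - snd v)"
  shows "XP dvd (fst (ext_act d c a u - ext_act d c b v))" "XP dvd (snd (ext_act d c a u - ext_act d c b v))"
proof -
  show "XP dvd (fst (ext_act d c a u - ext_act d c b v))"
    using density_cong[OF assms(1,2)] by (simp add: ext_act_def)
  have "XP dvd (density (c + of_nat d) a (snd u) - density (c + of_nat d) b (snd v)) + (cocycle d c a (fst u) - cocycle d c b (fst v))"
    using assms by (intro dvd_add density_cong cocycle_cong)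
  then show "XP dvd (snd (ext_act d c a u - ext_act d c b v))"
    by (simp add: ext_act_def algebra_simps)
qed

text \<open>
  The case \<open>\<sigma> = id\<close> describes the modules before the twist.
\<close>

locale twisted_character =
  fixes \<chi> :: "'k::field lie \<Rightarrow> 'k" and \<sigma> :: "'k lie \<Rightarrow> 'k lie"
  assumes p5: "CHAR('k) \<ge> 5" and \<sigma>: "\<sigma> \<in> witt_aut" and \<chi>: "x \<in> witt \<Longrightarrow> \<chi> x = chi0 (\<sigma> x)"
begin

lemma p0: "CHAR('k) > 0" and p2: "CHAR('k) \<ge> 2" using p5 by simp_all

lemma \<sigma>_bij: "bij_betw \<sigma> witt witt"
  and \<sigma>_add: "x \<in> witt \<Longrightarrow> y \<in> witt \<Longrightarrow> \<sigma> (x + y) = \<sigma> x + \<sigma> y"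
  and \<sigma>_scale: "x \<in> witt \<Longrightarrow> \<sigma> (scale t x) = scale t (\<sigma> x)"
  and \<sigma>_bracket: "x \<in> witt \<Longrightarrow> y \<in> witt \<Longrightarrow> \<sigma> (witt_bracket x y) = witt_bracket (\<sigma> x) (\<sigma> y)"
  using \<sigma> by (auto simp: witt_aut_def)

lemma \<sigma>_in: "x \<in> witt \<Longrightarrow> \<sigma> x \<in> witt"
  using \<sigma>_bij by (auto simp: bij_betw_def)

lemma \<sigma>_pmap: "x \<in> witt \<Longrightarrow> \<sigma> (witt_pmap x) = witt_pmap (\<sigma> x)"
  by (rule aut_pmap[OF p0 \<sigma>])

sublocale restricted_subalgebra witt \<chi>
  by unfold_locales (auto simp: witt_add witt_scale witt_bracket_in witt_pmap_in)

lemma bracket_cong: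
  assumes "x \<in> witt" "y \<in> witt"
  shows "XP dvd (density (- 1) (vfield (\<sigma> x)) (vfield (\<sigma> y)) - vfield (\<sigma> (witt_bracket x y)))"
  unfolding \<sigma>_bracket[OF assms] vfield_bracket[OF p2 \<sigma>_in[OF assms(1)] \<sigma>_in[OF assms(2)]] by (rule XP_dvd_mod)

lemma density_representation:
  assumes c: "c ^ CHAR('k) - c = 1"
  shows "reduced_representation witt \<chi> Polynomial.smult (\<lambda>x. density c (vfield (\<sigma> x))) {v. XP dvd v}"
proof (unfold_locales, goal_cases)
  case (1 x u v)
  show ?case by (rule density_add_v)
next
  case (2 x t v)
  show ?case by (rule density_smult_v)
next
  case (6 x v)
  then show ?case using density_cong[of "vfield (\<sigma> x)" "vfield (\<sigma> x)" v 0 c] by (simp add: density_def)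
next
  case (7 x y v)
  then show ?case by (simp add: \<sigma>_add vfield_add density_add_a)
next
  case (8 x v t)
  then show ?case by (simp add: \<sigma>_scale vfield_scale density_smult_a)
next
  case (9 x y v)
  then show ?case using density_cong[OF bracket_cong[OF 9], of v v c] by (simp add: density_bracket)
next
  case (10 x v)
  have "XP dvd (density c (vfield_pow (vfield (\<sigma> x))) v - density c (vfield (witt_pmap (\<sigma> x))) v)
    + (pderiv (vfield (\<sigma> x)) ^ CHAR('k) * v - Polynomial.smult (Poly_Mapping.lookup (\<sigma> x) 0 ^ CHAR('k)) v)"
    by (intro dvd_add density_cong vfield_pow_cong[OF p0] K_cong[OF p2]) simp
  then show ?case using 10 by (simp add: density_funpow_CHAR[OF p0] c \<sigma>_pmap \<chi> chi0_def algebra_simps)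
qed (auto intro: dvd_smult)

lemma ext_representation:
  assumes c: "c ^ CHAR('k) - c = 1" and d: "d \<in> {2, 3, 4}"
  shows "reduced_representation witt \<chi> pair_smult (\<lambda>x. ext_act d c (vfield (\<sigma> x))) {v. XP dvd fst v \<and> XP dvd snd v}"
proof (unfold_locales, goal_cases)
  case (1 x u v)
  show ?case by (rule ext_act_add_v)
next
  case (2 x t v)
  show ?case by (rule ext_act_smult_v)
next
  case (6 x v)
  then show ?case using ext_act_cong[of "vfield (\<sigma> x)" "vfield (\<sigma> x)" v 0 d c]
    by (simp add: ext_act_def density_def cocycle_0)
next
  case (7 x y v)
  then show ?case by (simp add: \<sigma>_add vfield_add ext_act_add_a)
next
  case (8 x v t)
  then show ?case by (simp add: \<sigma>_scale vfield_scale ext_act_smult_a)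
next
  case (9 x y v)
  then show ?case using ext_act_cong[OF bracket_cong[OF 9], of v v d c] by (simp add: ext_act_bracket[OF d])
next
  case (10 x v)
  let ?K = "pderiv (vfield (\<sigma> x)) ^ CHAR('k)" and ?l = "Poly_Mapping.lookup (\<sigma> x) 0 ^ CHAR('k)"
  note e = ext_act_cong[OF vfield_pow_cong[OF p0, of "\<sigma> x"], where u = v and v = v and d = d and c = c]
  have "XP dvd fst (ext_act d c (vfield_pow (vfield (\<sigma> x))) v - ext_act d c (vfield (witt_pmap (\<sigma> x))) v)
    + (?K * fst v - Polynomial.smult ?l (fst v))"
    by (intro dvd_add e K_cong[OF p2]) simp_all
  moreover have "XP dvd snd (ext_act d c (vfield_pow (vfield (\<sigma> x))) v - ext_act d c (vfield (witt_pmap (\<sigma> x))) v)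
    + (?K * snd v - Polynomial.smult ?l (snd v))"
    by (intro dvd_add e K_cong[OF p2]) simp_all
  ultimately show ?case
    using 10 by (simp add: ext_act_pow[OF p5 d c] \<sigma>_pmap \<chi> chi0_def pair_smult_def algebra_simps)
qed (auto simp: pair_smult_def intro: dvd_smult)

end

lemma twisted_id: "CHAR('k::field) \<ge> 5 \<Longrightarrow> twisted_character (chi0 :: 'k lie \<Rightarrow> 'k) id"
  by unfold_locales (auto simp: witt_aut_def)

lemma vfield_pow_coeff:
  fixes a :: "'k::field poly"
  assumes "Polynomial.coeff a 0 = 0"
  shows "Polynomial.coeff (vfield_pow a) 0 = 0 \<and> Polynomial.coeff (vfield_pow a) 1 = Polynomial.coeff a 1 ^ CHAR('k)"
proof -
  have "Polynomial.coeff (((\<lambda>f. a * pderiv f) ^^ n) [:0, 1:]) 0 = 0 \<and>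
    Polynomial.coeff (((\<lambda>f. a * pderiv f) ^^ n) [:0, 1:]) 1 = Polynomial.coeff a 1 ^ n" for n
    by (induction n) (use assms in \<open>simp_all add: coeff_mult coeff_pderiv\<close>)
  then show ?thesis by (simp add: vfield_pow_def)
qed

lemma borel_coeff:
  "x \<in> witt_borel \<Longrightarrow> Polynomial.coeff (vfield (x::'k::field lie)) 0 = 0"
  by (simp add: coeff_vfield in_borel_iff)

lemma borel_bracket:
  fixes x y :: "'k::field lie"
  assumes p: "CHAR('k) \<ge> 2" and x: "x \<in> witt_borel" and y: "y \<in> witt_borel"
  shows "witt_bracket x y \<in> witt_borel" "Poly_Mapping.lookup (witt_bracket x y) 0 = 0"
proof -
  have "vfield (witt_bracket x y) = density (- 1) (vfield x) (vfield y) mod XP"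
    using x y by (intro vfield_bracket p) (simp_all add: in_borel_iff)
  then have "Polynomial.coeff (vfield (witt_bracket x y)) n = Polynomial.coeff (density (- 1) (vfield x) (vfield y)) n" if "n < 2" for n
    using that p by (simp add: coeff_mod_monom)
  from this[of 0] this[of 1] have "Polynomial.coeff (vfield (witt_bracket x y)) 0 = 0" "Polynomial.coeff (vfield (witt_bracket x y)) 1 = 0"
    using borel_coeff[OF x] borel_coeff[OF y] by (simp_all add: density_def coeff_mult coeff_pderiv)
  then show "witt_bracket x y \<in> witt_borel" "Poly_Mapping.lookup (witt_bracket x y) 0 = 0"
    using p by (simp_all add: in_borel_iff witt_bracket_in coeff_vfield split: if_splits)
qed

lemma borel_pmap:
  fixes x :: "'k::field lie"
  assumes p: "CHAR('k) \<ge> 2" and x: "x \<in> witt_borel"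
  shows "witt_pmap x \<in> witt_borel" "Poly_Mapping.lookup (witt_pmap x) 0 = Poly_Mapping.lookup x 0 ^ CHAR('k)"
proof -
  have p0: "CHAR('k) > 0" using p by simp
  have "Polynomial.coeff (vfield (witt_pmap x)) n = Polynomial.coeff (vfield_pow (vfield x)) n" if "n < 2" for n
    using that p by (simp add: coeff_mod_monom vfield_pmap[OF p0])
  from this[of 0] this[of 1]
  have "Polynomial.coeff (vfield (witt_pmap x)) 0 = 0" "Polynomial.coeff (vfield (witt_pmap x)) 1 = Polynomial.coeff (vfield x) 1 ^ CHAR('k)"
    using vfield_pow_coeff[OF borel_coeff[OF x]] by simp_all
  then show "witt_pmap x \<in> witt_borel" "Poly_Mapping.lookup (witt_pmap x) 0 = Poly_Mapping.lookup x 0 ^ CHAR('k)"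
    using p by (simp_all add: in_borel_iff witt_pmap_in coeff_vfield split: if_splits)
qed

lemma restricted_borel:
  assumes "CHAR('k::field) \<ge> 2"
  shows "restricted_subalgebra (witt_borel :: 'k lie set)"
proof (rule restricted_subalgebra.intro)
  show "x + y \<in> witt_borel" if "x \<in> witt_borel" "y \<in> witt_borel" for x y :: "'k lie"
    using that by (simp add: in_borel_iff witt_add lookup_add)
  show "scale t x \<in> witt_borel" if "x \<in> witt_borel" for x :: "'k lie" and t
    using that by (simp add: in_borel_iff witt_scale lookup_scale)
qed (simp_all add: borel_bracket borel_pmap assms)

text \<open>
  The one-dimensional module from which \<open>L(\<lambda>)\<close> is induced.
\<close>

lemma borel_representation:
  fixes c :: "'k::field"
  assumes p: "CHAR('k) \<ge> 2" and c: "c ^ CHAR('k) - c = 1"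
  shows "reduced_representation witt_borel chi0 (*) (\<lambda>x v. c * Poly_Mapping.lookup x 0 * v) {0}"
proof -
  have c': "c ^ CHAR('k) = c + 1" using c by (simp add: algebra_simps eq_diff_eq)
  have pow: "((\<lambda>v. c * a * v) ^^ n) v = c ^ n * a ^ n * v" for a v :: 'k and n by (induction n) simp_all
  interpret restricted_subalgebra "witt_borel :: 'k lie set" chi0 by (rule restricted_borel[OF p])
  show ?thesis
  proof (unfold_locales, goal_cases)
    case (14 x v)
    then show ?case by (simp add: pow c' borel_pmap[OF p] chi0_def) (simp add: algebra_simps)
  qed (simp_all add: algebra_simps lookup_add lookup_scale borel_bracket[OF p])
qed

section \<open>Generators of the algebra and the left ideal\<close>

text \<open>
  The part of the structure of \<open>u(g, \<chi>)\<close> that is common to all \<open>\<chi> = \<chi>\<^sub>0 \<circ> \<sigma>\<close>: \<open>E i\<close> is the class of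
  \<open>\<sigma>\<^sup>-\<^sup>1 e\<^sub>i\<close> for \<open>0 \<le> i \<le> p - 2\<close>, and \<open>D\<close> is the class of \<open>\<sigma>\<^sup>-\<^sup>1 e\<^sub>-\<^sub>1\<close>.  With \<open>E i = 0\<close> for larger \<open>i\<close> the
  bracket relations need no case distinction.
\<close>

locale witt_generators = ring A for A (structure) +
  fixes s :: "'k::field \<Rightarrow> 'a" and E :: "nat \<Rightarrow> 'a" and D :: 'a
  assumes p5: "CHAR('k) \<ge> 5"
    and s_closed [simp]: "s c \<in> carrier A" and s_add: "s (x + y) = s x \<oplus> s y"
    and s_mult: "s (x * y) = s x \<otimes> s y" and s_one: "s 1 = \<one>"
    and s_central: "a \<in> carrier A \<Longrightarrow> s c \<otimes> a = a \<otimes> s c"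
    and E_closed [simp]: "E i \<in> carrier A" and D_closed [simp]: "D \<in> carrier A"
    and E_high: "i > CHAR('k) - 2 \<Longrightarrow> E i = \<zero>"
    and E_E: "E i \<otimes> E j = E j \<otimes> E i \<oplus> s (of_nat j - of_nat i) \<otimes> E (i + j)"
    and E_D: "E i \<otimes> D = D \<otimes> E i \<oplus> s (- (of_nat i + 1)) \<otimes> (if i = 0 then D else E (i - 1))"
    and D_pow: "D [^] CHAR('k) = \<zero>" and E_0_pow: "E 0 [^] CHAR('k) = E 0 \<oplus> \<one>"
    and E_1_pow: "E 1 [^] CHAR('k) = \<zero>"
    and generated: "a \<in> carrier A \<Longrightarrow> P \<one> \<Longrightarrow>
      (\<And>a b. a \<in> carrier A \<Longrightarrow> b \<in> carrier A \<Longrightarrow> P a \<Longrightarrow> P b \<Longrightarrow> P (a \<oplus> b)) \<Longrightarrow>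
      (\<And>c a. a \<in> carrier A \<Longrightarrow> P a \<Longrightarrow> P (s c \<otimes> a)) \<Longrightarrow>
      (\<And>i a. a \<in> carrier A \<Longrightarrow> P a \<Longrightarrow> P (E i \<otimes> a)) \<Longrightarrow>
      (\<And>a. a \<in> carrier A \<Longrightarrow> P a \<Longrightarrow> P (D \<otimes> a)) \<Longrightarrow> P a"
begin

lemma p0: "CHAR('k) > 0" using p5 by simp
lemma prime_p: "prime CHAR('k)" using prime_CHAR_semidom[OF p0] .

lemma s_zero: "s 0 = \<zero>"
  using s_add[of 0 0] s_closed[of 0] by simp

inductive_set J :: "'k \<Rightarrow> 'a set" for \<mu> where
  zero: "\<zero> \<in> J \<mu>"
| E_0: "a \<in> J \<mu> \<Longrightarrow> r \<in> carrier A \<Longrightarrow> r \<otimes> (E 0 \<ominus> s \<mu>) \<oplus> a \<in> J \<mu>"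
| E_i: "a \<in> J \<mu> \<Longrightarrow> r \<in> carrier A \<Longrightarrow> i \<ge> 1 \<Longrightarrow> r \<otimes> E i \<oplus> a \<in> J \<mu>"

lemma J_carrier: "a \<in> J \<mu> \<Longrightarrow> a \<in> carrier A"
  by (induction rule: J.induct) auto

lemma J_add: "a \<in> J \<mu> \<Longrightarrow> b \<in> J \<mu> \<Longrightarrow> a \<oplus> b \<in> J \<mu>"
proof (induction rule: J.induct)
  case (E_0 a r)
  then show ?case using J.E_0[of "a \<oplus> b" \<mu> r] J_carrier[of a \<mu>] J_carrier[of b \<mu>] by (simp add: a_assoc)
next
  case (E_i a r i)
  then show ?case using J.E_i[of "a \<oplus> b" \<mu> r i] J_carrier[of a \<mu>] J_carrier[of b \<mu>] by (simp add: a_assoc)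
qed (simp add: J_carrier)

lemma J_mult: "a \<in> J \<mu> \<Longrightarrow> r \<in> carrier A \<Longrightarrow> r \<otimes> a \<in> J \<mu>"
proof (induction rule: J.induct)
  case (E_0 a t)
  then show ?case using J.E_0[of "r \<otimes> a" \<mu> "r \<otimes> t"] J_carrier[of a \<mu>]
    by (simp add: r_distr m_assoc)
next
  case (E_i a t i)
  then show ?case using J.E_i[of "r \<otimes> a" \<mu> "r \<otimes> t" i] J_carrier[of a \<mu>]
    by (simp add: r_distr m_assoc)
qed (simp add: J.zero)

lemma J_E_0: "E 0 \<ominus> s \<mu> \<in> J \<mu>"
  using J.E_0[OF J.zero one_closed] by simp

lemma J_E_i: "i \<ge> 1 \<Longrightarrow> E i \<in> J \<mu>"
  using J.E_i[OF J.zero one_closed] by simp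

section \<open>Spanning modulo the left ideal\<close>

definition ev :: "'k poly \<Rightarrow> 'a" where
  "ev q = fold_coeffs (\<lambda>c r. s c \<oplus> D \<otimes> r) q \<zero>"

lemma ev_0: "ev 0 = \<zero>" by (simp add: ev_def)

lemma ev_pCons: "ev (pCons c q) = s c \<oplus> D \<otimes> ev q"
  by (cases "c = 0 \<and> q = 0") (auto simp: ev_def s_zero)

lemma ev_closed [simp]: "ev q \<in> carrier A"
  by (induction q) (simp_all add: ev_0 ev_pCons)

lemma ev_add: "ev (q + r) = ev q \<oplus> ev r"
  by (induction q r rule: poly_induct2) (simp_all add: ev_0 ev_pCons s_add r_distr a_ac)

lemma ev_smult: "ev (Polynomial.smult c q) = s c \<otimes> ev q"
proof (induction q)
  case (pCons a q)
  have "D \<otimes> (s c \<otimes> ev q) = s c \<otimes> (D \<otimes> ev q)"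
    using s_central[of D c] by (simp add: m_assoc[symmetric])
  with pCons show ?case by (simp add: ev_pCons s_mult r_distr)
qed (simp add: ev_0)

lemma ev_monom_mult: "ev (Polynomial.monom 1 n * q) = D [^] n \<otimes> ev q"
proof (induction n)
  case (Suc n)
  have "ev (Polynomial.monom 1 (Suc n) * q) = D \<otimes> ev (Polynomial.monom 1 n * q)"
    by (simp add: monom_Suc ev_pCons s_zero)
  also have "\<dots> = D [^] Suc n \<otimes> ev q"
    using nat_pow_comm[OF D_closed, of 1 n] by (simp add: Suc m_assoc[symmetric])
  finally show ?case .
qed simp

lemma ev_mod: "ev (q mod XP) = ev q"
proof -
  have "ev q = ev (XP * (q div XP) + q mod XP)" by simp
  also have "\<dots> = ev (q mod XP)" unfolding ev_add ev_monom_mult D_pow by simp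
  finally show ?thesis ..
qed

definition spanned :: "'k \<Rightarrow> 'a \<Rightarrow> bool" where
  "spanned \<mu> a \<longleftrightarrow> (\<exists>q. \<exists>j\<in>J \<mu>. a = ev q \<oplus> j)"

lemma spanned_J: "a \<in> J \<mu> \<Longrightarrow> spanned \<mu> a"
  unfolding spanned_def by (intro exI[of _ 0] bexI[of _ a]) (simp_all add: ev_0 J_carrier)

lemma spanned_ev: "spanned \<mu> (ev q)"
  unfolding spanned_def by (intro exI[of _ q] bexI[of _ \<zero>]) (simp_all add: J.zero)

lemma spanned_add: "spanned \<mu> a \<Longrightarrow> spanned \<mu> b \<Longrightarrow> spanned \<mu> (a \<oplus> b)"
proof -
  assume "spanned \<mu> a" "spanned \<mu> b"
  then obtain q j r k where *: "j \<in> J \<mu>" "a = ev q \<oplus> j" "k \<in> J \<mu>" "b = ev r \<oplus> k" by (auto simp: spanned_def)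
  then have "a \<oplus> b = ev (q + r) \<oplus> (j \<oplus> k)"
    using J_carrier by (simp add: ev_add a_ac)
  then show ?thesis using * J_add unfolding spanned_def by blast
qed

lemma spanned_scalar: "spanned \<mu> a \<Longrightarrow> spanned \<mu> (s c \<otimes> a)"
proof -
  assume "spanned \<mu> a"
  then obtain q j where *: "j \<in> J \<mu>" "a = ev q \<oplus> j" by (auto simp: spanned_def)
  then have "s c \<otimes> a = ev (Polynomial.smult c q) \<oplus> s c \<otimes> j"
    using J_carrier by (simp add: ev_smult r_distr)
  then show ?thesis using * J_mult s_closed unfolding spanned_def by blast
qed

lemma spanned_D: "spanned \<mu> a \<Longrightarrow> spanned \<mu> (D \<otimes> a)"
proof -
  assume "spanned \<mu> a"
  then obtain q j where *: "j \<in> J \<mu>" "a = ev q \<oplus> j" by (auto simp: spanned_def)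
  then have "D \<otimes> a = ev (pCons 0 q) \<oplus> D \<otimes> j"
    using J_carrier by (simp add: ev_pCons s_zero r_distr)
  then show ?thesis using * J_mult D_closed unfolding spanned_def by blast
qed

text \<open>
  Commuting \<open>E i\<close> past one factor \<open>D\<close> leaves \<open>E (i - 1)\<close> in front of a shorter power of \<open>D\<close>.
\<close>

lemma spanned_E_ev: "spanned \<mu> (E i \<otimes> ev q)"
proof (induction q arbitrary: i)
  case 0
  then show ?case by (simp add: ev_0 spanned_J J.zero)
next
  case (pCons c q)
  have "E i \<otimes> s c = s c \<otimes> E i" by (simp add: s_central)
  moreover have "spanned \<mu> (E i)"
  proof (cases "i = 0")
    case True
    have "E 0 = (E 0 \<ominus> s \<mu>) \<oplus> ev [:\<mu>:]"
      by (simp add: ev_pCons ev_0 a_minus_def a_assoc l_neg)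
    then show ?thesis using spanned_add[OF spanned_J[OF J_E_0] spanned_ev] True by metis
  qed (simp add: spanned_J J_E_i)
  ultimately have 1: "spanned \<mu> (E i \<otimes> s c)" by (simp add: spanned_scalar)
  have "E i \<otimes> (D \<otimes> ev q) = D \<otimes> (E i \<otimes> ev q) \<oplus> s (- (of_nat i + 1)) \<otimes> ((if i = 0 then D else E (i - 1)) \<otimes> ev q)"
    by (simp add: m_assoc[symmetric] E_D l_distr)
  moreover have "spanned \<mu> ((if i = 0 then D else E (i - 1)) \<otimes> ev q)"
    using spanned_D[OF spanned_ev] pCons by auto
  ultimately have 2: "spanned \<mu> (E i \<otimes> (D \<otimes> ev q))"
    using pCons by (simp only:) (intro spanned_add spanned_D spanned_scalar)
  show ?case using spanned_add[OF 1 2] by (simp add: ev_pCons r_distr)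
qed

lemma spanned_all: "a \<in> carrier A \<Longrightarrow> spanned \<mu> a"
proof (rule generated[where P = "spanned \<mu>"])
  have "\<one> = ev [:1:]" by (simp add: ev_pCons ev_0 s_one)
  then show "spanned \<mu> \<one>" using spanned_ev by metis
  fix i a assume "spanned \<mu> a"
  then obtain q j where *: "j \<in> J \<mu>" "a = ev q \<oplus> j" by (auto simp: spanned_def)
  then have "E i \<otimes> a = E i \<otimes> ev q \<oplus> E i \<otimes> j" using J_carrier by (simp add: r_distr)
  then show "spanned \<mu> (E i \<otimes> a)"
    using spanned_add[OF spanned_E_ev spanned_J[OF J_mult[OF *(1) E_closed]]] by metis
qed (auto intro: spanned_add spanned_scalar spanned_D)

text \<open>
  The powers \<open>D\<^sup>n\<close> with \<open>n < p\<close> span the algebra modulo the left ideal, because \<open>D\<^sup>p = 0\<close>.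
\<close>

lemma span:
  assumes "a \<in> carrier A"
  obtains q j where "q mod XP = q" "j \<in> J \<mu>" "a = ev q \<oplus> j"
proof -
  obtain q j where "j \<in> J \<mu>" "a = ev q \<oplus> j" using spanned_all[OF assms, of \<mu>] by (auto simp: spanned_def)
  then show ?thesis using that[of "q mod XP" j] by (simp add: ev_mod)
qed

end

section \<open>Density modules over the generators\<close>

lemma coeff_density_monom:
  "Polynomial.coeff (density c (Polynomial.monom 1 (Suc i)) v) n =
    (if i \<le> n then (of_nat (n - i) + c * (of_nat i + 1)) * Polynomial.coeff v (n - i) else 0)"
proof (cases "i < n")
  case True
  then obtain k where k: "n = Suc (i + k)" using less_imp_Suc_add by blast
  show ?thesis by (simp add: k density_def coeff_monom_mult coeff_pderiv pderiv_monom) (simp add: algebra_simps)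
next
  case False
  then show ?thesis by (auto simp: density_def coeff_monom_mult coeff_pderiv pderiv_monom add.commute)
qed

text \<open>
  An action on the polynomials of degree less than \<open>p\<close>, which represent \<open>k[X]/(X\<^sup>p)\<close>.  It is only
  specified on reduced polynomials.
\<close>

locale density_action = witt_generators A s E D
  for A (structure) and s :: "'k::field \<Rightarrow> 'a" and E D +
  fixes c :: 'k and dact :: "'a \<Rightarrow> 'k poly \<Rightarrow> 'k poly"
  assumes c: "c ^ CHAR('k) - c = 1"
    and dact_mod: "a \<in> carrier A \<Longrightarrow> v mod XP = v \<Longrightarrow> dact a v mod XP = dact a v"
    and dact_add: "a \<in> carrier A \<Longrightarrow> b \<in> carrier A \<Longrightarrow> v mod XP = v \<Longrightarrow> dact (a \<oplus> b) v = dact a v + dact b v"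
    and dact_mult: "a \<in> carrier A \<Longrightarrow> b \<in> carrier A \<Longrightarrow> v mod XP = v \<Longrightarrow> dact (a \<otimes> b) v = dact a (dact b v)"
    and dact_v_add: "a \<in> carrier A \<Longrightarrow> u mod XP = u \<Longrightarrow> v mod XP = v \<Longrightarrow> dact a (u + v) = dact a u + dact a v"
    and dact_s: "v mod XP = v \<Longrightarrow> dact (s t) v = Polynomial.smult t v"
    and dact_E: "i \<le> CHAR('k) - 2 \<Longrightarrow> v mod XP = v \<Longrightarrow> dact (E i) v = density c (Polynomial.monom 1 (Suc i)) v mod XP"
    and dact_D: "v mod XP = v \<Longrightarrow> dact D v = pderiv v"
begin

abbreviation Vp where "Vp v \<equiv> v mod XP = (v :: 'k poly)"

lemma Vp_iff: "Vp v \<longleftrightarrow> (\<forall>n\<ge>CHAR('k). Polynomial.coeff v n = 0)"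
  by (auto simp: poly_eq_iff coeff_mod_monom not_less)

lemma Vp_add: "Vp u \<Longrightarrow> Vp v \<Longrightarrow> Vp (u + v)" by (simp add: Vp_iff)
lemma Vp_smult: "Vp v \<Longrightarrow> Vp (Polynomial.smult t v)" by (simp add: Vp_iff)
lemma Vp_diff: "Vp u \<Longrightarrow> Vp v \<Longrightarrow> Vp (u - v)" by (simp add: Vp_iff)
lemma Vp_0: "Vp 0" by simp
lemma Vp_monom: "n < CHAR('k) \<Longrightarrow> Vp (Polynomial.monom t n)" by (simp add: Vp_iff)

lemma dact_0: "a \<in> carrier A \<Longrightarrow> dact a 0 = 0"
  using dact_v_add[of a 0 0] unfolding add_0_right mod_0 by (metis add_cancel_right_right)

lemma dact_zero: "Vp v \<Longrightarrow> dact \<zero> v = 0"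
  using dact_s[of v 0] by (simp add: s_zero)

lemma dact_one: "Vp v \<Longrightarrow> dact \<one> v = v"
  using dact_s[of v 1] by (simp add: s_one)

lemma dact_smult: "a \<in> carrier A \<Longrightarrow> Vp v \<Longrightarrow> dact a (Polynomial.smult t v) = Polynomial.smult t (dact a v)"
  using dact_mult[of a "s t" v] dact_mult[of "s t" a v] by (simp add: s_central dact_s dact_mod)

lemma dact_uminus: "a \<in> carrier A \<Longrightarrow> Vp v \<Longrightarrow> dact (\<ominus> a) v = - dact a v"
  using dact_add[of a "\<ominus> a" v] by (simp add: r_neg dact_zero eq_neg_iff_add_eq_0 add.commute)

lemma dact_diff: "a \<in> carrier A \<Longrightarrow> Vp u \<Longrightarrow> Vp v \<Longrightarrow> dact a (u - v) = dact a u - dact a v"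
  using dact_v_add[of a "u - v" v] by (simp add: Vp_diff)

lemma coeff_dact_E:
  assumes "i \<le> CHAR('k) - 2" "Vp v" "n < CHAR('k)"
  shows "Polynomial.coeff (dact (E i) v) n =
    (if i \<le> n then (of_nat (n - i) + c * (of_nat i + 1)) * Polynomial.coeff v (n - i) else 0)"
  using assms by (simp add: dact_E coeff_mod_monom coeff_density_monom)

lemma dact_E_monom:
  assumes "i \<le> CHAR('k) - 2" "m < CHAR('k)"
  shows "dact (E i) (Polynomial.monom t m) =
    (if m + i < CHAR('k) then Polynomial.monom ((of_nat m + c * (of_nat i + 1)) * t) (m + i) else 0)"
proof (rule poly_eqI)
  fix n
  show "Polynomial.coeff (dact (E i) (Polynomial.monom t m)) n =
    Polynomial.coeff (if m + i < CHAR('k) then Polynomial.monom ((of_nat m + c * (of_nat i + 1)) * t) (m + i) else 0) n"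
  proof (cases "n < CHAR('k)")
    case True
    then show ?thesis using assms by (auto simp: coeff_dact_E Vp_monom)
  next
    case False
    then have "Polynomial.coeff (dact (E i) (Polynomial.monom t m)) n = 0"
      using dact_mod[OF E_closed Vp_monom[OF assms(2)], of i t] by (simp add: Vp_iff)
    then show ?thesis using False by auto
  qed
qed

lemma dact_E0: "Vp v \<Longrightarrow> n < CHAR('k) \<Longrightarrow> Polynomial.coeff (dact (E 0) v) n = (of_nat n + c) * Polynomial.coeff v n"
  by (simp add: coeff_dact_E)

text \<open>
  The highest weight vector: all \<open>E i\<close> with \<open>i \<ge> 1\<close> raise the exponent of \<open>X\<close>.
\<close>

definition top_vec :: "'k poly" where "top_vec = Polynomial.monom 1 (CHAR('k) - 1)"

lemma Vp_top: "Vp top_vec" using p0 by (simp add: top_vec_def Vp_monom)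

lemma dact_J_top: "a \<in> J (c - 1) \<Longrightarrow> dact a top_vec = 0"
proof (induction rule: J.induct)
  case zero
  show ?case by (simp add: dact_zero Vp_top)
next
  case (E_0 a r)
  have "(of_nat (CHAR('k) - 1) :: 'k) = - 1" using p0 by (simp add: of_nat_diff)
  then have "dact (E 0) top_vec = Polynomial.smult (c - 1) top_vec"
    using p0 by (simp add: top_vec_def dact_E_monom smult_monom algebra_simps)
  then have "dact (E 0 \<ominus> s (c - 1)) top_vec = 0"
    by (simp add: a_minus_def dact_add Vp_top dact_uminus dact_s)
  then show ?case using E_0 J_carrier by (simp add: dact_add dact_mult Vp_top dact_0)
next
  case (E_i a r i)
  have "dact (E i) top_vec = 0"
  proof (cases "i \<le> CHAR('k) - 2")
    case True
    then show ?thesis using p0 E_i by (simp add: top_vec_def dact_E_monom)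
  next
    case False
    then show ?thesis by (simp add: E_high dact_zero Vp_top)
  qed
  then show ?case using E_i J_carrier by (simp add: dact_add dact_mult Vp_top dact_0)
qed

text \<open>
  \<open>D\<close> acts as \<open>d/dX\<close>, so the powers of \<open>D\<close> take \<open>X\<^bsup>p-1\<^esup>\<close> to nonzero multiples of distinct monomials.
\<close>

lemma coeff_ev_top:
  "n < CHAR('k) \<Longrightarrow> Polynomial.coeff (dact (ev q) top_vec) (CHAR('k) - 1 - n) = Polynomial.coeff q n * (\<Prod>i<n. of_nat (CHAR('k) - 1 - i))"
proof (induction q arbitrary: n)
  case 0
  then show ?case by (simp add: ev_0 dact_zero Vp_top)
next
  case (pCons a q)
  have eq: "dact (ev (pCons a q)) top_vec = Polynomial.smult a top_vec + pderiv (dact (ev q) top_vec)"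
    by (simp add: ev_pCons dact_add dact_mult Vp_top dact_s dact_D dact_mod)
  show ?case
  proof (cases n)
    case 0
    have "Polynomial.coeff (dact (ev q) top_vec) CHAR('k) = 0"
      using dact_mod[OF ev_closed Vp_top, of q] by (simp add: Vp_iff)
    then show ?thesis using p0 0 unfolding eq by (simp add: coeff_pderiv) (simp add: top_vec_def)
  next
    case (Suc k)
    then have "Suc (CHAR('k) - 1 - n) = CHAR('k) - 1 - k" "CHAR('k) - 1 - n \<noteq> CHAR('k) - 1" "k < CHAR('k)" using pCons.prems by auto
    then show ?thesis using pCons.IH[of k] Suc
      unfolding eq by (simp add: coeff_pderiv mult_ac del: of_nat_Suc) (simp add: top_vec_def)
  qed
qed

lemma nat_nonzero: "0 < n \<Longrightarrow> n < CHAR('k) \<Longrightarrow> (of_nat n :: 'k) \<noteq> 0"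
  by (auto simp: of_nat_eq_0_iff_char_dvd dest: dvd_imp_le)

lemma falling_nonzero:
  assumes "n < CHAR('k)" shows "(\<Prod>i<n. of_nat (CHAR('k) - 1 - i) :: 'k) \<noteq> 0"
proof -
  have "(of_nat (CHAR('k) - 1 - i) :: 'k) \<noteq> 0" if "i < n" for i
    by (rule nat_nonzero) (use that assms in auto)
  then show ?thesis by (metis finite_lessThan lessThan_iff prod_zero_iff)
qed

lemma ev_top_eq_0:
  assumes "Vp q" "dact (ev q) top_vec = 0"
  shows "q = 0"
proof (rule poly_eqI)
  fix n
  show "Polynomial.coeff q n = Polynomial.coeff 0 n"
  proof (cases "n < CHAR('k)")
    case True
    then have "(\<Prod>i<n. of_nat (CHAR('k) - 1 - i) :: 'k) \<noteq> 0" by (rule falling_nonzero)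
    then show ?thesis using coeff_ev_top[OF True, of q] assms(2) by simp
  qed (use assms(1) in \<open>simp add: Vp_iff\<close>)
qed

text \<open>
  Modulo the left ideal an element is a polynomial in \<open>D\<close> of degree less than \<open>p\<close>, and no such
  polynomial annihilates \<open>X\<^bsup>p-1\<^esup>\<close>.
\<close>

theorem annihilator:
  assumes "a \<in> carrier A"
  shows "dact a top_vec = 0 \<longleftrightarrow> a \<in> J (c - 1)"
proof
  assume 0: "dact a top_vec = 0"
  obtain q j where *: "Vp q" "j \<in> J (c - 1)" "a = ev q \<oplus> j" using span[OF assms] .
  then have "dact (ev q) top_vec = 0" using 0 J_carrier by (simp add: dact_add Vp_top dact_J_top)
  then have "q = 0" using ev_top_eq_0 * by blast
  then show "a \<in> J (c - 1)" using * J_carrier by (simp add: ev_0)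
qed (rule dact_J_top)

theorem cyclic:
  assumes "Vp v"
  shows "\<exists>a\<in>carrier A. dact a top_vec = v"
proof -
  define q where "q = (\<Sum>n<CHAR('k). Polynomial.monom (Polynomial.coeff v (CHAR('k) - 1 - n) / (\<Prod>i<n. of_nat (CHAR('k) - 1 - i))) n)"
  have q: "Polynomial.coeff q n = (if n < CHAR('k) then Polynomial.coeff v (CHAR('k) - 1 - n) / (\<Prod>i<n. of_nat (CHAR('k) - 1 - i)) else 0)" for n
    by (simp add: q_def coeff_sum)
  have "dact (ev q) top_vec = v"
  proof (rule poly_eqI)
    fix m
    show "Polynomial.coeff (dact (ev q) top_vec) m = Polynomial.coeff v m"
    proof (cases "m < CHAR('k)")
      case True
      then have n: "CHAR('k) - 1 - m < CHAR('k)" "CHAR('k) - 1 - (CHAR('k) - 1 - m) = m" by auto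
      have "(\<Prod>i<CHAR('k) - 1 - m. of_nat (CHAR('k) - 1 - i) :: 'k) \<noteq> 0"
        by (rule falling_nonzero[OF n(1)])
      then show ?thesis using coeff_ev_top[OF n(1), of q] n q by simp
    next
      case False
      then show ?thesis using assms dact_mod[OF ev_closed Vp_top, of q] by (simp add: Vp_iff)
    qed
  qed
  then show ?thesis by auto
qed

end

section \<open>Homomorphisms from the left ideal to a density module\<close>

context density_action
begin

definition J_hom :: "'k \<Rightarrow> ('a \<Rightarrow> 'k poly) \<Rightarrow> bool" where
  "J_hom \<mu> g \<longleftrightarrow> (\<forall>a\<in>J \<mu>. Vp (g a)) \<and> (\<forall>a\<in>J \<mu>. \<forall>b\<in>J \<mu>. g (a \<oplus> b) = g a + g b)
     \<and> (\<forall>r\<in>carrier A. \<forall>a\<in>J \<mu>. g (r \<otimes> a) = dact r (g a))"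

lemma J_homD:
  assumes "J_hom \<mu> g"
  shows "a \<in> J \<mu> \<Longrightarrow> Vp (g a)" "a \<in> J \<mu> \<Longrightarrow> b \<in> J \<mu> \<Longrightarrow> g (a \<oplus> b) = g a + g b"
    "r \<in> carrier A \<Longrightarrow> a \<in> J \<mu> \<Longrightarrow> g (r \<otimes> a) = dact r (g a)"
  using assms by (auto simp: J_hom_def)

lemma J_hom_diff:
  assumes "J_hom \<mu> g" "J_hom \<mu> h"
  shows "J_hom \<mu> (\<lambda>a. g a - h a)"
  using J_homD[OF assms(1)] J_homD[OF assms(2)] by (simp add: J_hom_def Vp_diff dact_diff)

lemma J_hom_smult:
  assumes "J_hom \<mu> g" shows "J_hom \<mu> (\<lambda>a. Polynomial.smult t (g a))"
  using J_homD[OF assms] by (simp add: J_hom_def Vp_smult dact_smult smult_add_right)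

lemma J_hom_principal:
  assumes "Vp y" shows "J_hom \<mu> (\<lambda>a. dact a y)"
  using assms by (simp add: J_hom_def J_carrier dact_mod dact_add dact_mult)

lemma J_hom_zero:
  assumes "J_hom \<mu> g" shows "g \<zero> = 0"
  by (rule add_cancel_right_right[THEN iffD1])
    (use J_homD(2)[OF assms J.zero J.zero] in \<open>simp only: l_zero zero_closed\<close>)

lemma J_hom_eq_0:
  assumes g: "J_hom \<mu> g" and 0: "g (E 0 \<ominus> s \<mu>) = 0" and i: "\<And>i. i \<ge> 1 \<Longrightarrow> g (E i) = 0"
    and a: "a \<in> J \<mu>"
  shows "g a = 0"
  using a
proof (induction rule: J.induct)
  case zero
  show ?case by (rule J_hom_zero[OF g])
next
  case (E_0 a r)
  then show ?case using J_mult[OF J_E_0] by (simp add: J_homD[OF g] J_E_0 0 dact_0)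
next
  case (E_i a r j)
  then show ?case using J_mult[OF J_E_i] by (simp add: J_homD[OF g] J_E_i i dact_0)
qed

lemma J_hom_E_E:
  assumes g: "J_hom \<mu> g" and ij: "i \<ge> 1" "j \<ge> 1"
  shows "dact (E i) (g (E j)) = dact (E j) (g (E i)) + Polynomial.smult (of_nat j - of_nat i) (g (E (i + j)))"
proof -
  have "dact (E i) (g (E j)) = g (E j \<otimes> E i \<oplus> s (of_nat j - of_nat i) \<otimes> E (i + j))"
    using J_homD(3)[OF g E_closed J_E_i[OF ij(2)], of i] by (simp add: E_E[of i j])
  also have "\<dots> = dact (E j) (g (E i)) + dact (s (of_nat j - of_nat i)) (g (E (i + j)))"
    using ij by (simp add: J_homD[OF g] J_mult J_E_i)
  finally show ?thesis using J_homD(1)[OF g J_E_i, of "i + j"] ij by (simp add: dact_s)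
qed

lemma J_hom_E_0:
  assumes g: "J_hom \<mu> g" and i: "i \<ge> 1"
  shows "dact (E 0) (g (E i)) = dact (E i) (g (E 0 \<ominus> s \<mu>)) + Polynomial.smult (\<mu> + of_nat i) (g (E i))"
proof -
  have "(E 0 \<ominus> s \<mu>) \<oplus> s \<mu> = E 0" by (simp add: a_minus_def a_assoc l_neg)
  then have "E i \<otimes> E 0 = E i \<otimes> ((E 0 \<ominus> s \<mu>) \<oplus> s \<mu>)" by simp
  also have "\<dots> = E i \<otimes> (E 0 \<ominus> s \<mu>) \<oplus> s \<mu> \<otimes> E i"
    by (simp add: r_distr s_central)
  finally have eq: "E 0 \<otimes> E i = E i \<otimes> (E 0 \<ominus> s \<mu>) \<oplus> s (\<mu> + of_nat i) \<otimes> E i"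
    using E_E[of 0 i] by (simp add: s_add l_distr a_assoc)
  have "dact (E 0) (g (E i)) = g (E i \<otimes> (E 0 \<ominus> s \<mu>) \<oplus> s (\<mu> + of_nat i) \<otimes> E i)"
    using J_homD(3)[OF g E_closed J_E_i[OF i], of 0] eq by simp
  also have "\<dots> = dact (E i) (g (E 0 \<ominus> s \<mu>)) + dact (s (\<mu> + of_nat i)) (g (E i))"
    using i by (simp add: J_homD[OF g] J_mult J_E_i J_E_0)
  finally show ?thesis using J_homD(1)[OF g J_E_i] i by (simp add: dact_s)
qed

lemma of_nat_dvd: "(of_nat n :: 'k) = 0 \<longleftrightarrow> CHAR('k) dvd n"
  by (rule of_nat_eq_0_iff_char_dvd)

lemma dvd_small: "CHAR('k) dvd n \<Longrightarrow> n < 2 * CHAR('k) \<Longrightarrow> n = 0 \<or> n = CHAR('k)"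
proof -
  assume "CHAR('k) dvd n" "n < 2 * CHAR('k)"
  then obtain q where q: "n = CHAR('k) * q" "CHAR('k) * q < CHAR('k) * 2" by (auto elim!: dvdE simp: mult.commute)
  then have "q < 2" using mult_less_cancel1 by blast
  then show ?thesis using q by (auto simp: less_2_cases_iff)
qed

lemma two_c: "of_nat n + c * 2 \<noteq> 0"
proof -
  have "(of_int 2 :: 'k) \<noteq> 0" using nat_nonzero[of 2] p5 by simp
  then show ?thesis using artin_schreier_linear[OF p0 c, of 2 "int n"] by (simp add: algebra_simps)
qed

context
  fixes \<mu> :: 'k and d :: nat
  assumes c_eq: "c = \<mu> + of_nat d + 1" and d: "d < CHAR('k)"
begin

lemma \<mu>_pow: "\<mu> ^ CHAR('k) = \<mu> + 1"
proof -
  have "of_nat (Suc d) ^ CHAR('k) = (of_nat (Suc d) :: 'k)"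
    using of_int_pow_CHAR[OF p0, of "of_nat (Suc d)"] by (metis of_int_of_nat_eq rangeI)
  moreover have "c = \<mu> + of_nat (Suc d)" by (simp add: c_eq)
  ultimately have "c ^ CHAR('k) = \<mu> ^ CHAR('k) + of_nat (Suc d)"
    using freshmans_dream[OF prime_p refl, of \<mu> "of_nat (Suc d)"] by simp
  then show ?thesis using c by (simp add: c_eq algebra_simps)
qed

lemma \<mu>_nonzero: "\<mu> \<noteq> 0"
  using \<mu>_pow p0 by (auto simp: power_0_left)

lemma top_weight: "of_nat (CHAR('k) - 1 - d) + c = \<mu>"
proof -
  have "(of_nat (CHAR('k) - 1 - d) :: 'k) + of_nat (Suc d) = of_nat CHAR('k)"
    unfolding of_nat_add[symmetric] using d by simp
  then show ?thesis by (simp add: c_eq algebra_simps)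
qed

lemma weight_eq: "of_nat n + c = \<mu> + of_nat (n + d + 1)"
  by (simp add: c_eq)

text \<open>
  This is the separability of \<open>T\<^sup>p - T - 1\<close>.  The coefficient \<open>\<zeta>\<close> at the weight \<open>\<mu>\<close> satisfies
  \<open>\<mu> h(E\<^sub>0\<^sup>n - \<mu>\<^sup>n) = n \<mu>\<^sup>n \<zeta>\<close> in this weight; for \<open>n = p\<close> the left-hand side is \<open>\<mu> \<zeta>\<close>, because
  \<open>E\<^sub>0\<^sup>p - \<mu>\<^sup>p = E\<^sub>0 - \<mu>\<close>, and the right-hand side is zero.
\<close>

lemma coeff_E0_zero:
  assumes g: "J_hom \<mu> g"
  shows "Polynomial.coeff (g (E 0 \<ominus> s \<mu>)) (CHAR('k) - 1 - d) = 0"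
proof -
  let ?m = "CHAR('k) - 1 - d"
  let ?\<zeta> = "Polynomial.coeff (g (E 0 \<ominus> s \<mu>)) ?m"
  have m: "?m < CHAR('k)" using p0 by simp
  \<comment> \<open>Here \<open>j = E\<^sub>0\<^sup>n - \<mu>\<^sup>n\<close>; the factor \<open>\<mu>\<close> avoids the exponent \<open>n - 1\<close>.\<close>
  have "\<exists>j\<in>J \<mu>. E 0 [^] n = s (\<mu> ^ n) \<oplus> j \<and> \<mu> * Polynomial.coeff (g j) ?m = of_nat n * \<mu> ^ n * ?\<zeta>" for n
  proof (induction n)
    case 0
    then show ?case by (intro bexI[of _ \<zero>]) (simp_all add: s_one J_hom_zero[OF g] J.zero)
  next
    case (Suc n)
    then obtain j where j: "j \<in> J \<mu>" "E 0 [^] n = s (\<mu> ^ n) \<oplus> j" "\<mu> * Polynomial.coeff (g j) ?m = of_nat n * \<mu> ^ n * ?\<zeta>" by blast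
    have jc: "j \<in> carrier A" by (rule J_carrier[OF j(1)])
    let ?k = "s (\<mu> ^ n) \<otimes> (E 0 \<ominus> s \<mu>) \<oplus> E 0 \<otimes> j"
    have k: "?k \<in> J \<mu>" using j by (intro J_add J_mult J_E_0) simp_all
    have "E 0 [^] Suc n = E 0 \<otimes> E 0 [^] n" by (rule nat_pow_Suc2) simp
    also have "\<dots> = s (\<mu> ^ n) \<otimes> E 0 \<oplus> E 0 \<otimes> j"
      using jc by (simp add: j r_distr s_central)
    also have "s (\<mu> ^ n) \<otimes> E 0 = s (\<mu> ^ n) \<otimes> (s \<mu> \<oplus> (E 0 \<ominus> s \<mu>))"
      by (simp add: a_minus_def a_lcomm r_neg)
    also have "\<dots> = s (\<mu> ^ Suc n) \<oplus> s (\<mu> ^ n) \<otimes> (E 0 \<ominus> s \<mu>)"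
      by (simp only: r_distr s_closed minus_closed E_closed) (simp add: s_mult[symmetric] mult.commute)
    finally have 1: "E 0 [^] Suc n = s (\<mu> ^ Suc n) \<oplus> ?k" using jc by (simp add: a_assoc)
    have "g ?k = Polynomial.smult (\<mu> ^ n) (g (E 0 \<ominus> s \<mu>)) + dact (E 0) (g j)"
      using j J_homD(1)[OF g J_E_0] by (simp add: J_homD[OF g] J_mult J_E_0 dact_s)
    then have ck: "Polynomial.coeff (g ?k) ?m = \<mu> ^ n * ?\<zeta> + \<mu> * Polynomial.coeff (g j) ?m"
      using dact_E0[OF J_homD(1)[OF g j(1)] m] top_weight by simp
    have "\<mu> * Polynomial.coeff (g ?k) ?m = \<mu> * (\<mu> ^ n * ?\<zeta>) + \<mu> * (\<mu> * Polynomial.coeff (g j) ?m)"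
      unfolding ck by (rule distrib_left)
    also have "\<dots> = of_nat (Suc n) * \<mu> ^ Suc n * ?\<zeta>" unfolding j(3) by (simp add: algebra_simps)
    finally have "\<mu> * Polynomial.coeff (g ?k) ?m = of_nat (Suc n) * \<mu> ^ Suc n * ?\<zeta>" .
    with 1 k show ?case by blast
  qed
  from this[of "CHAR('k)"] obtain j where j: "j \<in> J \<mu>" "E 0 \<oplus> \<one> = s (\<mu> + 1) \<oplus> j" "\<mu> * Polynomial.coeff (g j) ?m = 0"
    by (auto simp: E_0_pow \<mu>_pow)
  have jc: "j \<in> carrier A" by (rule J_carrier[OF j(1)])
  have "E 0 \<oplus> \<one> = (s \<mu> \<oplus> j) \<oplus> \<one>" using j(2) jc by (simp add: s_add s_one a_ac)
  then have "E 0 = s \<mu> \<oplus> j" using jc by (simp add: add.right_cancel)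
  then have "E 0 \<ominus> s \<mu> = j" using jc by (simp add: a_minus_def a_ac r_neg r_neg1 r_neg2)
  then show ?thesis using j(3) \<mu>_nonzero by simp
qed

lemma E0_dact:
  assumes "Vp y" "n < CHAR('k)"
  shows "Polynomial.coeff (dact (E 0 \<ominus> s \<mu>) y) n = of_nat (n + d + 1) * Polynomial.coeff y n"
proof -
  have "dact (E 0 \<ominus> s \<mu>) y = dact (E 0) y - Polynomial.smult \<mu> y"
    using assms by (simp add: a_minus_def dact_add dact_uminus dact_s)
  then have "Polynomial.coeff (dact (E 0 \<ominus> s \<mu>) y) n = (of_nat n + c) * Polynomial.coeff y n - \<mu> * Polynomial.coeff y n"
    using dact_E0[OF assms] by simp
  then show ?thesis unfolding weight_eq by (simp add: algebra_simps)
qed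

text \<open>
  \<open>E 0 - \<mu>\<close> acts diagonally, and the only obstruction is the coefficient of weight \<open>\<mu>\<close>.
\<close>

lemma normalise_E0:
  assumes g: "J_hom \<mu> g"
  obtains y where "Vp y" "g (E 0 \<ominus> s \<mu>) = dact (E 0 \<ominus> s \<mu>) y"
proof -
  let ?y0 = "g (E 0 \<ominus> s \<mu>)"
  have V: "Vp ?y0" by (rule J_homD(1)[OF g J_E_0])
  define y where "y = (\<Sum>n<CHAR('k). Polynomial.monom (Polynomial.coeff ?y0 n / of_nat (n + d + 1)) n)"
  have cy: "Polynomial.coeff y n = (if n < CHAR('k) then Polynomial.coeff ?y0 n / of_nat (n + d + 1) else 0)" for n
    by (simp add: y_def coeff_sum)
  have Vy: "Vp y" by (simp add: Vp_iff cy)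
  have "?y0 = dact (E 0 \<ominus> s \<mu>) y"
  proof (rule poly_eqI)
    fix n
    show "Polynomial.coeff ?y0 n = Polynomial.coeff (dact (E 0 \<ominus> s \<mu>) y) n"
    proof (cases "n < CHAR('k)")
      case True
      show ?thesis
      proof (cases "(of_nat (n + d + 1) :: 'k) = 0")
        case z: True
        have "n + d + 1 < 2 * CHAR('k)" using True d by simp
        then have "n + d + 1 = CHAR('k)"
          using dvd_small[OF z[unfolded of_nat_dvd]] by simp
        then have "n = CHAR('k) - 1 - d" by simp
        then have "Polynomial.coeff ?y0 n = 0" using coeff_E0_zero[OF g] by simp
        then show ?thesis unfolding E0_dact[OF Vy True] z by simp
      next
        case False
        then show ?thesis unfolding E0_dact[OF Vy True] cy using True by simp
      qed
    next
      case False
      have "Vp (dact (E 0 \<ominus> s \<mu>) y)" by (rule dact_mod) (use Vy in simp_all)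
      then show ?thesis using False V by (simp only: Vp_iff not_less)
    qed
  qed
  then show ?thesis using that Vy by blast
qed

text \<open>
  The value at \<open>E i\<close> has weight \<open>\<mu> + i\<close>; this determines the exponent modulo \<open>p\<close>.
\<close>

lemma weight:
  assumes g: "J_hom \<mu> g" and 0: "g (E 0 \<ominus> s \<mu>) = 0" and i: "i \<ge> 1"
    and n: "n < CHAR('k)" "Polynomial.coeff (g (E i)) n \<noteq> 0"
  shows "(of_nat (n + d + 1) :: 'k) = of_nat i"
proof -
  have "dact (E 0) (g (E i)) = Polynomial.smult (\<mu> + of_nat i) (g (E i))"
    using J_hom_E_0[OF g i] by (simp add: 0 dact_0)
  then have "(of_nat n + c) * Polynomial.coeff (g (E i)) n = (\<mu> + of_nat i) * Polynomial.coeff (g (E i)) n"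
    using dact_E0[OF J_homD(1)[OF g J_E_i[OF i]] n(1)] by (metis coeff_smult)
  then have "of_nat n + c = \<mu> + of_nat i" using n(2) mult_right_cancel by blast
  then show ?thesis by (simp only: weight_eq add_left_cancel)
qed

lemma E_1_monom:
  assumes g: "J_hom \<mu> g" and 0: "g (E 0 \<ominus> s \<mu>) = 0"
  shows "\<exists>t. g (E 1) = Polynomial.monom t (if d = 0 then 0 else CHAR('k) - d)"
proof -
  let ?e = "if d = 0 then 0 else CHAR('k) - d"
  have "Polynomial.coeff (g (E 1)) n = 0" if "n \<noteq> ?e" for n
  proof (cases "n < CHAR('k)")
    case True
    show ?thesis
    proof (rule ccontr)
      assume "Polynomial.coeff (g (E 1)) n \<noteq> 0"
      from weight[OF g 0 _ True this] have "(of_nat (n + d) :: 'k) = 0" by simp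
      then have "n + d = 0 \<or> n + d = CHAR('k)" unfolding of_nat_dvd using True d by (intro dvd_small) auto
      then show False using that True d by (auto split: if_splits)
    qed
  next
    case False
    then show ?thesis using J_homD(1)[OF g J_E_i[of 1]] by (simp add: Vp_iff)
  qed
  then have "g (E 1) = Polynomial.monom (Polynomial.coeff (g (E 1)) ?e) ?e" by (intro poly_eqI) auto
  then show ?thesis by blast
qed

text \<open>
  The exponent congruent to \<open>1 - d\<close> modulo \<open>p\<close>, which is the one of weight \<open>\<mu> + 2\<close>.
\<close>

definition e2 :: nat where "e2 = (if d = 0 then 1 else if d = 1 then 0 else CHAR('k) + 1 - d)"

lemma E_2_monom:
  assumes g: "J_hom \<mu> g" and 0: "g (E 0 \<ominus> s \<mu>) = 0"
  shows "\<exists>t. g (E 2) = Polynomial.monom t e2"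
proof -
  have "Polynomial.coeff (g (E 2)) n = 0" if "n \<noteq> e2" for n
  proof (cases "n < CHAR('k)")
    case True
    show ?thesis
    proof (rule ccontr)
      assume "Polynomial.coeff (g (E 2)) n \<noteq> 0"
      from weight[OF g 0 _ True this] have *: "(of_nat (n + d + 1) :: 'k) = of_nat 2" by simp
      have nd: "n + d \<noteq> 0"
      proof
        assume "n + d = 0"
        then have "(of_nat 1 :: 'k) = of_nat 2" using * by simp
        then show False using of_nat_inj_CHAR[where ?'k = 'k, of 1 2] p5 by simp
      qed
      have "(of_nat (n + d + 1) :: 'k) = of_nat (n + d - 1) + of_nat 2"
        unfolding of_nat_add[symmetric] using nd by (intro arg_cong[where f = of_nat]) simp
      then have "(of_nat (n + d - 1) :: 'k) = 0" using * by (metis add_cancel_left_left)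
      then have "n + d - 1 = 0 \<or> n + d - 1 = CHAR('k)" unfolding of_nat_dvd using True d by (intro dvd_small) auto
      then show False using nd that True d by (auto simp: e2_def split: if_splits)
    qed
  next
    case False
    then show ?thesis using J_homD(1)[OF g J_E_i[of 2]] by (simp add: Vp_iff)
  qed
  then have "g (E 2) = Polynomial.monom (Polynomial.coeff (g (E 2)) e2) e2" by (intro poly_eqI) auto
  then show ?thesis by blast
qed

text \<open>
  If \<open>d \<noteq> 0\<close>, the vector of weight \<open>\<mu>\<close> is not the top one and \<open>E 1\<close> maps it onto the line of weight
  \<open>\<mu> + 1\<close>.  If \<open>d = 0\<close>, that line is spanned by \<open>1\<close>, and \<open>E\<^sub>1\<^bsup>p-1\<^esup>\<close> is injective on it although
  \<open>E\<^sub>1\<^sup>p = 0\<close>.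
\<close>

lemma normalise_E1:
  assumes g: "J_hom \<mu> g" and 0: "g (E 0 \<ominus> s \<mu>) = 0"
  obtains y where "Vp y" "dact (E 0 \<ominus> s \<mu>) y = 0" "g (E 1) = dact (E 1) y"
proof -
  obtain t where t: "g (E 1) = Polynomial.monom t (if d = 0 then 0 else CHAR('k) - d)"
    using E_1_monom[OF g 0] by blast
  show ?thesis
  proof (cases "d = 0")
    case True
    have pow: "dact (E 1 [^] n) (Polynomial.monom t 0) = Polynomial.monom ((\<Prod>i<n. of_nat i + c * 2) * t) n" if "n < CHAR('k)" for n
      using that
    proof (induction n)
      case 0
      then show ?case by (simp add: dact_one Vp_monom)
    next
      case (Suc n)
      have "dact (E 1 [^] Suc n) (Polynomial.monom t 0) = dact (E 1) (dact (E 1 [^] n) (Polynomial.monom t 0))"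
        unfolding nat_pow_Suc2[OF E_closed] using p0 by (intro dact_mult) (simp_all add: Vp_monom)
      also have "\<dots> = dact (E 1) (Polynomial.monom ((\<Prod>i<n. of_nat i + c * 2) * t) n)" using Suc by simp
      also have "\<dots> = Polynomial.monom ((\<Prod>i<Suc n. of_nat i + c * 2) * t) (Suc n)"
        using Suc.prems p5 by (subst dact_E_monom) (simp_all add: mult_ac)
      finally show ?case .
    qed
    have "dact (E 1 [^] (CHAR('k) - 1)) (g (E 1)) = g (E 1 [^] (CHAR('k) - 1) \<otimes> E 1)"
      by (simp add: J_homD[OF g] J_E_i)
    also have "E 1 [^] (CHAR('k) - 1) \<otimes> E 1 = E 1 [^] CHAR('k)"
      using p0 by (metis Suc_diff_1 nat_pow_Suc)
    finally have "Polynomial.monom ((\<Prod>i<CHAR('k) - 1. of_nat i + c * 2) * t) (CHAR('k) - 1) = 0"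
      using pow[of "CHAR('k) - 1"] p0 t True by (simp add: E_1_pow[simplified] J_hom_zero[OF g])
    then have "t = 0" using two_c by (simp add: monom_eq_0_iff)
    then show ?thesis using that[of 0] t by (simp add: dact_0)
  next
    case False
    let ?m = "CHAR('k) - 1 - d"
    let ?y = "Polynomial.monom (t / (of_nat ?m + c * 2)) ?m"
    have m: "?m < CHAR('k)" using p0 by simp
    have V: "Vp ?y" by (rule Vp_monom[OF m])
    have "dact (E 0 \<ominus> s \<mu>) ?y = 0"
    proof (rule poly_eqI)
      fix n
      show "Polynomial.coeff (dact (E 0 \<ominus> s \<mu>) ?y) n = Polynomial.coeff 0 n"
      proof (cases "n < CHAR('k)")
        case True
        have "?m + d + 1 = CHAR('k)" using d by simp
        then have "(of_nat (n + d + 1) :: 'k) = 0" if "n = ?m" using that by (simp only: of_nat_CHAR)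
        moreover have "Polynomial.coeff ?y n = 0" if "n \<noteq> ?m" unfolding coeff_monom using that by simp
        ultimately show ?thesis unfolding E0_dact[OF V True] by (metis coeff_0 mult_zero_left mult_zero_right)
      next
        case False
        have "Vp (dact (E 0 \<ominus> s \<mu>) ?y)" by (rule dact_mod) (use V in simp_all)
        then show ?thesis using False by (simp only: Vp_iff not_less coeff_0)
      qed
    qed
    moreover have "dact (E 1) ?y = Polynomial.monom t (CHAR('k) - d)"
    proof -
      have "?m + 1 = CHAR('k) - d" "?m + 1 < CHAR('k)" using d False by auto
      then show ?thesis using p5 two_c[of ?m] m by (subst dact_E_monom) (simp_all del: of_nat_diff of_nat_add)
    qed
    ultimately show ?thesis using that[OF V] t False by simp
  qed
qed

lemma normalise:
  assumes g: "J_hom \<mu> g"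
  obtains y where "Vp y" "g (E 0 \<ominus> s \<mu>) = dact (E 0 \<ominus> s \<mu>) y" "g (E 1) = dact (E 1) y"
proof -
  obtain y where y: "Vp y" "g (E 0 \<ominus> s \<mu>) = dact (E 0 \<ominus> s \<mu>) y" using normalise_E0[OF g] .
  let ?h = "\<lambda>a. g a - dact a y"
  have "J_hom \<mu> ?h" by (rule J_hom_diff[OF g J_hom_principal[OF y(1)]])
  from normalise_E1[OF this] obtain z where "Vp z" "dact (E 0 \<ominus> s \<mu>) z = 0" "?h (E 1) = dact (E 1) z"
    using y by auto
  then show ?thesis using that[of "y + z"] y by (simp add: Vp_add dact_v_add algebra_simps)
qed

lemma J_hom_E_1:
  assumes g: "J_hom \<mu> g" and 1: "g (E 1) = 0" and i: "i \<ge> 1" "j = i + 1"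
  shows "dact (E 1) (g (E i)) = Polynomial.smult (of_nat i - 1) (g (E j))"
  using J_hom_E_E[OF g, of 1 i] i by (simp add: 1[simplified] dact_0)

text \<open>
  \<open>E 1\<close> and \<open>E 2\<close> generate all \<open>E i\<close> with \<open>i \<ge> 1\<close>, as \<open>[e\<^sub>1, e\<^sub>i] = (i - 1) e\<^bsub>i+1\<^esub>\<close>.
\<close>

lemma J_hom_determined:
  assumes g: "J_hom \<mu> g" and 0: "g (E 0 \<ominus> s \<mu>) = 0" and 1: "g (E 1) = 0" and 2: "g (E 2) = 0"
    and a: "a \<in> J \<mu>"
  shows "g a = 0"
proof (rule J_hom_eq_0[OF g 0 _ a])
  have "g (E (i + 2)) = 0" for i
  proof (induction i)
    case (Suc i)
    have "Polynomial.smult (of_nat (Suc i)) (g (E (Suc i + 2))) = 0"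
      using J_hom_E_1[OF g 1, of "i + 2" "Suc i + 2"] Suc by (simp add: dact_0)
    moreover have "(of_nat (Suc i) :: 'k) \<noteq> 0 \<or> Suc i + 2 > CHAR('k) - 2"
      using nat_nonzero[of "Suc i"] by linarith
    ultimately show ?case using E_high[of "Suc i + 2"] J_hom_zero[OF g] by (auto simp del: of_nat_Suc)
  qed (use 2 in \<open>simp add: numeral_2_eq_2\<close>)
  then show "g (E i) = 0" if "i \<ge> 1" for i
    using that 1 by (metis One_nat_def add_2_eq_Suc' le_antisym not_less_eq_eq numeral_2_eq_2 Suc_le_D add.commute le_Suc_ex)
qed

text \<open>
  The leading coefficient in \<open>c\<close> is \<open>8\<close>, and \<open>c\<close> has degree \<open>p > 3\<close> over the prime field.
\<close>

lemma cubic_nonzero: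
  assumes "CHAR('k) \<ge> 7"
  shows "(of_nat n + 2 * c) * (of_nat n + 1 + 2 * c) * (of_nat n + 2 + 2 * c)
    - 6 * ((of_nat n + 2 * c) * (of_nat n + 1 + 3 * c) - (of_nat n + 4 * c)) \<noteq> 0"
proof -
  define m where "m = int n"
  \<comment> \<open>The expansion of the left-hand side in powers of \<open>c\<close>.\<close>
  let ?q = "[:of_int (m ^ 3 - 3 * m ^ 2 + 2 * m), of_int (6 * m ^ 2 - 18 * m + 16), of_int (12 * m - 24), of_int 8 :: 'k:]"
  have "(of_nat 2 :: 'k) \<noteq> 0" by (rule nat_nonzero) (use assms in auto)
  then have "(2 :: 'k) ^ 3 \<noteq> 0" by (intro power_not_zero) simp
  moreover have "(2 :: 'k) ^ 3 = of_int 8" by simp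
  ultimately have 8: "(of_int 8 :: 'k) \<noteq> 0" by metis
  have "poly ?q c \<noteq> 0"
  proof (rule artin_schreier_poly[OF p0 c])
    have "Polynomial.coeff ?q i \<in> insert 0 (range of_int)" for i
      by (auto simp: coeff_pCons split: nat.splits simp del: of_int_diff of_int_add of_int_mult of_int_numeral)
    moreover have "(0 :: 'k) \<in> range of_int" by (metis of_int_0 rangeI)
    ultimately show "Polynomial.coeff ?q i \<in> range of_int" for i by (metis insertE)
    show "Polynomial.degree ?q < CHAR('k)" using assms by (simp split: if_splits)
    show "?q \<noteq> 0" using 8 by (simp del: of_int_numeral)
  qed
  moreover have "poly ?q c = (of_nat n + 2 * c) * (of_nat n + 1 + 2 * c) * (of_nat n + 2 + 2 * c)
    - 6 * ((of_nat n + 2 * c) * (of_nat n + 1 + 3 * c) - (of_nat n + 4 * c))"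
    by (simp add: m_def algebra_simps power2_eq_square power3_eq_cube)
  ultimately show ?thesis by simp
qed

text \<open>
  The exceptional \<open>d\<close> are those for which the exponent of \<open>h(e\<^sub>2)\<close> is so close to \<open>p - 1\<close> that both sides
  of the relation used here vanish for degree reasons.  For \<open>p = 5\<close> this relation is
  \<open>[e\<^sub>1, e\<^sub>3] = 0\<close>, and otherwise it is \<open>3 [e\<^sub>2, e\<^sub>3] = [e\<^sub>1, e\<^sub>4]\<close>.
\<close>

lemma E_2_vanishes:
  assumes g: "J_hom \<mu> g" and 0: "g (E 0 \<ominus> s \<mu>) = 0" and 1: "g (E 1) = 0"
    and exc: "CHAR('k) = 5 \<and> d \<notin> {2, 3} \<or> CHAR('k) \<ge> 7 \<and> d \<notin> {2, 3, 4}"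
  shows "g (E 2) = 0"
proof -
  obtain t where t: "g (E 2) = Polynomial.monom t e2" using E_2_monom[OF g 0] by blast
  have 3: "g (E 3) = dact (E 1) (g (E 2))" using J_hom_E_1[OF g 1, of 2 3] by simp
  have 4: "Polynomial.smult 2 (g (E 4)) = dact (E 1) (g (E 3))" using J_hom_E_1[OF g 1, of 3 4] by simp
  have nz: "of_nat n + 2 * c \<noteq> 0" for n using two_c[of n] by (simp add: mult.commute)
  have small: "1 \<le> CHAR('k) - 2" "2 \<le> CHAR('k) - 2" "3 \<le> CHAR('k) - 2" using p5 by auto
  have "t = 0"
  proof (cases "CHAR('k) = 5")
    case True
    then have e: "e2 + 2 < CHAR('k)" using exc d by (auto simp: e2_def)
    have "g (E 4) = 0" using E_high[of 4] True J_hom_zero[OF g] by simp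
    then have "dact (E 1) (dact (E 1) (Polynomial.monom t e2)) = 0" using 3 4 t by simp
    then show ?thesis using e nz[of e2] nz[of "Suc e2"] small
      by (simp add: dact_E_monom monom_eq_0_iff mult.commute add_ac)
  next
    case False
    then have p7: "CHAR('k) \<ge> 7" using exc by auto
    then have e: "e2 + 3 < CHAR('k)" using exc d by (auto simp: e2_def)
    have 5: "Polynomial.smult 3 (g (E 5)) = dact (E 1) (g (E 4))" using J_hom_E_1[OF g 1, of 4 5] by simp
    have 23: "g (E 5) = dact (E 2) (g (E 3)) - dact (E 3) (g (E 2))" using J_hom_E_E[OF g, of 2 3] by simp
    have y3: "g (E 3) = Polynomial.monom ((of_nat e2 + 2 * c) * t) (e2 + 1)"
      using e small by (simp add: 3 t dact_E_monom mult.commute)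
    have b11: "dact (E 1) (dact (E 1) (g (E 3))) =
        Polynomial.monom ((of_nat e2 + 2 * c) * (of_nat e2 + 1 + 2 * c) * (of_nat e2 + 2 + 2 * c) * t) (e2 + 3)"
      unfolding y3 using e small by (simp add: dact_E_monom numeral_3_eq_3 algebra_simps)
    have b2: "dact (E 2) (g (E 3)) = Polynomial.monom ((of_nat e2 + 1 + 3 * c) * (of_nat e2 + 2 * c) * t) (e2 + 3)"
      unfolding y3 using e small by (simp add: dact_E_monom numeral_3_eq_3 algebra_simps)
    have b3: "dact (E 3) (g (E 2)) = Polynomial.monom ((of_nat e2 + 4 * c) * t) (e2 + 3)"
      unfolding t using e small by (simp add: dact_E_monom algebra_simps)
    have "Polynomial.smult 6 (g (E 5)) = Polynomial.smult 2 (dact (E 1) (g (E 4)))"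
      unfolding 5[symmetric] by simp
    also have "\<dots> = dact (E 1) (dact (E 1) (g (E 3)))"
      using dact_smult[of "E 1" "g (E 4)" 2] J_homD(1)[OF g J_E_i[of 4]] by (simp add: 4)
    finally have "Polynomial.smult 6 (dact (E 2) (g (E 3)) - dact (E 3) (g (E 2))) = dact (E 1) (dact (E 1) (g (E 3)))"
      unfolding 23 .
    then have "6 * ((of_nat e2 + 1 + 3 * c) * (of_nat e2 + 2 * c) * t - (of_nat e2 + 4 * c) * t)
      = (of_nat e2 + 2 * c) * (of_nat e2 + 1 + 2 * c) * (of_nat e2 + 2 + 2 * c) * t"
      unfolding b11 b2 b3 diff_monom smult_monom by simp
    then have "((of_nat e2 + 2 * c) * (of_nat e2 + 1 + 2 * c) * (of_nat e2 + 2 + 2 * c)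
      - 6 * ((of_nat e2 + 2 * c) * (of_nat e2 + 1 + 3 * c) - (of_nat e2 + 4 * c))) * t = 0"
      by (simp add: algebra_simps)
    then show ?thesis using cubic_nonzero[OF p7, of e2] by simp
  qed
  then show ?thesis using t by simp
qed

theorem every_hom_principal:
  assumes g: "J_hom \<mu> g" and exc: "CHAR('k) = 5 \<and> d \<notin> {2, 3} \<or> CHAR('k) \<ge> 7 \<and> d \<notin> {2, 3, 4}"
  shows "\<exists>y. Vp y \<and> (\<forall>a\<in>J \<mu>. g a = dact a y)"
proof -
  obtain y where y: "Vp y" "g (E 0 \<ominus> s \<mu>) = dact (E 0 \<ominus> s \<mu>) y" "g (E 1) = dact (E 1) y"
    using normalise[OF g] .
  have h: "J_hom \<mu> (\<lambda>a. g a - dact a y)" by (rule J_hom_diff[OF g J_hom_principal[OF y(1)]])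
  have "g (E 2) - dact (E 2) y = 0" by (rule E_2_vanishes[OF h _ _ exc]) (use y in simp_all)
  then have "g a - dact a y = 0" if "a \<in> J \<mu>" for a
    by (intro J_hom_determined[OF h _ _ _ that]) (use y in simp_all)
  then show ?thesis using y by auto
qed

theorem hom_multiple:
  assumes g: "J_hom \<mu> g" and k: "J_hom \<mu> k" "k (E 0 \<ominus> s \<mu>) = 0" "k (E 1) = 0" "k (E 2) \<noteq> 0"
  shows "\<exists>t y. Vp y \<and> (\<forall>a\<in>J \<mu>. g a = dact a y + Polynomial.smult t (k a))"
proof -
  obtain y where y: "Vp y" "g (E 0 \<ominus> s \<mu>) = dact (E 0 \<ominus> s \<mu>) y" "g (E 1) = dact (E 1) y"
    using normalise[OF g] .
  have h: "J_hom \<mu> (\<lambda>a. g a - dact a y)" by (rule J_hom_diff[OF g J_hom_principal[OF y(1)]])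
  obtain u where u: "g (E 2) - dact (E 2) y = Polynomial.monom u e2" using E_2_monom[OF h] y by auto
  obtain w where w: "k (E 2) = Polynomial.monom w e2" using E_2_monom[OF k(1,2)] by auto
  have w0: "w \<noteq> 0" using k(4) w by auto
  have f: "J_hom \<mu> (\<lambda>a. g a - dact a y - Polynomial.smult (u / w) (k a))"
    by (rule J_hom_diff[OF h J_hom_smult[OF k(1)]])
  have "g a - dact a y - Polynomial.smult (u / w) (k a) = 0" if "a \<in> J \<mu>" for a
    by (rule J_hom_determined[OF f _ _ _ that]) (use y k u w w0 in \<open>simp_all add: smult_monom\<close>)
  then show ?thesis using y(1) by (intro exI[of _ "u / w"] exI[of _ y]) (simp add: algebra_simps eq_diff_eq)
qed

text \<open>
  A vector \<open>y\<close> with \<open>(E 0 - \<mu>) y = 0\<close> and \<open>E 1 y = 0\<close> is zero, because \<open>E 1\<close> is injective on the line of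
  weight \<open>\<mu>\<close> unless this is the top one.
\<close>

theorem hom_not_principal:
  assumes "d \<noteq> 0" "k (E 0 \<ominus> s \<mu>) = 0" "k (E 1) = 0" "k (E 2) \<noteq> 0"
  shows "\<not> (\<exists>y. Vp y \<and> (\<forall>a\<in>J \<mu>. k a = dact a y))"
proof
  assume "\<exists>y. Vp y \<and> (\<forall>a\<in>J \<mu>. k a = dact a y)"
  then obtain y where y: "Vp y" and k: "\<And>a. a \<in> J \<mu> \<Longrightarrow> k a = dact a y" by blast
  let ?m = "CHAR('k) - 1 - d"
  have m: "?m < CHAR('k)" "Suc ?m < CHAR('k)" using assms(1) d by auto
  have "Polynomial.coeff y n = 0" for n
  proof (cases "n < CHAR('k)")
    case True
    have *: "of_nat (n + d + 1) * Polynomial.coeff y n = 0"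
      using E0_dact[OF y True] k[OF J_E_0] assms(2) by simp
    show ?thesis
    proof (cases "n = ?m")
      case n: True
      have "Polynomial.coeff (dact (E 1) y) (Suc ?m) = 0" using k[OF J_E_i[of 1]] assms(3) by simp
      then have "(of_nat ?m + c * 2) * Polynomial.coeff y ?m = 0"
        using p5 m by (subst (asm) coeff_dact_E[OF _ y m(2)]) (simp_all del: of_nat_diff)
      then show ?thesis using two_c[of ?m] n by (simp del: of_nat_diff)
    next
      case False
      have "(of_nat (n + d + 1) :: 'k) \<noteq> 0"
        unfolding of_nat_dvd using dvd_small[of "n + d + 1"] True d False by auto
      then show ?thesis using * by (simp del: of_nat_add of_nat_Suc)
    qed
  qed (use y in \<open>simp add: Vp_iff\<close>)
  then have "y = 0" by (simp add: poly_eq_iff)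
  then show False using k[OF J_E_i[of 2]] assms(4) by (simp add: dact_0)
qed

end

end

section \<open>The twisted generators satisfy the relations\<close>

lemma bracket_e:
  "witt_bracket (witt_e i) (witt_e j :: 'k::field lie) =
    (if i + j \<in> {-1..int CHAR('k) - 2} then scale (of_int (j - i)) (witt_e (i + j)) else 0)"
proof -
  have keys: "Poly_Mapping.keys (witt_e i :: 'k lie) = {i}" for i by (simp add: witt_e_def)
  show ?thesis unfolding witt_bracket_def keys by (simp add: lookup_witt_e)
qed

lemma witt_expand:
  fixes x :: "'k::field lie"
  assumes "x \<in> witt"
  shows "x = (\<Sum>i\<in>{-1..int CHAR('k) - 2}. scale (Poly_Mapping.lookup x i) (witt_e i))"
proof (rule poly_mapping_eqI)
  fix j
  show "Poly_Mapping.lookup x j = Poly_Mapping.lookup (\<Sum>i\<in>{-1..int CHAR('k) - 2}. scale (Poly_Mapping.lookup x i) (witt_e i)) j"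
    using assms by (auto simp: lookup_sum lookup_scale lookup_witt_e in_witt_iff if_distrib[of "\<lambda>x. _ * x"] cong: if_cong)
qed

context twisted_character
begin

definition pre :: "'k lie \<Rightarrow> 'k lie" where "pre = inv_into witt \<sigma>"

lemma pre: "y \<in> witt \<Longrightarrow> pre y \<in> witt" "y \<in> witt \<Longrightarrow> \<sigma> (pre y) = y" "x \<in> witt \<Longrightarrow> pre (\<sigma> x) = x"
  using \<sigma>_bij unfolding pre_def bij_betw_def
  by (auto intro: inv_into_into f_inv_into_f inv_into_f_f)

lemma \<sigma>_inj: "x \<in> witt \<Longrightarrow> y \<in> witt \<Longrightarrow> \<sigma> x = \<sigma> y \<Longrightarrow> x = y"
  using \<sigma>_bij by (auto simp: bij_betw_def inj_on_def)

text \<open>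
  The class of \<open>\<sigma>\<^sup>-\<^sup>1 y\<close>; these elements satisfy the relations of \<open>u(g, \<chi>\<^sub>0)\<close>.
\<close>

definition tgen :: "'k lie \<Rightarrow> 'k red" where "tgen y = g (pre y)"

lemma tgen_closed [simp]: "y \<in> witt \<Longrightarrow> tgen y \<in> carrier A"
  by (simp add: tgen_def pre)

lemma tgen_add: "x \<in> witt \<Longrightarrow> y \<in> witt \<Longrightarrow> tgen (x + y) = tgen x \<oplus>\<^bsub>A\<^esub> tgen y"
proof -
  assume xy: "x \<in> witt" "y \<in> witt"
  have "pre (x + y) = pre x + pre y"
    by (rule \<sigma>_inj) (use xy in \<open>simp_all add: pre witt_add \<sigma>_add\<close>)
  then show ?thesis using xy by (simp add: tgen_def g_add pre)
qed

lemma tgen_scale: "x \<in> witt \<Longrightarrow> tgen (scale t x) = s t \<otimes>\<^bsub>A\<^esub> tgen x"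
proof -
  assume x: "x \<in> witt"
  have "pre (scale t x) = scale t (pre x)"
    by (rule \<sigma>_inj) (use x in \<open>simp_all add: pre witt_scale \<sigma>_scale\<close>)
  then show ?thesis using x by (simp add: tgen_def g_scale pre)
qed

lemma tgen_bracket: "x \<in> witt \<Longrightarrow> y \<in> witt \<Longrightarrow> tgen x \<otimes>\<^bsub>A\<^esub> tgen y = tgen y \<otimes>\<^bsub>A\<^esub> tgen x \<oplus>\<^bsub>A\<^esub> tgen (witt_bracket x y)"
proof -
  assume xy: "x \<in> witt" "y \<in> witt"
  have eq: "pre (witt_bracket x y) = witt_bracket (pre x) (pre y)"
    by (rule \<sigma>_inj) (use xy in \<open>simp_all add: pre witt_bracket_in \<sigma>_bracket\<close>)
  show ?thesis unfolding tgen_def eq by (rule g_bracket) (use xy in \<open>simp_all add: pre\<close>)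
qed

lemma tgen_pow: "x \<in> witt \<Longrightarrow> tgen x [^]\<^bsub>A\<^esub> CHAR('k) = tgen (witt_pmap x) \<oplus>\<^bsub>A\<^esub> s (chi0 x ^ CHAR('k))"
proof -
  assume x: "x \<in> witt"
  have "pre (witt_pmap x) = witt_pmap (pre x)"
    by (rule \<sigma>_inj) (use x in \<open>simp_all add: pre witt_pmap_in \<sigma>_pmap\<close>)
  then show ?thesis using x g_pow[OF pre(1)[OF x]] \<chi>[OF pre(1)[OF x]] by (simp add: tgen_def pre)
qed

lemma s0: "s 0 = \<zero>\<^bsub>A\<^esub>"
proof -
  have "s 0 \<oplus>\<^bsub>A\<^esub> s 0 = s 0" using s_add[of 0 0] by simp
  then show ?thesis by simp
qed

lemma scale_0: "scale 0 x = (0 :: 'k lie)"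
  by (rule poly_mapping_eqI) (simp add: lookup_scale)

lemma tgen_0: "tgen 0 = \<zero>\<^bsub>A\<^esub>"
  using tgen_scale[OF witt_0, of 0] by (simp add: scale_0 s0 witt_0)

definition E :: "nat \<Rightarrow> 'k red" where
  "E n = (if n \<le> CHAR('k) - 2 then tgen (witt_e (int n)) else \<zero>\<^bsub>A\<^esub>)"

definition D :: "'k red" where "D = tgen (witt_e (- 1))"

lemma e_in: "n \<le> CHAR('k) - 2 \<Longrightarrow> (witt_e (int n) :: 'k lie) \<in> witt" "(witt_e (- 1) :: 'k lie) \<in> witt"
  using p5 by (auto intro!: witt_e_in)

lemma E_eq: "n \<le> CHAR('k) - 2 \<Longrightarrow> E n = tgen (witt_e (int n))"
  by (simp add: E_def)

lemma tgen_e_pow: "i \<in> {-1..int CHAR('k) - 2} \<Longrightarrow>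
    tgen (witt_e i) [^]\<^bsub>A\<^esub> CHAR('k) = (if i = 0 then tgen (witt_e 0) \<oplus>\<^bsub>A\<^esub> \<one>\<^bsub>A\<^esub> else \<zero>\<^bsub>A\<^esub>)"
  using p0 by (simp add: tgen_pow witt_e_in witt_pmap_e chi0_def lookup_witt_e power_0_left s0 s_one tgen_0)

sublocale gen: witt_generators A s E D
proof (unfold_locales, goal_cases)
  case 1
  show ?case by (rule p5)
next
  case (2 c)
  show ?case by simp
next
  case (3 x y)
  show ?case by (rule s_add)
next
  case (4 x y)
  show ?case by (rule s_mult)
next
  case 5
  show ?case by (rule s_one)
next
  case (6 a c)
  then show ?case by (rule s_central)
next
  case (7 i)
  show ?case by (simp add: E_def e_in)
next
  case 8
  show ?case by (simp add: D_def e_in)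
next
  case (9 i)
  then show ?case by (simp add: E_def)
next
  case (10 i j)
  show ?case
  proof (cases "i \<le> CHAR('k) - 2 \<and> j \<le> CHAR('k) - 2")
    case True
    have "tgen (witt_bracket (witt_e (int i)) (witt_e (int j))) = s (of_nat j - of_nat i) \<otimes>\<^bsub>A\<^esub> E (i + j)"
      using p5 by (auto simp: bracket_e E_def tgen_scale e_in tgen_0 of_nat_add[symmetric] simp del: of_nat_add)
    then show ?thesis using True tgen_bracket[of "witt_e (int i)" "witt_e (int j)"] by (simp add: E_eq e_in)
  next
    case False
    then have "E i = \<zero>\<^bsub>A\<^esub> \<or> E j = \<zero>\<^bsub>A\<^esub>" "E (i + j) = \<zero>\<^bsub>A\<^esub>" by (auto simp: E_def)
    moreover have "E n \<in> carrier A" for n by (simp add: E_def e_in)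
    ultimately show ?thesis by auto
  qed
next
  case (11 i)
  have Ec: "E n \<in> carrier A" for n by (simp add: E_def e_in)
  have Dc: "D \<in> carrier A" by (simp add: D_def e_in)
  show ?case
  proof (cases "i \<le> CHAR('k) - 2")
    case True
    have "tgen (witt_bracket (witt_e (int i)) (witt_e (- 1))) = s (- (of_nat i + 1)) \<otimes>\<^bsub>A\<^esub> (if i = 0 then D else E (i - 1))"
    proof (cases "i = 0")
      case z: True
      then show ?thesis using p5 by (simp add: bracket_e tgen_scale e_in D_def)
    next
      case False
      then have i: "int i + - 1 = int (i - 1)" "i - 1 \<le> CHAR('k) - 2" using True by auto
      have "int i + - 1 \<in> {-1..int CHAR('k) - 2}" using True p5 by auto
      moreover have "(of_int (- 1 - int i) :: 'k) = - (of_nat i + 1)" by simp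
      ultimately have "witt_bracket (witt_e (int i)) (witt_e (- 1)) = scale (- (of_nat i + 1)) (witt_e (int (i - 1)) :: 'k lie)"
        by (simp only: bracket_e if_True i(1))
      then show ?thesis using False i(2) by (simp only: tgen_scale e_in E_eq if_False)
    qed
    then show ?thesis using True tgen_bracket[of "witt_e (int i)" "witt_e (- 1)"] by (simp add: E_eq D_def e_in)
  next
    case False
    have "s (- (of_nat i + 1)) \<otimes>\<^bsub>A\<^esub> (if i = 0 then D else E (i - 1)) = \<zero>\<^bsub>A\<^esub>"
    proof (cases "i = CHAR('k) - 1")
      case True
      then have "i + 1 = CHAR('k)" using p5 by simp
      then have "(of_nat (i + 1) :: 'k) = 0" by (simp only: of_nat_CHAR)
      then have "- (of_nat i + 1) = (0 :: 'k)" by (simp add: add.commute)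
      then show ?thesis by (simp only: s0) (simp add: Ec Dc)
    next
      case n: False
      then have "i \<noteq> 0" "\<not> i - 1 \<le> CHAR('k) - 2" using False p5 by linarith+
      then have "i \<noteq> 0" "E (i - 1) = \<zero>\<^bsub>A\<^esub>" by (simp_all only: E_def if_False not_False_eq_True)
      then show ?thesis by simp
    qed
    moreover have "E i = \<zero>\<^bsub>A\<^esub>" using False by (simp add: E_def)
    ultimately show ?thesis by (simp add: Dc)
  qed
next
  case 12
  show ?case using tgen_e_pow[of "- 1"] p5 by (simp add: D_def)
next
  case 13
  show ?case using tgen_e_pow[of 0] p5 by (simp add: E_def)
next
  case 14
  have "1 \<le> CHAR('k) - 2" using p5 by simp
  then show ?case using tgen_e_pow[of 1] p5 by (simp add: E_def)
next
  case (15 a P)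
  from 15(1) show ?case
  proof (induction rule: A_induct)
    case (gen x a)
    \<comment> \<open>Expand \<open>\<sigma> x\<close> in the basis \<open>e\<^sub>i\<close>; the class of \<open>x\<close> is \<open>tgen (\<sigma> x)\<close>.\<close>
    have "P (tgen (\<Sum>i\<in>S. scale (Poly_Mapping.lookup (\<sigma> x) i) (witt_e i)) \<otimes>\<^bsub>A\<^esub> a)" if "S \<subseteq> {-1..int CHAR('k) - 2}" for S
      using finite_subset[OF that finite_atLeastAtMost_int] that
    proof (induction S rule: finite_induct)
      case empty
      then show ?case using 15(4)[of a 0] gen by (simp add: tgen_0 s0)
    next
      case (insert i S)
      let ?u = "\<Sum>i\<in>S. scale (Poly_Mapping.lookup (\<sigma> x) i) (witt_e i)" and ?t = "Poly_Mapping.lookup (\<sigma> x) i"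
      have u: "?u \<in> witt" using insert by (intro witt_sum witt_scale witt_e_in) auto
      have e: "(witt_e i :: 'k lie) \<in> witt" using insert by (intro witt_e_in) auto
      have "P (tgen (witt_e i) \<otimes>\<^bsub>A\<^esub> a)"
      proof (cases "i = - 1")
        case True
        then show ?thesis using 15(6)[of a] gen by (simp add: D_def)
      next
        case False
        then have "i = int (nat i)" "nat i \<le> CHAR('k) - 2" using insert.prems by auto
        then have "tgen (witt_e i) = E (nat i)" using E_eq[of "nat i"] by simp
        then show ?thesis using 15(5)[of a "nat i"] gen by simp
      qed
      then have "P (s ?t \<otimes>\<^bsub>A\<^esub> (tgen (witt_e i) \<otimes>\<^bsub>A\<^esub> a))" using gen e by (intro 15(4)) simp_all
      then have "P (s ?t \<otimes>\<^bsub>A\<^esub> (tgen (witt_e i) \<otimes>\<^bsub>A\<^esub> a) \<oplus>\<^bsub>A\<^esub> tgen ?u \<otimes>\<^bsub>A\<^esub> a)"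
        using insert gen e u by (intro 15(3)) simp_all
      moreover have "tgen (scale ?t (witt_e i) + ?u) \<otimes>\<^bsub>A\<^esub> a = s ?t \<otimes>\<^bsub>A\<^esub> (tgen (witt_e i) \<otimes>\<^bsub>A\<^esub> a) \<oplus>\<^bsub>A\<^esub> tgen ?u \<otimes>\<^bsub>A\<^esub> a"
        using gen e u by (simp add: tgen_add witt_scale tgen_scale A.l_distr A.m_assoc)
      ultimately show ?case using insert by simp
    qed
    from this[OF order_refl] show ?case
      using witt_expand[OF \<sigma>_in[OF gen(1)]] gen(1) by (simp add: tgen_def pre)
  qed (use 15 in auto)
qed

section \<open>Density modules over the reduced enveloping algebra\<close>

definition dact :: "'k \<Rightarrow> 'k red \<Rightarrow> 'k poly \<Rightarrow> 'k poly" where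
  "dact c a v = act Polynomial.smult (\<lambda>x. density c (vfield (\<sigma> x))) (red_rep witt \<chi> a) v mod XP"

lemma cls_surj: "a \<in> carrier A \<Longrightarrow> \<exists>f\<in>carrier F. a = cls f"
  using A_carrier by auto

lemma dact_cls:
  assumes c: "c ^ CHAR('k) - c = 1" and f: "f \<in> carrier F"
  shows "dact c (cls f) v = act Polynomial.smult (\<lambda>x. density c (vfield (\<sigma> x))) f v mod XP"
proof -
  interpret R: reduced_representation witt \<chi> Polynomial.smult "\<lambda>x. density c (vfield (\<sigma> x))" "{v. XP dvd v}"
    by (rule density_representation[OF c])
  show ?thesis unfolding dact_def mod_XP_eq_iff
    using R.act_cong[of "red_rep witt \<chi> (cls f)" f v] f red_rep[of "cls f"] by simp
qed

theorem density_action: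
  assumes c: "c ^ CHAR('k) - c = 1"
  shows "density_action A s E D c (dact c)"
proof -
  interpret R: reduced_representation witt \<chi> Polynomial.smult "\<lambda>x. density c (vfield (\<sigma> x))" "{v. XP dvd v}"
    by (rule density_representation[OF c])
  note b = dact_cls[OF c]
  have modadd: "(u + v) mod XP = u mod XP + v mod XP" for u v :: "'k poly"
    by (rule poly_eqI) (simp add: coeff_mod_monom)
  have tgen: "dact c (tgen y) v = density c (vfield y) v mod XP" if "y \<in> witt" for y v
    using that by (simp add: tgen_def b pre)
  show ?thesis
  proof (unfold_locales, goal_cases)
    case 1
    show ?case by (rule c)
  next
    case (2 a v)
    show ?case by (simp add: dact_def)
  next
    case (3 x y v)
    then obtain f f' where "f \<in> carrier F" "f' \<in> carrier F" "x = cls f" "y = cls f'"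
      using cls_surj[of x] cls_surj[of y] by blast
    then show ?case using F.a_closed[of f f'] by (simp add: cls_add[symmetric] b R.act_add modadd)
  next
    case (4 x y v)
    then obtain f f' where f: "f \<in> carrier F" "f' \<in> carrier F" "x = cls f" "y = cls f'"
      using cls_surj[of x] cls_surj[of y] by blast
    have "XP dvd R.ac f (R.ac f' v mod XP - R.ac f' v)"
      using R.act_Z[OF f(1), of "R.ac f' v mod XP - R.ac f' v"] XP_dvd_mod(1)[of "R.ac f' v"] by simp
    then have "XP dvd (R.ac f (R.ac f' v) - R.ac f (R.ac f' v mod XP))"
      using R.act_vadd[of f "R.ac f' v mod XP - R.ac f' v" "R.ac f' v"] by (simp add: dvd_diff_commute)
    then show ?case using f F.m_closed[of f f']
      by (simp add: cls.hom_mult[symmetric] b R.act_mult mod_XP_eq_iff del: cls.hom_mult)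
  next
    case (5 a u v)
    show ?case by (simp add: dact_def R.act_vadd modadd)
  next
    case (6 v t)
    have "Polynomial.smult t v mod XP = Polynomial.smult t (v mod XP)" by (rule poly_eqI) (simp add: coeff_mod_monom)
    with 6 show ?case by (simp add: b)
  next
    case (7 i v)
    have "nat (int i + 1) = Suc i" by linarith
    with 7 show ?case using p5 by (simp add: E_eq tgen e_in vfield_e)
  next
    case (8 v)
    have v0: "Polynomial.coeff v n = 0" if "n \<ge> CHAR('k)" for n using 8 that by (metis coeff_mod_monom not_less)
    have "pderiv v mod XP = pderiv v"
      by (rule poly_eqI) (simp add: coeff_mod_monom coeff_pderiv v0)
    then show ?case using p5 by (simp add: D_def tgen e_in vfield_e monom_0 density_def pderiv_pCons one_pCons[symmetric])
  qed
qed

section \<open>The homomorphism defined by an extension\<close>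

text \<open>
  In an extension of the density module of weight \<open>c\<close> by that of weight \<open>c + d\<close>, lift the top vector of
  the quotient to \<open>(X\<^bsup>p-1\<^esup>, 0)\<close>.  Its annihilator in the quotient acts on the lift with values in the
  submodule.
\<close>

definition coc_hom :: "nat \<Rightarrow> 'k \<Rightarrow> 'k red \<Rightarrow> 'k poly" where
  "coc_hom d c a = snd (act pair_smult (\<lambda>x. ext_act d c (vfield (\<sigma> x))) (red_rep witt \<chi> a)
      (Polynomial.monom 1 (CHAR('k) - 1), 0)) mod XP"

context
  fixes c :: 'k and d :: nat
  assumes c: "c ^ CHAR('k) - c = 1" and d: "d \<in> {2, 3, 4}"
begin

lemma c_shift: "(c + of_nat d) ^ CHAR('k) - (c + of_nat d) = 1"
  by (rule artin_schreier_shift[OF p0 c])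

interpretation M: reduced_representation witt \<chi> Polynomial.smult "\<lambda>x. density c (vfield (\<sigma> x))" "{v. XP dvd v}"
  by (rule density_representation[OF c])
interpretation N: reduced_representation witt \<chi> Polynomial.smult "\<lambda>x. density (c + of_nat d) (vfield (\<sigma> x))" "{v. XP dvd v}"
  by (rule density_representation[OF c_shift])
interpretation X: reduced_representation witt \<chi> pair_smult "\<lambda>x. ext_act d c (vfield (\<sigma> x))" "{v. XP dvd fst v \<and> XP dvd snd v}"
  by (rule ext_representation[OF c d])
interpretation dM: density_action A s E D c "dact c" by (rule density_action[OF c])
interpretation dN: density_action A s E D "c + of_nat d" "dact (c + of_nat d)" by (rule density_action[OF c_shift])

lemma ext_fst: "fst (X.ac f v) = M.ac f (fst v)"
proof (induction f rule: free_induct)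
  case (2 w t)
  have "fst (foldr (\<lambda>x. ext_act d c (vfield (\<sigma> x))) w v) = foldr (\<lambda>x. density c (vfield (\<sigma> x))) w (fst v)"
    by (induction w) (simp_all add: ext_act_def)
  then show ?case by simp (simp add: pair_smult_def)
qed (simp_all add: X.act_add M.act_add)

lemma ext_snd: "X.ac f (0, v) = (0, N.ac f v)"
proof (induction f rule: free_induct)
  case (2 w t)
  have "foldr (\<lambda>x. ext_act d c (vfield (\<sigma> x))) w (0, v) = (0, foldr (\<lambda>x. density (c + of_nat d) (vfield (\<sigma> x))) w v)"
    by (induction w) (simp_all add: ext_act_def cocycle_0, simp add: density_def)
  then show ?case by simp (simp add: pair_smult_def)
qed (simp_all add: X.act_add N.act_add zero_prod_def)

abbreviation "w \<equiv> (Polynomial.monom 1 (CHAR('k) - 1) :: 'k poly, 0 :: 'k poly)"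

lemma coc_cls: "f \<in> carrier F \<Longrightarrow> coc_hom d c (cls f) = snd (X.ac f w) mod XP"
  unfolding coc_hom_def mod_XP_eq_iff
  using X.act_cong[of "red_rep witt \<chi> (cls f)" f w] red_rep[of "cls f"] by simp

lemma coc_J_hom: "dN.J_hom (c - 1) (coc_hom d c)"
proof -
  have add: "coc_hom d c (a \<oplus>\<^bsub>A\<^esub> b) = coc_hom d c a + coc_hom d c b" if ab: "a \<in> carrier A" "b \<in> carrier A" for a b
  proof -
    obtain f f' where f: "f \<in> carrier F" "f' \<in> carrier F" "a = cls f" "b = cls f'"
      using cls_surj[OF ab(1)] cls_surj[OF ab(2)] by blast
    have "(u + v) mod XP = u mod XP + v mod XP" for u v :: "'k poly"
      by (rule poly_eqI) (simp add: coeff_mod_monom)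
    then show ?thesis using f F.a_closed[of f f'] by (simp add: cls_add[symmetric] coc_cls X.act_add)
  qed
  have mult: "coc_hom d c (r \<otimes>\<^bsub>A\<^esub> a) = dact (c + of_nat d) r (coc_hom d c a)" if ra: "r \<in> carrier A" "a \<in> gen.J (c - 1)" for r a
  proof -
    have aA: "a \<in> carrier A" by (rule gen.J_carrier[OF ra(2)])
    obtain f f' where f: "f \<in> carrier F" "f' \<in> carrier F" "r = cls f" "a = cls f'"
      using cls_surj[OF ra(1)] cls_surj[OF aA] by blast
    have "dact c a dM.top_vec = 0" using dM.annihilator[OF aA] ra(2) by simp
    then have "XP dvd (fst (X.ac f' w))" using f by (simp add: dact_cls[OF c] dM.top_vec_def ext_fst dvd_eq_mod_eq_0)
    then have "X.ac f (fst (X.ac f' w), 0) \<in> {v. XP dvd fst v \<and> XP dvd snd v}"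
      using f by (intro X.act_Z) simp_all
    moreover have "X.ac f (X.ac f' w) = X.ac f (fst (X.ac f' w), 0) + X.ac f (0, snd (X.ac f' w))"
      unfolding X.act_vadd[symmetric] by (simp add: prod_eq_iff)
    ultimately have 1: "XP dvd (snd (X.ac f (X.ac f' w)) - N.ac f (snd (X.ac f' w)))"
      by (simp add: ext_snd)
    let ?v = "snd (X.ac f' w)"
    have "XP dvd N.ac f (?v - ?v mod XP)" using N.act_Z[OF f(1), of "?v - ?v mod XP"] XP_dvd_mod(2)[of ?v] by simp
    then have "XP dvd (N.ac f ?v - N.ac f (?v mod XP))"
      using N.act_vadd[of f "?v - ?v mod XP" "?v mod XP"] by simp
    from dvd_add[OF 1 this] have "XP dvd (snd (X.ac f (X.ac f' w)) - N.ac f (?v mod XP))" by simp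
    then show ?thesis using f F.m_closed[of f f']
      by (simp add: cls.hom_mult[symmetric] coc_cls X.act_mult dact_cls[OF c_shift] mod_XP_eq_iff del: cls.hom_mult)
  qed
  show ?thesis unfolding dN.J_hom_def
    using gen.J_carrier add mult by (auto simp: coc_hom_def)
qed

lemma coc_tgen: "y \<in> witt \<Longrightarrow> coc_hom d c (tgen y) = cocycle d c (vfield y) (Polynomial.monom 1 (CHAR('k) - 1)) mod XP"
  by (simp add: tgen_def coc_cls pre ext_act_def) (simp add: density_def)

lemma coc_E:
  shows "coc_hom d c (E 0 \<ominus>\<^bsub>A\<^esub> s (c - 1)) = 0" "coc_hom d c (E 1) = 0"
proof -
  let ?f = "free_gen (pre (witt_e 0)) - free_scalar (c - 1)"
  have e0: "(witt_e 0 :: 'k lie) \<in> witt" using e_in(1)[of 0] by simp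
  have f: "?f \<in> carrier F" using e0 by (intro F_minus_closed) (simp_all add: pre)
  have "E 0 \<ominus>\<^bsub>A\<^esub> s (c - 1) = cls ?f" using e0 by (simp add: cls_minus pre E_def tgen_def)
  moreover have "snd (X.ac ?f w) = 0"
    using e0 p5 d by (auto simp: X.act_diff pre ext_act_def vfield_e pair_smult_def cocycle_def coc_defs pderiv_monom monom_0 density_def pderiv_pCons one_pCons)
  ultimately show "coc_hom d c (E 0 \<ominus>\<^bsub>A\<^esub> s (c - 1)) = 0" using coc_cls[OF f] by simp
  have "vfield (witt_e 1 :: 'k lie) = Polynomial.monom 1 2" using p5 by (simp add: vfield_e)
  then show "coc_hom d c (E 1) = 0"
    using p5 e_in(1)[of 1] d coc_tgen[of "witt_e 1"] by (auto simp: E_def cocycle_def coc_defs pderiv_monom)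
qed

text \<open>
  The values for \<open>d = 2, 3, 4\<close> are \<open>6 X\<^bsup>p-1\<^esup>\<close>, \<open>12 (X\<^bsup>p-1\<^esup>)'\<close> and \<open>60 (X\<^bsup>p-1\<^esup>)''\<close>; the factor \<open>10\<close> in the last
  one is where \<open>p = 5\<close> fails.
\<close>

lemma coc_E2:
  assumes "d = 4 \<Longrightarrow> CHAR('k) \<ge> 7"
  shows "coc_hom d c (E 2) \<noteq> 0"
proof -
  let ?q = "CHAR('k)"
  have n2: "(of_nat 2 :: 'k) \<noteq> 0" "(of_nat 3 :: 'k) \<noteq> 0" by (rule dM.nat_nonzero; use p5 in simp)+
  have "(6 :: 'k) = of_nat 2 * of_nat 3" by simp
  then have n6: "(6 :: 'k) \<noteq> 0" using n2 by (metis no_zero_divisors)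
  have "(12 :: 'k) = of_nat 2 * 6" by simp
  then have n12: "(12 :: 'k) \<noteq> 0" using n2 n6 by (metis no_zero_divisors)
  have v: "vfield (witt_e 2 :: 'k lie) = Polynomial.monom 1 3" using p5 by (simp add: vfield_e)
  have E2: "coc_hom d c (E 2) = cocycle d c (Polynomial.monom 1 3) (Polynomial.monom 1 (?q - 1)) mod XP"
    using p5 e_in(1)[of 2] coc_tgen[of "witt_e 2"] by (simp add: E_def v)
  have 3: "pderiv (pderiv (pderiv (Polynomial.monom 1 3 :: 'k poly))) = [:of_nat 2 * of_nat 3:]"
    by (simp add: pderiv_monom monom_0 mult.commute)
  have "\<exists>n t. n < ?q \<and> t \<noteq> 0 \<and> cocycle d c (Polynomial.monom 1 3) (Polynomial.monom 1 (?q - 1)) = Polynomial.monom t n"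
  proof -
    consider "d = 2" | "d = 3" | "d = 4" using d by auto
    then show ?thesis
    proof cases
      case 1
      then show ?thesis using n6 n2 p0
        by (intro exI[of _ "?q - 1"] exI[of _ "of_nat 2 * of_nat 3"]) (simp add: cocycle_def coc_defs 3 smult_monom)
    next
      case 2
      have "(of_nat (?q - 1) :: 'k) \<noteq> 0" by (rule dM.nat_nonzero; use p5 in simp)
      then show ?thesis using n12 n6 n2 2 p0
        by (intro exI[of _ "?q - 2"] exI[of _ "2 * (of_nat 2 * of_nat 3 * of_nat (?q - 1))"])
          (simp add: cocycle_def coc_defs 3 smult_monom pderiv_monom pderiv_pCons numeral_poly del: of_nat_diff,
            simp add: monom_0[symmetric] mult_monom numeral_2_eq_2 del: of_nat_diff)
    next
      case four: 3
      have k: "(of_nat (?q - 1) :: 'k) \<noteq> 0" "(of_nat (?q - 2) :: 'k) \<noteq> 0" "(of_nat 5 :: 'k) \<noteq> 0"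
        by (rule dM.nat_nonzero; use p5 assms[OF four] in simp)+
      have "(10 :: 'k) = of_nat 2 * of_nat 5" by simp
      then have "(10 :: 'k) \<noteq> 0" using n2 k by (metis no_zero_divisors)
      moreover have "(60 :: 'k) = 6 * 10" by simp
      ultimately have "(60 :: 'k) \<noteq> 0" using n6 by (metis no_zero_divisors)
      then show ?thesis using n6 n2 four p0 k
        by (intro exI[of _ "?q - 3"] exI[of _ "10 * (of_nat 2 * of_nat 3 * (of_nat (?q - 2) * of_nat (?q - 1)))"])
          (simp add: cocycle_def coc_defs 3 smult_monom pderiv_monom pderiv_pCons numeral_poly diff_diff_left del: of_nat_diff,
            simp add: monom_0[symmetric] mult_monom eval_nat_numeral del: of_nat_diff)
    qed
  qed
  then obtain n t where nt: "n < ?q" "t \<noteq> 0"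
    "cocycle d c (Polynomial.monom 1 3) (Polynomial.monom 1 (?q - 1)) = Polynomial.monom t n" by blast
  then have "coc_hom d c (E 2) = Polynomial.monom t n" unfolding E2 nt(3) mod_monom by simp
  then show ?thesis using nt(2) by (simp add: monom_eq_0_iff)
qed

end

end

section \<open>The induced modules\<close>

lemma free_map_id: "free_map id f = f"
proof (rule poly_mapping_eqI)
  fix u
  have "Poly_Mapping.lookup (free_map id f) u =
      (\<Sum>x\<in>Poly_Mapping.keys f. if x = u then Poly_Mapping.lookup f u else 0)"
    unfolding free_map_def lookup_sum by (rule sum.cong) (auto simp: lookup_single when_def)
  then show "Poly_Mapping.lookup (free_map id f) u = Poly_Mapping.lookup f u"
    by (simp add: in_keys_iff)
qed

lemma (in operator_family) act_sum: "ac (sum F S) v = (\<Sum>x\<in>S. ac (F x) v)"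
  by (induction S rule: infinite_finite_induct) (simp_all add: act_add)

lemma (in operator_family) act_free_map: "ac (free_map \<phi> f) v = act sc (\<lambda>x. \<rho> (\<phi> x)) f v"
  by (simp add: free_map_def act_sum act_def[of sc "\<lambda>x. \<rho> (\<phi> x)"] foldr_map comp_def)

locale induced = T: twisted_character "chi0 :: 'k::field lie \<Rightarrow> 'k" id
  for w :: "'k::field" +
  assumes w: "w ^ CHAR('k) - w = 1"
begin

abbreviation "A \<equiv> red_env (witt :: 'k lie set) chi0"
abbreviation "B \<equiv> red_env (witt_borel :: 'k lie set) chi0"
abbreviation "\<iota> \<equiv> red_map (witt_borel :: 'k lie set) chi0 witt chi0 id"
abbreviation "k_w \<equiv> borel_module w"
abbreviation "L \<equiv> induced_module A B \<iota> k_w"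

sublocale B: reduced_representation "witt_borel :: 'k lie set" chi0 "(*)" "\<lambda>x v. w * Poly_Mapping.lookup x 0 * v" "{0}"
  by (rule borel_representation[OF T.p2 w])

lemma c: "(w + 1) ^ CHAR('k) - (w + 1) = 1"
  using artin_schreier_shift[OF T.p0 w, of 1] by simp

sublocale d: density_action A T.s T.E T.D "w + 1" "T.dact (w + 1)"
  by (rule T.density_action[OF c])

abbreviation "dact \<equiv> T.dact (w + 1)"

lemma borel_witt: "(witt_borel :: 'k lie set) \<subseteq> witt"
  by (simp add: subset_iff in_borel_iff)

lemma borel_F: "f \<in> carrier B.F \<Longrightarrow> f \<in> carrier T.F"
  unfolding B.F_carrier T.F_carrier using borel_witt by blast

text \<open>
  The relations of \<open>u(b\<^sup>+, \<chi>\<^sub>0)\<close> are among those of \<open>u(g, \<chi>\<^sub>0)\<close>, so the inclusion induces a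
  homomorphism of the reduced enveloping algebras.
\<close>

lemma B_kernel:
  assumes f: "f \<in> carrier B.F" "B.cls f = \<zero>\<^bsub>B\<^esub>"
  shows "T.cls f = \<zero>\<^bsub>A\<^esub>"
proof -
  define Y where "Y = {f \<in> carrier B.F. T.cls f = \<zero>\<^bsub>A\<^esub>}"
  have mult_eq: "f \<otimes>\<^bsub>B.F\<^esub> f' = f \<otimes>\<^bsub>T.F\<^esub> f'" for f f' by (simp add: free_alg_def)
  have pow_eq: "f [^]\<^bsub>B.F\<^esub> (n :: nat) = f [^]\<^bsub>T.F\<^esub> n" for f n
  proof (induction n)
    case 0
    show ?case by (simp add: free_alg_def)
  qed (simp add: mult_eq)
  have "ideal Y B.F"
  proof (rule idealI[OF B.F.ring_axioms])
    show "subgroup Y (add_monoid B.F)"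
    proof (rule B.F.add.subgroupI)
      show "Y \<subseteq> carrier B.F" by (auto simp: Y_def)
      show "Y \<noteq> {}" using T.cls.hom_zero B.F.zero_closed by (auto simp: Y_def)
      fix a b assume a: "a \<in> Y"
      then show "\<ominus>\<^bsub>B.F\<^esub> a \<in> Y" using T.cls_minus[of 0 a] borel_F[of a] T.cls.hom_zero B.F.a_inv_closed[of a]
        by (auto simp: Y_def B.F_uminus a_minus_def T.F_carrier)
      assume "b \<in> Y"
      then show "a \<oplus>\<^bsub>B.F\<^esub> b \<in> Y" using a B.F.a_closed[of a b] borel_F
        by (auto simp: Y_def T.cls_add)
    qed
  next
    fix a x assume ax: "a \<in> Y" "x \<in> carrier B.F"
    then have a: "a \<in> carrier B.F" "T.cls a = \<zero>\<^bsub>A\<^esub>" by (simp_all add: Y_def)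
    have "T.cls (x \<otimes>\<^bsub>T.F\<^esub> a) = \<zero>\<^bsub>A\<^esub>" "T.cls (a \<otimes>\<^bsub>T.F\<^esub> x) = \<zero>\<^bsub>A\<^esub>"
      using a ax by (simp_all add: borel_F)
    then show "x \<otimes>\<^bsub>B.F\<^esub> a \<in> Y" "a \<otimes>\<^bsub>B.F\<^esub> x \<in> Y"
      using B.F.m_closed[OF ax(2) a(1)] B.F.m_closed[OF a(1) ax(2)] unfolding Y_def mult_eq by simp_all
  qed
  moreover have "B.env_relations \<subseteq> Y"
  proof
    fix f assume f: "f \<in> B.env_relations"
    then have "f \<in> T.env_relations"
      unfolding B.env_relations_def T.env_relations_def mult_eq using borel_witt by blast
    then show "f \<in> Y" using f B.env_relations_carrier T.env_relations_mem by (auto simp: Y_def)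
  qed
  moreover have "B.pth_relation x \<in> Y" if "x \<in> witt_borel" for x
  proof -
    have "B.pth_relation x = T.pth_relation x" by (simp add: B.pth_relation_def T.pth_relation_def pow_eq)
    then show ?thesis using that B.pth_relation_carrier[OF that] T.pth_relation_mem[of x]
      by (simp add: Y_def in_borel_iff)
  qed
  ultimately have "f \<in> Y" by (rule B.kernel_minimal) (use f in auto)
  then show ?thesis by (simp add: Y_def)
qed

lemma \<iota>_cls:
  assumes "f \<in> carrier B.F"
  shows "\<iota> (B.cls f) = T.cls f"
proof -
  let ?r = "red_rep witt_borel chi0 (B.cls f)"
  have r: "?r \<in> carrier B.F" "B.cls ?r = B.cls f" using B.red_rep[of "B.cls f"] assms by auto
  then have "B.cls (?r - f) = \<zero>\<^bsub>B\<^esub>" using assms by (simp add: B.cls_minus B.A.minus_self)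
  then have "T.cls (?r - f) = \<zero>\<^bsub>A\<^esub>" using r assms by (intro B_kernel B.F_minus_closed)
  then have "T.cls ?r = T.cls f"
    using r assms T.A.minus_eq_zeroD[of "T.cls ?r" "T.cls f"] by (simp add: T.cls_minus borel_F)
  then show ?thesis by (simp add: red_map_def free_map_id)
qed

text \<open>
  The character by which \<open>u(b\<^sup>+, \<chi>\<^sub>0)\<close> acts on its one-dimensional module.
\<close>

definition \<epsilon> :: "'k free \<Rightarrow> 'k" where "\<epsilon> f = B.ac f 1"

lemma B_ac: "B.ac f v = \<epsilon> f * v"
  using B.act_sc[of f v 1] by (simp add: \<epsilon>_def mult.commute)

lemma k_w_smult:
  assumes "f \<in> carrier B.F"
  shows "B.cls f \<odot>\<^bsub>k_w\<^esub> v = \<epsilon> f * v"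
proof -
  let ?r = "red_rep witt_borel chi0 (B.cls f)"
  have r: "?r \<in> carrier B.F" "B.cls ?r = B.cls f" using B.red_rep[of "B.cls f"] assms by auto
  have word: "foldr (\<lambda>x v. w * Poly_Mapping.lookup x 0 * v) u v = prod_list (map (\<lambda>x. w * Poly_Mapping.lookup x 0) u) * v" for u :: "'k lie list" and v
    by (induction u) simp_all
  have "B.cls f \<odot>\<^bsub>k_w\<^esub> v = B.ac ?r v"
    unfolding act_def word by (simp add: borel_module_def Let_def sum_distrib_right)
  also have "\<dots> = B.ac f v" using B.act_cong[OF r(1) assms r(2), of v] by simp
  finally show ?thesis by (simp add: B_ac)
qed

lemma k_w_simps: "carrier k_w = UNIV" "x \<oplus>\<^bsub>k_w\<^esub> y = x + y" "\<zero>\<^bsub>k_w\<^esub> = 0"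
  by (simp_all add: borel_module_def)

interpretation R: reduced_representation "witt :: 'k lie set" chi0 Polynomial.smult "\<lambda>x. density (w + 1) (vfield (id x))" "{v. XP dvd v}"
  by (rule T.density_representation[OF c])

text \<open>
  Only the linear coefficient of a vector field \<open>a d/dX\<close> with \<open>a(0) = 0\<close> matters, since
  multiplication by \<open>X\<close> annihilates \<open>X\<^bsup>p-1\<^esup>\<close>.
\<close>

lemma borel_top:
  assumes "x \<in> witt_borel"
  shows "XP dvd (density (w + 1) (vfield x) d.top_vec - Polynomial.smult (w * Poly_Mapping.lookup x 0) d.top_vec)"
proof -
  obtain q where q: "vfield x = pCons 0 q" using borel_coeff[OF assms] by (cases "vfield x") auto
  have q0: "Polynomial.coeff q 0 = Poly_Mapping.lookup x 0"
    using coeff_vfield[of x 1] T.p2 by (simp add: q)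
  obtain m where m: "CHAR('k) = Suc (Suc m)" using T.p2 by (metis Suc_le_D numeral_2_eq_2 Suc_le_mono)
  have m1: "of_nat (Suc m) = (- 1 :: 'k)"
    using of_nat_CHAR[where ?'a = 'k] unfolding m by (simp add: eq_neg_iff_add_eq_0 add_ac)
  have shift: "pCons 0 q * Polynomial.monom 1 m = Polynomial.monom 1 (Suc m) * q" by (simp add: monom_Suc)
  have ring: "Polynomial.smult (- 1) (t * q) + y * t = t * (y - q)" for t y :: "'k poly" by (simp add: algebra_simps)
  have top: "d.top_vec = Polynomial.monom 1 (Suc m)" by (simp add: d.top_vec_def m)
  have "pderiv d.top_vec = Polynomial.smult (- 1) (Polynomial.monom 1 m)"
    unfolding top pderiv_monom m1 smult_monom by simp
  then have "density (w + 1) (vfield x) d.top_vec = pCons 0 q * Polynomial.smult (- 1) (Polynomial.monom 1 m)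
      + Polynomial.smult (w + 1) (q + pCons 0 (pderiv q)) * Polynomial.monom 1 (Suc m)"
    by (simp only: density_def q pderiv_pCons top)
  also have "\<dots> = Polynomial.monom 1 (Suc m) * (Polynomial.smult (w + 1) (q + pCons 0 (pderiv q)) - q)"
    unfolding mult_smult_right shift by (rule ring)
  finally have eq: "density (w + 1) (vfield x) d.top_vec = Polynomial.monom 1 (Suc m) * (Polynomial.smult (w + 1) (q + pCons 0 (pderiv q)) - q)" .
  have "Polynomial.coeff (density (w + 1) (vfield x) d.top_vec) n = (if n = Suc m then w * Poly_Mapping.lookup x 0 else 0)"
    if "n < CHAR('k)" for n
    using that unfolding eq coeff_monom_mult m by (auto simp: q0 algebra_simps)
  then show ?thesis unfolding XP_dvd_iff by (auto simp: top)
qed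

lemma borel_word_top:
  assumes "set u \<subseteq> witt_borel"
  shows "XP dvd (foldr (\<lambda>x. density (w + 1) (vfield (id x))) u d.top_vec
    - Polynomial.smult (foldr (\<lambda>x v. w * Poly_Mapping.lookup x 0 * v) u 1) d.top_vec)"
  using assms
proof (induction u)
  case (Cons x u)
  let ?r = "foldr (\<lambda>x. density (w + 1) (vfield (id x))) u d.top_vec" and ?e = "foldr (\<lambda>x v. w * Poly_Mapping.lookup x 0 * v) u 1"
  have "XP dvd (density (w + 1) (vfield x) ?r - density (w + 1) (vfield x) (Polynomial.smult ?e d.top_vec))"
    using Cons by (intro density_cong) simp_all
  moreover have "XP dvd Polynomial.smult ?e (density (w + 1) (vfield x) d.top_vec - Polynomial.smult (w * Poly_Mapping.lookup x 0) d.top_vec)"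
    by (rule dvd_smult, rule borel_top) (use Cons in simp)
  ultimately have "XP dvd ((density (w + 1) (vfield x) ?r - density (w + 1) (vfield x) (Polynomial.smult ?e d.top_vec))
    + Polynomial.smult ?e (density (w + 1) (vfield x) d.top_vec - Polynomial.smult (w * Poly_Mapping.lookup x 0) d.top_vec))"
    by (rule dvd_add)
  then show ?case by (simp add: density_smult_v smult_diff_right mult_ac del: B.scale_scale)
qed simp

lemma act_borel_top:
  assumes "f \<in> carrier B.F"
  shows "dact (T.cls f) d.top_vec = Polynomial.smult (\<epsilon> f) d.top_vec"
proof -
  have "R.ac f d.top_vec - Polynomial.smult (\<epsilon> f) d.top_vec = (\<Sum>u\<in>Poly_Mapping.keys f. Polynomial.smult (Poly_Mapping.lookup f u)
     (foldr (\<lambda>x. density (w + 1) (vfield (id x))) u d.top_vec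
    - Polynomial.smult (foldr (\<lambda>x v. w * Poly_Mapping.lookup x 0 * v) u 1) d.top_vec))"
    by (simp add: act_def \<epsilon>_def smult_diff_right sum_subtractf smult_sum)
  also have "XP dvd \<dots>"
    using assms by (intro dvd_sum dvd_smult borel_word_top) (auto simp: B.F_carrier)
  finally have "dact (T.cls f) d.top_vec = Polynomial.smult (\<epsilon> f) d.top_vec mod XP"
    using borel_F[OF assms] by (simp add: T.dact_cls[OF c] mod_XP_eq_iff)
  then show ?thesis using d.Vp_smult[OF d.Vp_top] by simp
qed

section \<open>The tensor product\<close>

text \<open>
  The identity automorphism has to remain visible as an argument of the locale constants.
\<close>

declare id_apply [simp del]

abbreviation "FA \<equiv> free_Abelian_group (carrier A \<times> carrier k_w)"
abbreviation "TS \<equiv> tensor_subgroup A B \<iota> k_w"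

text \<open>
  The map \<open>a \<otimes> t \<mapsto> t (a X\<^bsup>p-1\<^esup>)\<close> on the free abelian group whose quotient is the tensor product.
\<close>

definition val :: "('k red \<times> 'k \<Rightarrow>\<^sub>0 int) \<Rightarrow> 'k poly" where
  "val x = (\<Sum>k\<in>Poly_Mapping.keys x. Polynomial.smult (of_int (Poly_Mapping.lookup x k) * snd k) (dact (fst k) d.top_vec))"

lemma val_superset: "finite S \<Longrightarrow> Poly_Mapping.keys x \<subseteq> S \<Longrightarrow>
    val x = (\<Sum>k\<in>S. Polynomial.smult (of_int (Poly_Mapping.lookup x k) * snd k) (dact (fst k) d.top_vec))"
  unfolding val_def by (rule sum.mono_neutral_left) (auto simp: in_keys_iff)

lemma val_add: "val (x + y) = val x + val y"
  by (subst (1 2 3) val_superset[of "Poly_Mapping.keys x \<union> Poly_Mapping.keys y"])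
    (auto simp: Poly_Mapping.keys_add lookup_add sum.distrib[symmetric] smult_add_left distrib_right intro!: sum.cong)

lemma val_0: "val 0 = 0" by (simp add: val_def)

lemma val_uminus: "val (- x) = - val x"
  using val_add[of x "- x"] by (simp add: val_0 eq_neg_iff_add_eq_0 add.commute)

lemma val_diff: "val (x - y) = val x - val y"
  using val_add[of x "- y"] by (simp add: val_uminus)

lemma val_of: "val (frag_of (a, t)) = Polynomial.smult t (dact a d.top_vec)"
  by (subst val_superset[of "{(a, t)}"]) auto

lemma dact_Vp: "a \<in> carrier A \<Longrightarrow> d.Vp (dact a d.top_vec)"
  by (rule d.dact_mod) (simp_all add: d.Vp_top)

lemma FA_group: "comm_group FA" by (rule abelian_free_Abelian_group)

interpretation FA: comm_group FA by (rule FA_group)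

lemma FA_carrier: "x \<in> carrier FA \<longleftrightarrow> Poly_Mapping.keys x \<subseteq> carrier A \<times> UNIV"
  by (simp add: k_w_simps)

lemma FA_of: "a \<in> carrier A \<Longrightarrow> frag_of (a, t) \<in> carrier FA"
  by (simp add: k_w_simps)

lemma FA_diff: "x \<in> carrier FA \<Longrightarrow> y \<in> carrier FA \<Longrightarrow> x - y \<in> carrier FA"
  using keys_diff[of x y] by (auto simp: FA_carrier)

lemma B_carrier_cls: "r \<in> carrier B \<Longrightarrow> \<exists>f\<in>carrier B.F. r = B.cls f"
  using B.A_carrier by auto

lemma \<iota>_closed: "r \<in> carrier B \<Longrightarrow> \<iota> r \<in> carrier A"
  using B_carrier_cls borel_F \<iota>_cls by fastforce

lemma relations_FA: "tensor_relations A B \<iota> k_w \<subseteq> carrier FA"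
  unfolding tensor_relations_def
  by (auto intro!: FA_diff FA_of simp: \<iota>_closed simp del: carrier_free_Abelian_group_iff)

lemma relations_val: "x \<in> tensor_relations A B \<iota> k_w \<Longrightarrow> val x = 0"
proof -
  assume "x \<in> tensor_relations A B \<iota> k_w"
  then consider
      a b n where "a \<in> carrier A" "b \<in> carrier A" "x = frag_of (a \<oplus>\<^bsub>A\<^esub> b, n) - frag_of (a, n) - frag_of (b, n)"
    | a m n where "a \<in> carrier A" "x = frag_of (a, m + n) - frag_of (a, m) - frag_of (a, n)"
    | a r n where "a \<in> carrier A" "r \<in> carrier B" "x = frag_of (a \<otimes>\<^bsub>A\<^esub> \<iota> r, n) - frag_of (a, r \<odot>\<^bsub>k_w\<^esub> n)"
    unfolding tensor_relations_def k_w_simps by blast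
  then show "val x = 0"
  proof cases
    case 1
    then show ?thesis by (simp add: val_diff val_of d.dact_add d.Vp_top smult_add_right)
  next
    case 2
    then show ?thesis by (simp add: val_diff val_of smult_add_left)
  next
    case 3
    obtain f where f: "f \<in> carrier B.F" "r = B.cls f" using B_carrier_cls[OF 3(2)] by blast
    have "dact (a \<otimes>\<^bsub>A\<^esub> T.cls f) d.top_vec = Polynomial.smult (\<epsilon> f) (dact a d.top_vec)"
      using 3 f borel_F by (simp add: d.dact_mult d.Vp_top act_borel_top d.dact_smult)
    then show ?thesis using f 3(3) by (simp add: val_diff val_of \<iota>_cls k_w_smult mult.commute)
  qed
qed

lemma TS_eq: "TS = generate FA (tensor_relations A B \<iota> k_w)"
  by (simp add: tensor_subgroup_def)

lemma TS_subgroup: "subgroup TS FA"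
  unfolding TS_eq by (rule FA.generate_is_subgroup[OF relations_FA])

lemma TS_normal: "TS \<lhd> FA"
  by (rule FA.subgroup_imp_normal[OF TS_subgroup])

lemma TS_carrier: "x \<in> TS \<Longrightarrow> x \<in> carrier FA"
  using subgroup.subset[OF TS_subgroup] by blast

lemma TS_add: "x \<in> TS \<Longrightarrow> y \<in> TS \<Longrightarrow> x + y \<in> TS"
  using subgroup.m_closed[OF TS_subgroup] by simp

lemma TS_uminus: "x \<in> TS \<Longrightarrow> - x \<in> TS"
  using subgroup.m_inv_closed[OF TS_subgroup, of x] TS_carrier[of x] by simp

lemma TS_diff: "x \<in> TS \<Longrightarrow> y \<in> TS \<Longrightarrow> x - y \<in> TS"
  using TS_add[OF _ TS_uminus] by fastforce

lemma TS_0: "0 \<in> TS"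
  using subgroup.one_closed[OF TS_subgroup] by simp

lemma TS_val: "x \<in> TS \<Longrightarrow> val x = 0"
  unfolding TS_eq
proof (induction rule: generate.induct)
  case (inv h)
  then have "h \<in> carrier FA" using relations_FA by blast
  then have "inv\<^bsub>FA\<^esub> h = - h" by simp
  then show ?case using relations_val[OF inv] by (simp add: val_uminus)
qed (simp_all add: val_0 relations_val val_add)

lemma rel_1: "a \<in> carrier A \<Longrightarrow> b \<in> carrier A \<Longrightarrow> frag_of (a \<oplus>\<^bsub>A\<^esub> b, t) - frag_of (a, t) - frag_of (b, t) \<in> TS"
  unfolding TS_eq tensor_relations_def k_w_simps by (rule generate.incl) blast

lemma rel_2: "a \<in> carrier A \<Longrightarrow> frag_of (a, t + u) - frag_of (a, t) - frag_of (a, u) \<in> TS"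
  unfolding TS_eq tensor_relations_def k_w_simps by (rule generate.incl) blast

lemma rel_3:
  assumes "a \<in> carrier A" "f \<in> carrier B.F"
  shows "frag_of (a \<otimes>\<^bsub>A\<^esub> T.cls f, t) - frag_of (a, \<epsilon> f * t) \<in> TS"
proof -
  have "frag_of (a \<otimes>\<^bsub>A\<^esub> \<iota> (B.cls f), t) - frag_of (a, B.cls f \<odot>\<^bsub>k_w\<^esub> t) \<in> tensor_relations A B \<iota> k_w"
    unfolding tensor_relations_def k_w_simps using assms B.A_carrier by blast
  then show ?thesis unfolding TS_eq using assms by (intro generate.incl) (simp add: \<iota>_cls k_w_smult)
qed

lemma TS_zero_l: "frag_of (\<zero>\<^bsub>A\<^esub>, t) \<in> TS"
  using TS_uminus[OF rel_1[of "\<zero>\<^bsub>A\<^esub>" "\<zero>\<^bsub>A\<^esub>" t]] by simp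

lemma TS_zero_r: "a \<in> carrier A \<Longrightarrow> frag_of (a, 0) \<in> TS"
  using TS_uminus[OF rel_2[of a 0 0]] by simp

lemma TS_sum: "a \<in> carrier A \<Longrightarrow> b \<in> carrier A \<Longrightarrow> frag_of (a, t) \<in> TS \<Longrightarrow> frag_of (b, t) \<in> TS \<Longrightarrow> frag_of (a \<oplus>\<^bsub>A\<^esub> b, t) \<in> TS"
  using TS_add[OF TS_add[OF rel_1[of a b t]]] by fastforce

lemma TS_mult_kernel:
  assumes "a \<in> carrier A" "f \<in> carrier B.F" "\<epsilon> f = 0"
  shows "frag_of (a \<otimes>\<^bsub>A\<^esub> T.cls f, t) \<in> TS"
  using TS_add[OF rel_3[OF assms(1,2), of t] TS_zero_r[OF assms(1)]] assms(3) by simp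

lemma e_borel: "n \<le> CHAR('k) - 2 \<Longrightarrow> (witt_e (int n) :: 'k lie) \<in> witt_borel"
  by (simp add: in_borel_iff T.e_in lookup_witt_e)

lemma E_cls: "n \<le> CHAR('k) - 2 \<Longrightarrow> T.E n = T.cls (free_gen (witt_e (int n)))"
  using T.pre(3)[of "witt_e (int n)", unfolded id_apply[of "witt_e (int n)"]] by (simp add: T.E_eq T.tgen_def T.e_in)

text \<open>
  The generators of the left ideal come from \<open>u(b\<^sup>+, \<chi>\<^sub>0)\<close> and act by zero on the one-dimensional module,
  so they can be moved through the tensor sign.
\<close>

lemma J_TS: "b \<in> T.gen.J w \<Longrightarrow> frag_of (b, t) \<in> TS"
proof (induction rule: T.gen.J.induct)
  case zero
  show ?case by (rule TS_zero_l)
next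
  case (E_0 a r)
  let ?f = "free_gen (witt_e 0) - free_scalar w"
  have e: "(witt_e 0 :: 'k lie) \<in> witt_borel" using e_borel[of 0] by simp
  have f: "?f \<in> carrier B.F" using e by (intro B.F_minus_closed) simp_all
  have "T.E 0 \<ominus>\<^bsub>A\<^esub> T.s w = T.cls ?f" using e borel_witt by (subst T.cls_minus) (auto simp: E_cls)
  moreover have "\<epsilon> ?f = 0" by (simp add: \<epsilon>_def B.act_diff lookup_witt_e)
  ultimately have "frag_of (r \<otimes>\<^bsub>A\<^esub> (T.E 0 \<ominus>\<^bsub>A\<^esub> T.s w), t) \<in> TS" using TS_mult_kernel[OF E_0(2) f] by simp
  then show ?case using E_0 T.gen.J_carrier[OF E_0(1)] by (intro TS_sum) simp_all
next
  case (E_i a r i)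
  have "frag_of (r \<otimes>\<^bsub>A\<^esub> T.E i, t) \<in> TS"
  proof (cases "i \<le> CHAR('k) - 2")
    case True
    have "\<epsilon> (free_gen (witt_e (int i))) = 0" using E_i by (simp add: \<epsilon>_def lookup_witt_e)
    then show ?thesis using TS_mult_kernel[OF E_i(2), of "free_gen (witt_e (int i))"] e_borel[OF True] E_cls[OF True] by simp
  next
    case False
    then show ?thesis using E_i TS_zero_l by (simp add: T.gen.E_high)
  qed
  then show ?case using E_i T.gen.J_carrier[OF E_i(1)] by (intro TS_sum) simp_all
qed

lemma reduce_frag:
  assumes "x \<in> carrier FA"
  shows "\<exists>b\<in>carrier A. x - frag_of (b, 1) \<in> TS"
  using assms[unfolded carrier_free_Abelian_group_iff]
proof (induction x rule: frag_induction)
  case zero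
  show ?case using TS_uminus[OF TS_zero_l] by (intro bexI[of _ "\<zero>\<^bsub>A\<^esub>"]) simp_all
next
  case (one k)
  obtain a t where k: "k = (a, t)" "a \<in> carrier A" using one by (cases k) auto
  have "frag_of (a \<otimes>\<^bsub>A\<^esub> T.s t, 1) - frag_of (a, t) \<in> TS"
    using rel_3[OF k(2), of "free_scalar t" 1] by (simp add: \<epsilon>_def)
  from TS_uminus[OF this] show ?case using k by (intro bexI[of _ "a \<otimes>\<^bsub>A\<^esub> T.s t"]) simp_all
next
  case (diff x y)
  then obtain a b where ab: "a \<in> carrier A" "x - frag_of (a, 1) \<in> TS" "b \<in> carrier A" "y - frag_of (b, 1) \<in> TS" by blast
  have "(a \<ominus>\<^bsub>A\<^esub> b) \<oplus>\<^bsub>A\<^esub> b = a" using ab by (simp add: a_minus_def T.A.a_assoc T.A.l_neg)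
  then have "frag_of (a, 1) - frag_of (a \<ominus>\<^bsub>A\<^esub> b, 1) - frag_of (b, 1) \<in> TS"
    using rel_1[of "a \<ominus>\<^bsub>A\<^esub> b" b 1] ab by simp
  from TS_add[OF TS_diff[OF ab(2,4)] this] show ?case
    using ab by (intro bexI[of _ "a \<ominus>\<^bsub>A\<^esub> b"]) (simp_all add: algebra_simps)
qed

text \<open>
  Injectivity of the map from the tensor product to the density module: every element of the tensor
  product has the form \<open>b \<otimes> 1\<close>, and if \<open>b\<close> annihilates \<open>X\<^bsup>p-1\<^esup>\<close>, it lies in the left ideal.
\<close>

lemma val_eq_0:
  assumes x: "x \<in> carrier FA" and 0: "val x = 0"
  shows "x \<in> TS"
proof -
  obtain b where b: "b \<in> carrier A" "x - frag_of (b, 1) \<in> TS" using reduce_frag[OF x] by blast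
  have "dact b d.top_vec = 0" using TS_val[OF b(2)] 0 by (simp add: val_diff val_of)
  then have "b \<in> T.gen.J w" using d.annihilator[OF b(1)] by simp
  from TS_add[OF b(2) J_TS[OF this, of 1]] show ?thesis by simp
qed

lemma val_Vp: "x \<in> carrier FA \<Longrightarrow> d.Vp (val x)"
  unfolding d.Vp_iff val_def coeff_sum
  using dact_Vp unfolding d.Vp_iff FA_carrier by (auto intro!: sum.neutral)

definition \<psi> :: "'k ind \<Rightarrow> 'k poly" where "\<psi> X = val (SOME x. x \<in> X)"

lemma coset_mem: "y \<in> TS #>\<^bsub>FA\<^esub> x \<longleftrightarrow> (\<exists>u\<in>TS. y = u + x)"
  by (auto simp: r_coset_def)

lemma rep_mem: "(SOME y. y \<in> TS #>\<^bsub>FA\<^esub> x) \<in> TS #>\<^bsub>FA\<^esub> x"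
  by (rule someI[of _ x]) (use TS_0 in \<open>auto simp: coset_mem intro!: bexI[of _ 0]\<close>)

lemma \<psi>_coset: "\<psi> (TS #>\<^bsub>FA\<^esub> x) = val x"
  using rep_mem[of x] by (auto simp: \<psi>_def coset_mem val_add TS_val)

lemma L_carrier: "carrier L = (\<lambda>x. TS #>\<^bsub>FA\<^esub> x) ` carrier FA"
  by (auto simp: induced_module_def Let_def FactGroup_def RCOSETS_def)

lemma L_add: "x \<in> carrier FA \<Longrightarrow> y \<in> carrier FA \<Longrightarrow> (TS #>\<^bsub>FA\<^esub> x) \<oplus>\<^bsub>L\<^esub> (TS #>\<^bsub>FA\<^esub> y) = TS #>\<^bsub>FA\<^esub> (x + y)"
  using normal.rcos_sum[OF TS_normal, of x y] by (simp add: induced_module_def Let_def FactGroup_def)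

lemma L_zero: "\<zero>\<^bsub>L\<^esub> = TS #>\<^bsub>FA\<^esub> 0"
proof -
  have "TS #>\<^bsub>FA\<^esub> 0 = TS" by (auto simp: r_coset_def)
  then show ?thesis by (simp add: induced_module_def Let_def FactGroup_def)
qed

definition mult_frag :: "'k red \<Rightarrow> ('k red \<times> 'k \<Rightarrow>\<^sub>0 int) \<Rightarrow> ('k red \<times> 'k \<Rightarrow>\<^sub>0 int)" where
  "mult_frag a = frag_extend (\<lambda>(b, n). frag_of (a \<otimes>\<^bsub>A\<^esub> b, n))"

lemma mult_frag:
  assumes a: "a \<in> carrier A" and x: "x \<in> carrier FA"
  shows "mult_frag a x \<in> carrier FA \<and> val (mult_frag a x) = dact a (val x)"
proof -
  have "x \<in> carrier FA \<and> mult_frag a x \<in> carrier FA \<and> val (mult_frag a x) = dact a (val x)"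
    using x[unfolded carrier_free_Abelian_group_iff]
  proof (induction x rule: frag_induction)
    case zero
    show ?case using a by (simp add: mult_frag_def val_0 d.dact_0)
  next
    case (one k)
    obtain b t where k: "k = (b, t)" "b \<in> carrier A" using one by (cases k) auto
    have "mult_frag a (frag_of k) = frag_of (a \<otimes>\<^bsub>A\<^esub> b, t)" by (simp add: mult_frag_def k)
    then show ?case using a k dact_Vp FA_of
      by (simp add: val_of d.dact_mult d.Vp_top d.dact_smult del: carrier_free_Abelian_group_iff)
  next
    case (diff x y)
    have "mult_frag a (x - y) = mult_frag a x - mult_frag a y" by (simp add: mult_frag_def frag_extend_diff)
    then show ?case using diff a
      by (simp add: FA_diff val_diff d.dact_diff val_Vp del: carrier_free_Abelian_group_iff)
  qed
  then show ?thesis by blast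
qed

lemma L_smult:
  assumes a: "a \<in> carrier A" and X: "X \<in> carrier L"
  shows "a \<odot>\<^bsub>L\<^esub> X \<in> carrier L" "\<psi> (a \<odot>\<^bsub>L\<^esub> X) = dact a (\<psi> X)"
proof -
  obtain x where x: "x \<in> carrier FA" "X = TS #>\<^bsub>FA\<^esub> x" using X by (auto simp: L_carrier)
  let ?y = "SOME y. y \<in> X"
  have y: "?y \<in> carrier FA"
  proof -
    have "?y \<in> TS #>\<^bsub>FA\<^esub> x" unfolding x(2) by (rule rep_mem)
    then obtain u where u: "u \<in> TS" "?y = u + x" unfolding coset_mem by blast
    show ?thesis using FA.m_closed[OF TS_carrier[OF u(1)] x(1)] unfolding u(2) mult_free_Abelian_group .
  qed
  have eq: "a \<odot>\<^bsub>L\<^esub> X = TS #>\<^bsub>FA\<^esub> mult_frag a ?y"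
    by (simp add: induced_module_def Let_def mult_frag_def)
  show "a \<odot>\<^bsub>L\<^esub> X \<in> carrier L" unfolding eq L_carrier using mult_frag[OF a y] by blast
  show "\<psi> (a \<odot>\<^bsub>L\<^esub> X) = dact a (\<psi> X)" unfolding eq \<psi>_coset using mult_frag[OF a y] by (simp add: \<psi>_def)
qed

theorem L_iso:
  "bij_betw \<psi> (carrier L) {v. d.Vp v}"
  "X \<in> carrier L \<Longrightarrow> Y \<in> carrier L \<Longrightarrow> X \<oplus>\<^bsub>L\<^esub> Y \<in> carrier L"
  "X \<in> carrier L \<Longrightarrow> Y \<in> carrier L \<Longrightarrow> \<psi> (X \<oplus>\<^bsub>L\<^esub> Y) = \<psi> X + \<psi> Y"
  "\<zero>\<^bsub>L\<^esub> \<in> carrier L" "\<psi> \<zero>\<^bsub>L\<^esub> = 0"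
proof -
  have inj: "inj_on \<psi> (carrier L)"
  proof (rule inj_onI)
    fix X Y assume "X \<in> carrier L" "Y \<in> carrier L" and eq: "\<psi> X = \<psi> Y"
    then obtain x y where xy: "x \<in> carrier FA" "y \<in> carrier FA" "X = TS #>\<^bsub>FA\<^esub> x" "Y = TS #>\<^bsub>FA\<^esub> y"
      by (auto simp: L_carrier)
    have "val (x - y) = 0" using eq xy by (simp add: \<psi>_coset val_diff)
    then have u: "x - y \<in> TS" by (rule val_eq_0[OF FA_diff[OF xy(1,2)]])
    have "x \<in> TS #>\<^bsub>FA\<^esub> y" unfolding coset_mem by (rule bexI[OF _ u]) simp
    from FA.repr_independence[OF this xy(2) TS_subgroup] show "X = Y" using xy by simp
  qed
  have "\<psi> ` carrier L = {v. d.Vp v}"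
  proof (intro equalityI subsetI)
    fix v assume "v \<in> \<psi> ` carrier L"
    then show "v \<in> {v. d.Vp v}" using val_Vp by (auto simp: L_carrier \<psi>_coset)
  next
    fix v assume "v \<in> {v. d.Vp v}"
    then obtain a where a: "a \<in> carrier A" "dact a d.top_vec = v" using d.cyclic by blast
    then have "\<psi> (TS #>\<^bsub>FA\<^esub> frag_of (a, 1)) = v" by (simp add: \<psi>_coset val_of)
    then show "v \<in> \<psi> ` carrier L" using FA_of[OF a(1), of 1] unfolding L_carrier by blast
  qed
  with inj show "bij_betw \<psi> (carrier L) {v. d.Vp v}" by (simp add: bij_betw_def)
  show "X \<oplus>\<^bsub>L\<^esub> Y \<in> carrier L" "\<psi> (X \<oplus>\<^bsub>L\<^esub> Y) = \<psi> X + \<psi> Y" if XY: "X \<in> carrier L" "Y \<in> carrier L"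
  proof -
    obtain x y where xy: "x \<in> carrier FA" "y \<in> carrier FA" "X = TS #>\<^bsub>FA\<^esub> x" "Y = TS #>\<^bsub>FA\<^esub> y"
      using XY unfolding L_carrier by blast
    then have eq: "X \<oplus>\<^bsub>L\<^esub> Y = TS #>\<^bsub>FA\<^esub> (x + y)" by (simp only: L_add)
    have "x + y \<in> carrier FA" using FA.m_closed[OF xy(1,2)] by simp
    then show "X \<oplus>\<^bsub>L\<^esub> Y \<in> carrier L" unfolding eq L_carrier by blast
    show "\<psi> (X \<oplus>\<^bsub>L\<^esub> Y) = \<psi> X + \<psi> Y" unfolding eq using xy by (simp add: \<psi>_coset val_add)
  qed
  show "\<zero>\<^bsub>L\<^esub> \<in> carrier L" unfolding L_zero L_carrier using FA.one_closed by auto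
  show "\<psi> \<zero>\<^bsub>L\<^esub> = 0" unfolding L_zero by (simp add: \<psi>_coset val_0)
qed

end

context twisted_character
begin

section \<open>Extensions between the simple modules\<close>

definition models :: "('k red, 'm) module \<Rightarrow> 'k \<Rightarrow> ('m \<Rightarrow> 'k poly) \<Rightarrow> bool" where
  "models M c \<psi> \<longleftrightarrow> bij_betw \<psi> (carrier M) {v. v mod XP = v}
     \<and> (\<forall>x\<in>carrier M. \<forall>y\<in>carrier M. x \<oplus>\<^bsub>M\<^esub> y \<in> carrier M \<and> \<psi> (x \<oplus>\<^bsub>M\<^esub> y) = \<psi> x + \<psi> y)
     \<and> \<zero>\<^bsub>M\<^esub> \<in> carrier M \<and> \<psi> \<zero>\<^bsub>M\<^esub> = 0
     \<and> (\<forall>a\<in>carrier A. \<forall>x\<in>carrier M. a \<odot>\<^bsub>M\<^esub> x \<in> carrier M \<and> \<psi> (a \<odot>\<^bsub>M\<^esub> x) = dact c a (\<psi> x))"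

lemma modelsD:
  assumes "models M c \<psi>"
  shows "x \<in> carrier M \<Longrightarrow> \<psi> x mod XP = \<psi> x"
    "x \<in> carrier M \<Longrightarrow> y \<in> carrier M \<Longrightarrow> \<psi> x = \<psi> y \<Longrightarrow> x = y"
    "v mod XP = v \<Longrightarrow> inv_into (carrier M) \<psi> v \<in> carrier M"
    "v mod XP = v \<Longrightarrow> \<psi> (inv_into (carrier M) \<psi> v) = v"
    "x \<in> carrier M \<Longrightarrow> y \<in> carrier M \<Longrightarrow> x \<oplus>\<^bsub>M\<^esub> y \<in> carrier M"
    "x \<in> carrier M \<Longrightarrow> y \<in> carrier M \<Longrightarrow> \<psi> (x \<oplus>\<^bsub>M\<^esub> y) = \<psi> x + \<psi> y"
    "\<zero>\<^bsub>M\<^esub> \<in> carrier M" "\<psi> \<zero>\<^bsub>M\<^esub> = 0"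
    "a \<in> carrier A \<Longrightarrow> x \<in> carrier M \<Longrightarrow> a \<odot>\<^bsub>M\<^esub> x \<in> carrier M"
    "a \<in> carrier A \<Longrightarrow> x \<in> carrier M \<Longrightarrow> \<psi> (a \<odot>\<^bsub>M\<^esub> x) = dact c a (\<psi> x)"
proof -
  have bij: "bij_betw \<psi> (carrier M) {v. v mod XP = v}" using assms by (simp add: models_def)
  have im: "\<psi> ` carrier M = {v. v mod XP = v}" and inj: "inj_on \<psi> (carrier M)"
    using bij by (auto simp: bij_betw_def)
  show "x \<in> carrier M \<Longrightarrow> \<psi> x mod XP = \<psi> x" using im by blast
  show "x \<in> carrier M \<Longrightarrow> y \<in> carrier M \<Longrightarrow> \<psi> x = \<psi> y \<Longrightarrow> x = y" using inj by (auto dest: inj_onD)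
  show "v mod XP = v \<Longrightarrow> inv_into (carrier M) \<psi> v \<in> carrier M" by (rule inv_into_into) (simp add: im)
  show "v mod XP = v \<Longrightarrow> \<psi> (inv_into (carrier M) \<psi> v) = v" by (rule f_inv_into_f) (simp add: im)
qed (use assms in \<open>simp_all add: models_def\<close>)

lemma models_left_module:
  assumes c: "c ^ CHAR('k) - c = 1" and m: "models M c \<psi>"
  shows "left_module A M"
proof -
  interpret d: density_action A s E D c "dact c" by (rule density_action[OF c])
  note md = modelsD[OF m]
  note eqI = md(2)
  have "abelian_group M"
  proof (rule abelian_groupI)
    fix x assume x: "x \<in> carrier M"
    let ?y = "inv_into (carrier M) \<psi> (- \<psi> x)"
    have V: "d.Vp (- \<psi> x)" using d.Vp_diff[OF d.Vp_0 md(1)[OF x]] by simp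
    have y: "?y \<in> carrier M" "\<psi> ?y = - \<psi> x" by (rule md(3)[OF V], rule md(4)[OF V])
    have "?y \<oplus>\<^bsub>M\<^esub> x = \<zero>\<^bsub>M\<^esub>" by (rule eqI) (simp_all add: md x y)
    then show "\<exists>y\<in>carrier M. y \<oplus>\<^bsub>M\<^esub> x = \<zero>\<^bsub>M\<^esub>" using y by blast
    show "\<zero>\<^bsub>M\<^esub> \<oplus>\<^bsub>M\<^esub> x = x" by (rule eqI) (simp_all add: md x)
  next
    fix x y assume xy: "x \<in> carrier M" "y \<in> carrier M"
    show "x \<oplus>\<^bsub>M\<^esub> y = y \<oplus>\<^bsub>M\<^esub> x" by (rule eqI) (simp_all add: md xy add.commute)
    fix z assume z: "z \<in> carrier M"
    show "x \<oplus>\<^bsub>M\<^esub> y \<oplus>\<^bsub>M\<^esub> z = x \<oplus>\<^bsub>M\<^esub> (y \<oplus>\<^bsub>M\<^esub> z)" by (rule eqI) (simp_all add: md xy z add.assoc)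
  qed (simp_all add: md)
  then show ?thesis
  proof (intro left_module.intro left_module_axioms.intro A.ring_axioms)
    fix a x assume a: "a \<in> carrier A" and x: "x \<in> carrier M"
    show "a \<odot>\<^bsub>M\<^esub> x \<in> carrier M" by (rule md(9)[OF a x])
    fix b assume b: "b \<in> carrier A"
    show "(a \<oplus>\<^bsub>A\<^esub> b) \<odot>\<^bsub>M\<^esub> x = a \<odot>\<^bsub>M\<^esub> x \<oplus>\<^bsub>M\<^esub> b \<odot>\<^bsub>M\<^esub> x"
      by (rule eqI) (simp_all add: md a b x d.dact_add)
    show "(a \<otimes>\<^bsub>A\<^esub> b) \<odot>\<^bsub>M\<^esub> x = a \<odot>\<^bsub>M\<^esub> (b \<odot>\<^bsub>M\<^esub> x)"
      by (rule eqI) (simp_all add: md a b x d.dact_mult)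
  next
    fix a x y assume a: "a \<in> carrier A" and xy: "x \<in> carrier M" "y \<in> carrier M"
    show "a \<odot>\<^bsub>M\<^esub> (x \<oplus>\<^bsub>M\<^esub> y) = a \<odot>\<^bsub>M\<^esub> x \<oplus>\<^bsub>M\<^esub> a \<odot>\<^bsub>M\<^esub> y"
      by (rule eqI) (simp_all add: md a xy d.dact_v_add)
  next
    fix x assume x: "x \<in> carrier M"
    show "\<one>\<^bsub>A\<^esub> \<odot>\<^bsub>M\<^esub> x = x" by (rule eqI) (simp_all add: md x d.dact_one)
  qed
qed

text \<open>
  The generator of \<open>M\<close> is the preimage of the top vector, so homomorphisms from its annihilator to \<open>N\<close>
  become homomorphisms from the left ideal to a density module.
\<close>

theorem Ext1_density:
  fixes M :: "('k red, 'm) module" and N :: "('k red, 'n) module"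
  assumes \<mu>: "\<mu> ^ CHAR('k) - \<mu> = 1" and d: "d < CHAR('k)"
    and M: "models M (\<mu> + 1) \<psi>M" and N: "models N (\<mu> + 1 + of_nat d) \<psi>N"
  shows "CHAR('k) = 5 \<and> d \<notin> {2, 3} \<or> CHAR('k) \<ge> 7 \<and> d \<notin> {2, 3, 4} \<Longrightarrow> vs_iso (Ext1 A s M N) zero_space"
    "d \<in> {2, 3} \<or> CHAR('k) \<ge> 7 \<and> d = 4 \<Longrightarrow> vs_iso (Ext1 A s M N) line"
proof -
  have cM: "(\<mu> + 1) ^ CHAR('k) - (\<mu> + 1) = 1" using artin_schreier_shift[OF p0 \<mu>, of 1] by simp
  have cN: "(\<mu> + 1 + of_nat d) ^ CHAR('k) - (\<mu> + 1 + of_nat d) = 1" by (rule artin_schreier_shift[OF p0 cM])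
  have c_eq: "\<mu> + 1 + of_nat d = \<mu> + of_nat d + 1" by simp
  interpret dM: density_action A s E D "\<mu> + 1" "dact (\<mu> + 1)" by (rule density_action[OF cM])
  interpret dN: density_action A s E D "\<mu> + 1 + of_nat d" "dact (\<mu> + 1 + of_nat d)" by (rule density_action[OF cN])
  interpret LM: left_module A M by (rule models_left_module[OF cM M])
  interpret LN: left_module A N by (rule models_left_module[OF cN N])
  note mM = modelsD[OF M] and mN = modelsD[OF N]
  define m0 where "m0 = inv_into (carrier M) \<psi>M dM.top_vec"
  have m0: "m0 \<in> carrier M" "\<psi>M m0 = dM.top_vec"
    unfolding m0_def by (rule mM(3)[OF dM.Vp_top], rule mM(4)[OF dM.Vp_top])
  interpret X: ext_pair A M N s m0
  proof
    fix x assume x: "x \<in> carrier M"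
    obtain a where a: "a \<in> carrier A" "dact (\<mu> + 1) a dM.top_vec = \<psi>M x" using dM.cyclic[OF mM(1)[OF x]] by blast
    have "a \<odot>\<^bsub>M\<^esub> m0 = x" by (rule mM(2)) (simp_all add: mM a x m0)
    then show "\<exists>a\<in>carrier A. a \<odot>\<^bsub>M\<^esub> m0 = x" using a by blast
  qed (fact s_add s_mult s_one s_central m0(1) | simp)+
  have ann: "X.ann = gen.J \<mu>"
  proof -
    have "a \<odot>\<^bsub>M\<^esub> m0 = \<zero>\<^bsub>M\<^esub> \<longleftrightarrow> a \<in> gen.J \<mu>" if a: "a \<in> carrier A" for a
    proof -
      have "a \<odot>\<^bsub>M\<^esub> m0 = \<zero>\<^bsub>M\<^esub> \<longleftrightarrow> \<psi>M (a \<odot>\<^bsub>M\<^esub> m0) = 0"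
        using mM(2)[of "a \<odot>\<^bsub>M\<^esub> m0" "\<zero>\<^bsub>M\<^esub>"] mM(7,8) mM(9)[OF a m0(1)] by auto
      also have "\<dots> \<longleftrightarrow> a \<in> gen.J \<mu>" using dM.annihilator[OF a] by (simp add: mM a m0)
      finally show ?thesis .
    qed
    then show ?thesis using gen.J_carrier by (auto simp: X.ann_def)
  qed
  have hom: "dN.J_hom \<mu> (\<lambda>a. \<psi>N (g a))" if "X.is_hom g" for g
    using that unfolding X.is_hom_def dN.J_hom_def ann by (simp add: mN)
  let ?inv = "inv_into (carrier N) \<psi>N"
  show "vs_iso (Ext1 A s M N) zero_space" if exc: "CHAR('k) = 5 \<and> d \<notin> {2, 3} \<or> CHAR('k) \<ge> 7 \<and> d \<notin> {2, 3, 4}"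
  proof (rule X.Ext1_zero)
    fix g assume g: "X.is_hom g"
    obtain y where y: "dN.Vp y" "\<And>a. a \<in> gen.J \<mu> \<Longrightarrow> \<psi>N (g a) = dact (\<mu> + 1 + of_nat d) a y"
      using dN.every_hom_principal[OF c_eq d hom[OF g] exc] by blast
    have "g a = a \<odot>\<^bsub>N\<^esub> ?inv y" if a: "a \<in> X.ann" for a
    proof (rule mN(2))
      show "g a \<in> carrier N" using g a by (simp add: X.is_hom_def)
      have aA: "a \<in> carrier A" using a by (simp add: X.ann_def)
      show "a \<odot>\<^bsub>N\<^esub> ?inv y \<in> carrier N" by (rule mN(9)[OF aA mN(3)[OF y(1)]])
      show "\<psi>N (g a) = \<psi>N (a \<odot>\<^bsub>N\<^esub> ?inv y)" using a y by (simp add: mN(10)[OF aA mN(3)[OF y(1)]] mN(4)[OF y(1)] ann)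
    qed
    then show "\<exists>y\<in>carrier N. \<forall>a\<in>X.ann. g a = a \<odot>\<^bsub>N\<^esub> y" using mN(3)[OF y(1)] by blast
  qed
  show "vs_iso (Ext1 A s M N) line" if dd: "d \<in> {2, 3} \<or> CHAR('k) \<ge> 7 \<and> d = 4"
  proof -
    have d3: "d \<in> {2, 3, 4}" "d \<noteq> 0" using dd by auto
    let ?k = "coc_hom d (\<mu> + 1)"
    have k: "dN.J_hom \<mu> ?k" "?k (E 0 \<ominus>\<^bsub>A\<^esub> s \<mu>) = 0" "?k (E 1) = 0" "?k (E 2) \<noteq> 0"
      using coc_J_hom[OF cM d3(1)] coc_E[OF cM d3(1)] coc_E2[OF cM d3(1)] dd by auto
    let ?g = "\<lambda>a. ?inv (?k a)"
    have kV: "dN.Vp (?k a)" if "a \<in> gen.J \<mu>" for a using k(1) that by (simp add: dN.J_hom_def)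
    note ginv = mN(3)[OF kV] mN(4)[OF kV]
    have gh: "X.is_hom ?g"
      unfolding X.is_hom_def ann
    proof (intro conjI ballI)
      fix a assume a: "a \<in> gen.J \<mu>"
      show "?g a \<in> carrier N" by (rule ginv[OF a])
      fix b assume b: "b \<in> gen.J \<mu>"
      show "?g (a \<oplus>\<^bsub>A\<^esub> b) = ?g a \<oplus>\<^bsub>N\<^esub> ?g b"
        by (rule mN(2)) (simp_all add: ginv a b gen.J_add mN dN.J_homD(2)[OF k(1)] dN.Vp_add[OF kV[OF a] kV[OF b]])
    next
      fix r a assume r: "r \<in> carrier A" and a: "a \<in> gen.J \<mu>"
      show "?g (r \<otimes>\<^bsub>A\<^esub> a) = r \<odot>\<^bsub>N\<^esub> ?g a"
        by (rule mN(2)) (simp_all add: ginv a r gen.J_mult mN dN.J_homD(3)[OF k(1)] dN.dact_mod[OF r kV[OF a]])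
    qed
    show ?thesis
    proof (rule X.Ext1_line[OF gh])
      show "\<not> (\<exists>y\<in>carrier N. \<forall>a\<in>X.ann. ?g a = a \<odot>\<^bsub>N\<^esub> y)"
      proof
        assume "\<exists>y\<in>carrier N. \<forall>a\<in>X.ann. ?g a = a \<odot>\<^bsub>N\<^esub> y"
        then obtain y where y: "y \<in> carrier N" "\<And>a. a \<in> gen.J \<mu> \<Longrightarrow> ?g a = a \<odot>\<^bsub>N\<^esub> y" unfolding ann by blast
        have "?k a = dact (\<mu> + 1 + of_nat d) a (\<psi>N y)" if a: "a \<in> gen.J \<mu>" for a
          using ginv(2)[OF a] y(2)[OF a] mN(10)[OF gen.J_carrier[OF a] y(1)] by simp
        then show False using dN.hom_not_principal[OF c_eq d d3(2) k(2,3,4)] mN(1)[OF y(1)] by blast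
      qed
    next
      fix g assume g: "X.is_hom g"
      obtain t y where y: "dN.Vp y" "\<And>a. a \<in> gen.J \<mu> \<Longrightarrow> \<psi>N (g a) = dact (\<mu> + 1 + of_nat d) a y + Polynomial.smult t (?k a)"
        using dN.hom_multiple[OF c_eq d hom[OF g] k] by blast
      have "g a = a \<odot>\<^bsub>N\<^esub> ?inv y \<oplus>\<^bsub>N\<^esub> s t \<odot>\<^bsub>N\<^esub> ?g a" if a: "a \<in> X.ann" for a
      proof (rule mN(2))
        have aJ: "a \<in> gen.J \<mu>" and aA: "a \<in> carrier A" using a by (simp_all add: ann X.ann_def[symmetric]) (simp add: ann gen.J_carrier)
        show "g a \<in> carrier N" using g a by (simp add: X.is_hom_def)
        have yN: "?inv y \<in> carrier N" "\<psi>N (?inv y) = y" by (rule mN(3)[OF y(1)], rule mN(4)[OF y(1)])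
        show "a \<odot>\<^bsub>N\<^esub> ?inv y \<oplus>\<^bsub>N\<^esub> s t \<odot>\<^bsub>N\<^esub> ?g a \<in> carrier N"
          by (intro mN(5,9) ginv yN aA aJ) simp
        show "\<psi>N (g a) = \<psi>N (a \<odot>\<^bsub>N\<^esub> ?inv y \<oplus>\<^bsub>N\<^esub> s t \<odot>\<^bsub>N\<^esub> ?g a)"
          using ginv[OF aJ] yN aA by (simp add: mN(6,9,10) y(2)[OF aJ] dN.dact_s kV[OF aJ])
      qed
      then show "\<exists>t. \<exists>y\<in>carrier N. \<forall>a\<in>X.ann. g a = a \<odot>\<^bsub>N\<^esub> y \<oplus>\<^bsub>N\<^esub> s t \<odot>\<^bsub>N\<^esub> ?g a"
        using mN(3)[OF y(1)] by blast
    qed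
  qed
qed

text \<open>
  The twist by \<open>\<sigma>\<close> replaces the vector field of \<open>x\<close> by that of \<open>\<sigma> x\<close>.
\<close>

lemma L_mod_models:
  assumes w: "(l + \<xi>) ^ CHAR('k) - (l + \<xi>) = 1"
  shows "\<exists>\<psi>. models (L_mod \<xi> \<chi> \<sigma> l) (l + \<xi> + 1) \<psi>"
proof -
  interpret I: induced "l + \<xi>"
    by (rule induced.intro[OF twisted_id[OF p5]], unfold_locales) (rule w)
  interpret R: reduced_representation "witt :: 'k lie set" chi0 Polynomial.smult "\<lambda>x. density (l + \<xi> + 1) (vfield (id x))" "{v. XP dvd v}"
    by (rule I.T.density_representation[OF I.c])
  let ?L = "L_mod \<xi> \<chi> \<sigma> l"
  have L: "L_chi0 \<xi> l = I.L" by (simp add: L_chi0_def)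
  have simps: "carrier ?L = carrier I.L" "x \<oplus>\<^bsub>?L\<^esub> y = x \<oplus>\<^bsub>I.L\<^esub> y" "\<zero>\<^bsub>?L\<^esub> = \<zero>\<^bsub>I.L\<^esub>"
    "a \<odot>\<^bsub>?L\<^esub> x = red_map witt \<chi> witt chi0 \<sigma> a \<odot>\<^bsub>I.L\<^esub> x" for a x y
    by (simp_all add: L_mod_def L)
  have map: "red_map witt \<chi> witt chi0 \<sigma> a \<in> carrier I.T.A"
    "I.T.dact (l + \<xi> + 1) (red_map witt \<chi> witt chi0 \<sigma> a) v = dact (l + \<xi> + 1) a v" if a: "a \<in> carrier A" for a v
  proof -
    let ?f = "free_map \<sigma> (red_rep witt \<chi> a)"
    have f: "?f \<in> carrier I.T.F"
    proof -
      have "Poly_Mapping.keys ?f \<subseteq> map \<sigma> ` Poly_Mapping.keys (red_rep witt \<chi> a)"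
        unfolding free_map_def by (rule order_trans[OF keys_sum]) (auto split: if_splits)
      then show ?thesis using red_rep(1)[OF a] \<sigma>_in unfolding F_carrier I.T.F_carrier by fastforce
    qed
    have eq: "red_map witt \<chi> witt chi0 \<sigma> a = I.T.cls ?f" by (simp add: red_map_def)
    show "red_map witt \<chi> witt chi0 \<sigma> a \<in> carrier I.T.A" unfolding eq using f by (rule I.T.cls.hom_closed)
    show "I.T.dact (l + \<xi> + 1) (red_map witt \<chi> witt chi0 \<sigma> a) v = dact (l + \<xi> + 1) a v"
      unfolding eq I.T.dact_cls[OF I.c f] R.act_free_map by (simp only: dact_def id_apply)
  qed
  have "models ?L (l + \<xi> + 1) I.\<psi>"
    unfolding models_def simps
    by (intro conjI ballI I.L_iso) (simp_all only: I.L_smult map)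
  then show ?thesis by blast
qed

end

theorem theorem4p2:
  fixes p :: nat
    and \<chi> :: "'k::alg_closed_field lie \<Rightarrow> 'k"
    and \<sigma> :: "'k lie \<Rightarrow> 'k lie"
    and \<xi> l m :: 'k
  assumes "CHAR('k) = p" and "p \<ge> 5"
    and "\<chi> \<in> witt_dual" and "height \<chi> = 1"
    and "\<sigma> \<in> witt_aut" and "\<forall>x\<in>witt. \<chi> x = chi0 (\<sigma> x)"
    and "\<xi> ^ p - \<xi> - 1 = 0"
    and "l \<in> range of_int" and "m \<in> range of_int"
  shows "(p = 5 \<longrightarrow>
            vs_iso (Ext1 (red_env witt \<chi>) (red_scalar witt \<chi>) (L_mod \<xi> \<chi> \<sigma> m) (L_mod \<xi> \<chi> \<sigma> l))
              (if l - m \<in> {2, 3} then line else zero_space)) \<and>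
         (p \<ge> 7 \<longrightarrow>
            vs_iso (Ext1 (red_env witt \<chi>) (red_scalar witt \<chi>) (L_mod \<xi> \<chi> \<sigma> m) (L_mod \<xi> \<chi> \<sigma> l))
              (if l - m \<in> {2, 3, 4} then line else zero_space))"
proof -
  interpret T: twisted_character \<chi> \<sigma>
    by unfold_locales (use assms in auto)
  have p: "CHAR('k) = p" by (rule assms(1))
  have AS: "(t + \<xi>) ^ p - (t + \<xi>) = 1" if "t \<in> range of_int" for t :: 'k
    using freshmans_dream[OF T.gen.prime_p refl, of t \<xi>] of_int_pow_CHAR[OF T.p0 that] assms(7) p
    by (simp add: algebra_simps)
  obtain z where z: "l - m = of_int z" using assms(8,9) by (metis imageE of_int_diff)
  define d where "d = nat (z mod int p)"
  have d: "d < p" using assms(2) by (simp add: d_def nat_less_iff)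
  have "(of_int z :: 'k) = of_int (z mod int p) + of_int (int p) * of_int (z div int p)"
    by (metis mult_div_mod_eq add.commute of_int_add of_int_mult)
  then have lm: "l - m = of_nat d" using z assms(2) of_nat_CHAR[where ?'a = 'k] by (simp add: d_def p)
  have small: "l - m = of_nat n \<longleftrightarrow> d = n" if "n < p" for n
    using of_nat_inj_CHAR[where ?'k = 'k, of d n] d that lm p by auto
  have sm: "l - m = 2 \<longleftrightarrow> d = 2" "l - m = 3 \<longleftrightarrow> d = 3" "l - m = 4 \<longleftrightarrow> d = 4"
    using small[of 2] small[of 3] small[of 4] assms(2) by simp_all
  obtain \<psi>M where M: "T.models (L_mod \<xi> \<chi> \<sigma> m) (m + \<xi> + 1) \<psi>M"
    using T.L_mod_models[of m \<xi>] AS[OF assms(9)] p by auto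
  obtain \<psi>N where N: "T.models (L_mod \<xi> \<chi> \<sigma> l) (l + \<xi> + 1) \<psi>N"
    using T.L_mod_models[of l \<xi>] AS[OF assms(8)] p by auto
  have "l + \<xi> + 1 = m + \<xi> + 1 + of_nat d" using lm by (simp add: algebra_simps)
  then have N': "T.models (L_mod \<xi> \<chi> \<sigma> l) (m + \<xi> + 1 + of_nat d) \<psi>N" using N by (simp only:)
  have "red_scalar witt \<chi> = T.s" by (simp add: fun_eq_iff red_scalar_def)
  note Ext = T.Ext1_density[OF AS[OF assms(9), folded p] d[folded p] M N', folded this]
  show ?thesis
  proof (intro conjI impI)
    assume p5: "p = 5"
    show "vs_iso (Ext1 (red_env witt \<chi>) (red_scalar witt \<chi>) (L_mod \<xi> \<chi> \<sigma> m) (L_mod \<xi> \<chi> \<sigma> l))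
        (if l - m \<in> {2, 3} then line else zero_space)"
    proof (cases "d \<in> {2, 3}")
      case True
      then have "l - m \<in> {2, 3}" using sm by simp
      then show ?thesis using Ext(2)[OF disjI1[OF True]] by (simp only: if_True)
    next
      case False
      then have "l - m \<notin> {2, 3}" using sm by simp
      then show ?thesis using Ext(1)[OF disjI1[OF conjI[OF p[unfolded p5] False]]] by (simp only: if_False)
    qed
  next
    assume "p \<ge> 7"
    then have p7: "CHAR('k) \<ge> 7" by (simp add: p)
    show "vs_iso (Ext1 (red_env witt \<chi>) (red_scalar witt \<chi>) (L_mod \<xi> \<chi> \<sigma> m) (L_mod \<xi> \<chi> \<sigma> l))
        (if l - m \<in> {2, 3, 4} then line else zero_space)"
    proof (cases "d \<in> {2, 3, 4}")
      case True
      then have "l - m \<in> {2, 3, 4}" using sm by simp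
      moreover have "d \<in> {2, 3} \<or> CHAR('k) \<ge> 7 \<and> d = 4" using True p7 by blast
      ultimately show ?thesis using Ext(2) by (simp only: if_True)
    next
      case False
      then have "l - m \<notin> {2, 3, 4}" using sm by simp
      then show ?thesis using Ext(1)[OF disjI2[OF conjI[OF p7 False]]] by (simp only: if_False)
    qed
  qed
qed

end
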